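(* Let $n\ge2$ and $1/2<s<n/2$. Then for all $f\in\mathcal{S}(\mathbb{R}^n)$ $$\|f|_{\mathbb{S}^{n-1}}\|_{L^2(\mathbb{S}^{n-1};d\omega)}\le\left(2^{1-2s}\,\frac{\Gamma(2s-1)\,\Gamma(\frac n2-s)}{\Gamma(s)^2\,\Gamma(\frac n2-1+s)}\right)^{1/2}\|f\|_{\dot H^s(\mathbb{R}^n)},$$ and the constant in this estimate cannot be improved, i.e. the inequality for all $f\in\mathcal{S}(\mathbb{R}^n)$ fails if the constant is replaced by any strictly smaller one.
   Context: $\mathbb{S}^{n-1}$ is the unit sphere in $\mathbb{R}^n$ and $d\omega$ its standard (induced) surface measure. With $\widehat f(\xi)=\int_{\mathbb{R}^n}e^{-ix\cdot\xi}f(x)\,dx$, the homogeneous Sobolev norm is $\|f\|_{\dot H^s(\mathbb{R}^n)}=\||D_x|^sf\|_{L^2(\mathbb{R}^n)}$, where $|D_x|^s$ is the Fourier multiplier with symbol $|\xi|^s$, i.e. $\|f\|_{\dot H^s}^2=(2\pi)^{-n}\int_{\mathbb{R}^n}|\xi|^{2s}|\widehat f(\xi)|^2\,d\xi$. $\Gamma$ is the Gamma function. *)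

theory Defs
  imports "HOL-Analysis.Analysis"
begin

section \<open>Schwartz functions\<close>

text \<open>Iterated coordinate partial derivatives; a multi-index is represented by a list of
  elements of \<^const>\<open>Basis\<close>, a vector being repeated according to its multiplicity.\<close>

primrec partials :: "'a::euclidean_space list \<Rightarrow> ('a \<Rightarrow> complex) \<Rightarrow> 'a \<Rightarrow> complex" where
  "partials [] f = f"
| "partials (b # bs) f = (\<lambda>x. frechet_derivative (partials bs f) (at x) b)"

text \<open>Differentiability everywhere of all iterated partial derivatives is smoothness; without it
  \<^const>\<open>frechet_derivative\<close> would be unspecified.\<close>

definition schwartz :: "('a::euclidean_space \<Rightarrow> complex) \<Rightarrow> bool" where
  "schwartz f \<longleftrightarrow> (\<forall>bs. set bs \<subseteq> Basis \<longrightarrow>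
     (\<forall>x. partials bs f differentiable (at x)) \<and>
     (\<forall>k::nat. bounded (range (\<lambda>x. norm x ^ k *\<^sub>R partials bs f x))))"

section \<open>Fourier transform and homogeneous Sobolev norm\<close>

definition fourier :: "('a::euclidean_space \<Rightarrow> complex) \<Rightarrow> 'a \<Rightarrow> complex" where
  "fourier f \<xi> = (\<integral>x. exp (- \<i> * complex_of_real (x \<bullet> \<xi>)) * f x \<partial>lborel)"

definition hom_sobolev_norm :: "real \<Rightarrow> ('a::euclidean_space \<Rightarrow> complex) \<Rightarrow> real" where
  "hom_sobolev_norm s f =
     sqrt ((2 * pi) powr (- real DIM('a)) *
       (\<integral>\<xi>. norm \<xi> powr (2 * s) * (norm (fourier f \<xi>))\<^sup>2 \<partial>lborel))"

section \<open>Surface measure on the unit sphere\<close>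

text \<open>The measure \<open>d\<omega>\<close> of polar coordinates \<open>dx = r\<^sup>n\<^sup>-\<^sup>1 dr d\<omega>\<close>: since
  \<open>\<integral>\<^sub>0\<^sup>1 r\<^sup>n\<^sup>-\<^sup>1 dr = 1/n\<close>, the surface measure of \<open>A\<close> is \<open>n\<close> times the
  Lebesgue measure of the cone \<open>{r \<omega> | 0 < r < 1, \<omega> \<in> A}\<close>, that is, of the preimage
  of \<open>A\<close> in the punctured unit ball under the radial projection.\<close>

definition sphere_measure :: "'a::euclidean_space measure" where
  "sphere_measure =
     scale_measure (of_nat DIM('a))
       (distr (restrict_space lborel (ball 0 1 - {0})) (restrict_space borel (sphere 0 1))
          (\<lambda>x. x /\<^sub>R norm x))"

lemma space_sphere_measure [simp]: "space (sphere_measure :: 'a::euclidean_space measure) = sphere 0 1"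
  by (simp add: sphere_measure_def space_scale_measure space_restrict_space)

lemma sets_sphere_measure [simp, measurable_cong]:
  "sets (sphere_measure :: 'a::euclidean_space measure) = sets (restrict_space borel (sphere 0 1))"
  by (simp add: sphere_measure_def)

lemma emeasure_sphere_measure:
  fixes A :: "'a::euclidean_space set"
  assumes "A \<in> sets borel" "A \<subseteq> sphere 0 1"
  shows "emeasure sphere_measure A =
    of_nat DIM('a) * emeasure lborel {r *\<^sub>R \<omega> | r \<omega>. 0 < r \<and> r < 1 \<and> \<omega> \<in> A}"
proof -
  let ?B = "ball 0 1 - {0::'a}" and ?p = "\<lambda>x::'a. x /\<^sub>R norm x"
  have m: "?p \<in> measurable (restrict_space lborel ?B) (restrict_space borel (sphere 0 1))"
    by (intro measurable_restrict_space3) (auto simp: dist_norm)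
  have A: "A \<in> sets (restrict_space borel (sphere 0 1))"
    using assms by (auto simp: sets_restrict_space)
  have eq: "?p -` A \<inter> ?B = {r *\<^sub>R \<omega> | r \<omega>. 0 < r \<and> r < 1 \<and> \<omega> \<in> A}" (is "?L = ?R")
  proof (intro equalityI subsetI)
    fix x assume x: "x \<in> ?L"
    then have "x = norm x *\<^sub>R ?p x" "0 < norm x" "norm x < 1" "?p x \<in> A" by auto
    then show "x \<in> ?R" by blast
  next
    fix x assume "x \<in> ?R"
    then obtain r w where *: "x = r *\<^sub>R w" "0 < r" "r < 1" "w \<in> A" by blast
    then have "norm w = 1" using assms(2) by auto
    with * show "x \<in> ?L" by auto
  qed
  have "emeasure sphere_measure A =
      of_nat DIM('a) * emeasure (restrict_space lborel ?B) (?p -` A \<inter> ?B)"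
    using emeasure_distr[OF m A] by (simp add: sphere_measure_def space_restrict_space)
  also have "emeasure (restrict_space lborel ?B) (?p -` A \<inter> ?B) = emeasure lborel (?p -` A \<inter> ?B)"
    by (rule emeasure_restrict_space) auto
  finally show ?thesis by (simp only: eq)
qed

lemma emeasure_sphere_measure_space:
  "emeasure (sphere_measure :: 'a::euclidean_space measure) (sphere 0 1) =
    ennreal (2 * pi powr (real DIM('a) / 2) / Gamma (real DIM('a) / 2))"
proof -
  let ?n = "real DIM('a)"
  have eq: "{r *\<^sub>R \<omega> | r (\<omega>::'a). 0 < r \<and> r < 1 \<and> \<omega> \<in> sphere 0 1} = ball 0 1 - {0}" (is "?L = ?R")
  proof (intro equalityI subsetI)
    fix x assume "x \<in> ?R"
    then have "x = norm x *\<^sub>R (x /\<^sub>R norm x)" "0 < norm x" "norm x < 1" "x /\<^sub>R norm x \<in> sphere 0 1"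
      by auto
    then show "x \<in> ?L" by blast
  qed auto
  have "emeasure lborel (ball (0::'a) 1 - {0}) = emeasure lborel (ball (0::'a) 1)"
    by (rule emeasure_Diff_null_set) (auto intro: null_setsI)
  then have 1: "emeasure lborel (ball (0::'a) 1 - {0}) = ennreal (unit_ball_vol ?n)"
    using emeasure_ball[of 1 "0::'a"] by simp
  have "?n / 2 > 0" by simp
  then have "?n / 2 \<notin> \<int>\<^sub>\<le>\<^sub>0" using nonpos_Ints_nonpos by fastforce
  then have "Gamma (?n / 2 + 1) = ?n / 2 * Gamma (?n / 2)"
    by (rule Gamma_plus1)
  then have 2: "?n * unit_ball_vol ?n = 2 * pi powr (?n / 2) / Gamma (?n / 2)"
    unfolding unit_ball_vol_def by (simp only:) simp
  have "emeasure sphere_measure (sphere (0::'a) 1) =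
      of_nat DIM('a) * emeasure lborel (ball (0::'a) 1 - {0})"
    using emeasure_sphere_measure[of "sphere (0::'a) 1"] by (simp only: eq) simp
  also have "\<dots> = ennreal (?n * unit_ball_vol ?n)"
    by (simp add: 1 ennreal_mult ennreal_of_nat_eq_real_of_nat)
  finally show ?thesis by (simp only: 2)
qed

definition sphere_L2_norm :: "('a::euclidean_space \<Rightarrow> complex) \<Rightarrow> real" where
  "sphere_L2_norm f = sqrt (\<integral>\<omega>. (norm (f \<omega>))\<^sup>2 \<partial>sphere_measure)"

definition sphere_trace_const :: "nat \<Rightarrow> real \<Rightarrow> real" where
  "sphere_trace_const n s =
     (2 powr (1 - 2 * s) *
       (Gamma (2 * s - 1) * Gamma (real n / 2 - s) /
        ((Gamma s)\<^sup>2 * Gamma (real n / 2 - 1 + s)))) powr (1 / 2)"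

end

theory Submission
  imports Defs "HOL-Probability.Probability"
begin

text \<open>
  Write \<open>n\<close> for the dimension, \<open>d\<omega>\<close> for surface measure, \<open>(g d\<omega>)^\<close> for the Fourier transform of
  the measure \<open>g d\<omega>\<close>, and let \<open>g = f|\<^sub>S\<close>. Fourier inversion (here only in Gaussian-regularised form) gives
  \<open>\<integral>\<^sub>S |f|\<^sup>2 d\<omega> = (2\<pi>)\<^sup>-\<^sup>n \<integral> fourier f \<cdot> cnj (g d\<omega>)^ d\<xi>\<close>, so by Cauchy-Schwarz the inequality is dual to a
  bound of \<open>\<integral> |\<xi>|\<^sup>-\<^sup>2\<^sup>s |(g d\<omega>)^|\<^sup>2 d\<xi>\<close> by \<open>\<integral>\<^sub>S |g|\<^sup>2 d\<omega>\<close>. Writing \<open>|\<xi>|\<^sup>-\<^sup>2\<^sup>s\<close> as a superposition of the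
  Gaussians \<open>exp (- |\<xi>|\<^sup>2 / 2l)\<close> turns this into a quadratic form in \<open>g\<close> on the sphere whose kernel is positive
  and symmetric, a superposition of \<open>exp (- l (1 - \<omega> \<bullet> \<omega>'))\<close>. Its integral in \<open>\<omega>'\<close> does not depend on \<open>\<omega>\<close>, so
  the Schur test yields the constant, and \<open>g = 1\<close> is extremal.

  The kernel integral is found by computing
  \<open>\<integral> \<integral>\<^sub>0\<^sup>\<infinity> l\<^sup>a\<^sup>-\<^sup>1 exp (- l (|x| - x \<bullet> e)) exp (- |x|) / |x| dl dx\<close> in two ways: in polar coordinates, and by writing
  \<open>exp (- (1 + l) |x|) / |x|\<close> as a superposition of Gaussians in \<open>x\<close>, after which the integral in \<open>x\<close> is
  Gaussian and depends on \<open>e\<close> only through \<open>|e| = 1\<close>.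
\<close>

section \<open>Integrals over the half line\<close>

text \<open>The range of s is dictated by the superposed kernel. Up to a constant it is |w - w'|^(2s
  - n): the exponent is negative for s < n/2, and integrability over the (n - 1)-dimensional sphere
  means s > 1/2. This singular kernel never occurs explicitly: the Schur test is run for each
  Gaussian and l is integrated last, so the exchanges in the duality argument are Tonelli, or Fubini
  with a Gaussian factor. Inversion is regularised because \<open>fourier_sphere g\<close> need not
  be integrable.

  Rotation invariance of surface measure, the usual reason for a constant kernel integral, is
  replaced by the double evaluation, which never rotates e.

  The formal extremiser has Fourier transform |xi|^(-2s) times that of d omega. It is singular at 0
  and decays slowly, hence is not the transform of a Schwartz function. Truncating l to a compact
  interval repairs both ends, at the price that sharpness becomes a limit.

  Up to powers of 2 and pi the constant first appears as Gamma(s - 1/2) Gamma(n/2 - s) / (Gamma(s)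
  Gamma(n/2 - 1 + s)); the duplication formula brings it to the stated shape.\<close>

lemma absolutely_integrable_on_iff_set_nn_integral:
  fixes f :: "real \<Rightarrow> real"
  assumes [measurable]: "f \<in> borel_measurable borel" "S \<in> sets borel"
    and nn: "\<And>x. x \<in> S \<Longrightarrow> 0 \<le> f x" and b: "0 \<le> b"
  shows "f absolutely_integrable_on S \<and> integral S f = b \<longleftrightarrow> (\<integral>\<^sup>+x\<in>S. ennreal (f x) \<partial>lborel) = ennreal b"
proof -
  let ?I = "(\<integral>\<^sup>+x\<in>S. ennreal (f x) \<partial>lborel)"
  have eq: "?I = (\<integral>\<^sup>+x. ennreal (indicator S x * f x) \<partial>lborel)"
    by (intro nn_integral_cong) (auto simp: indicator_def)
  have nn': "0 \<le> indicator S x * f x" for x using nn by (auto simp: indicator_def)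
  have int: "f absolutely_integrable_on S \<longleftrightarrow> integrable lborel (\<lambda>x. indicator S x * f x)"
    by (simp add: set_integrable_def integrable_completion)
  have val: "integral S f = (\<integral>x. indicator S x * f x \<partial>lborel)" if "f absolutely_integrable_on S"
    using set_lebesgue_integral_eq_integral(2)[OF that] by (simp add: set_lebesgue_integral_def integral_completion)
  show ?thesis
  proof
    assume *: "f absolutely_integrable_on S \<and> integral S f = b"
    then show "?I = ennreal b"
      unfolding eq using int val nn' by (subst nn_integral_eq_integral) auto
  next
    assume *: "?I = ennreal b"
    have i: "integrable lborel (\<lambda>x. indicator S x * f x)"
      using * nn' unfolding eq by (intro integrableI_nonneg) auto
    then have "ennreal (\<integral>x. indicator S x * f x \<partial>lborel) = ennreal b"
      using * nn' unfolding eq by (subst nn_integral_eq_integral[symmetric]) auto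
    then have "(\<integral>x. indicator S x * f x \<partial>lborel) = b"
      using b nn' by (subst (asm) ennreal_inj) (auto intro!: integral_nonneg_AE)
    with i int val show "f absolutely_integrable_on S \<and> integral S f = b" by auto
  qed
qed

text \<open>The change of variables theorem speaks of absolute integrability together with a value.
  For nonnegative integrands both are encoded in one equation with a finite right side, which
  explains the form with a real b.\<close>

lemma set_nn_integral_substitution:
  fixes f g g' :: "real \<Rightarrow> real"
  assumes [measurable]: "f \<in> borel_measurable borel" "g \<in> borel_measurable borel"
      "g' \<in> borel_measurable borel" "S \<in> sets borel" "T \<in> sets borel"
    and der: "\<And>x. x \<in> S \<Longrightarrow> (g has_field_derivative g' x) (at x)"
    and inj: "inj_on g S" and T: "g ` S = T"
    and nn: "\<And>x. x \<in> T \<Longrightarrow> 0 \<le> f x" and b: "0 \<le> b"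
  shows "(\<integral>\<^sup>+x\<in>S. ennreal (\<bar>g' x\<bar> * f (g x)) \<partial>lborel) = ennreal b \<longleftrightarrow> (\<integral>\<^sup>+x\<in>T. ennreal (f x) \<partial>lborel) = ennreal b"
proof -
  have "(\<integral>\<^sup>+x\<in>S. ennreal (\<bar>g' x\<bar> * f (g x)) \<partial>lborel) = ennreal b \<longleftrightarrow>
    (\<lambda>x. \<bar>g' x\<bar> * f (g x)) absolutely_integrable_on S \<and> integral S (\<lambda>x. \<bar>g' x\<bar> * f (g x)) = b"
    using nn T b by (subst absolutely_integrable_on_iff_set_nn_integral) auto
  also have "\<dots> \<longleftrightarrow> f absolutely_integrable_on T \<and> integral T f = b"
    unfolding T[symmetric] by (rule has_absolute_integral_change_of_variables_1')
       (auto intro!: inj intro: DERIV_subset der)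
  also have "\<dots> \<longleftrightarrow> (\<integral>\<^sup>+x\<in>T. ennreal (f x) \<partial>lborel) = ennreal b"
    using nn b by (subst absolutely_integrable_on_iff_set_nn_integral) auto
  finally show ?thesis .
qed

lemma nn_integral_Gamma:
  fixes p q :: real
  assumes "p > 0" "q > 0"
  shows "(\<integral>\<^sup>+t\<in>{0<..}. ennreal (t powr (p - 1) * exp (- (q * t))) \<partial>lborel) = ennreal (Gamma p / q powr p)"
proof -
  let ?I = "(\<integral>\<^sup>+t\<in>{0<..}. ennreal (t powr (p - 1) * exp (- (q * t))) \<partial>lborel)"
  have "ennreal (Gamma p) = (\<integral>\<^sup>+t. ennreal (indicator {0..} t * t powr (p - 1) / exp t) \<partial>lborel)"
    using Gamma_conv_nn_integral_real[OF assms(1)] by simp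
  also have "\<dots> = ennreal q * (\<integral>\<^sup>+t. ennreal (indicator {0..} (q*t) * (q*t) powr (p - 1) / exp (q*t)) \<partial>lborel)"
    using assms(2) by (subst nn_integral_real_affine[where c=q and t=0]) auto
  also have "(\<integral>\<^sup>+t. ennreal (indicator {0..} (q*t) * (q*t) powr (p - 1) / exp (q*t)) \<partial>lborel) =
      (\<integral>\<^sup>+t. ennreal (q powr (p-1)) * (ennreal (t powr (p - 1) * exp (-(q * t))) * indicator {0<..} t) \<partial>lborel)"
    using assms by (intro nn_integral_cong)
      (auto simp: indicator_def powr_mult exp_minus field_simps zero_le_mult_iff simp flip: ennreal_mult)
  also have "\<dots> = ennreal (q powr (p-1)) * ?I"
    by (rule nn_integral_cmult) auto
  finally have "ennreal (Gamma p) = ennreal (q powr p) * ?I"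
    using assms by (simp add: powr_diff flip: ennreal_mult mult.assoc)
  then have "ennreal (1 / q powr p) * ennreal (Gamma p) = ennreal (1 / q powr p) * ennreal (q powr p) * ?I"
    by (simp add: mult.assoc)
  also have "ennreal (1 / q powr p) * ennreal (q powr p) = 1"
    using assms by (simp flip: ennreal_mult)
  finally show ?thesis
    using assms by (simp flip: ennreal_mult)
qed

text \<open>Euler's integral under t -> 1/t. With p = s and q = |xi|^2 / 2 it represents |xi|^(-2s),
  up to \<open>Gamma s * 2 powr s\<close>, as a superposition of the Gaussians
  \<open>gauss t\<close> with weight t^(-s-1).\<close>

lemma nn_integral_inverse_Gamma:
  fixes p q :: real
  assumes "p > 0" "q > 0"
  shows "(\<integral>\<^sup>+t\<in>{0<..}. ennreal (t powr (- p - 1) * exp (- (q / t))) \<partial>lborel) = ennreal (Gamma p / q powr p)"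
proof -
  have im: "(\<lambda>t::real. 1 / t) ` {0<..} = {0<..}"
  proof (intro equalityI subsetI)
    fix x :: real assume "x \<in> {0<..}"
    then show "x \<in> (\<lambda>t. 1 / t) ` {0<..}" by (intro image_eqI[of _ _ "1/x"]) auto
  qed auto
  have "(\<integral>\<^sup>+t\<in>{0<..}. ennreal (\<bar>- 1 / t\<^sup>2\<bar> * ((1/t) powr (p - 1) * exp (- (q * (1/t))))) \<partial>lborel)
      = ennreal (Gamma p / q powr p)" using assms
    by (subst set_nn_integral_substitution[where g="\<lambda>t. 1/t" and T="{0<..}"
            and f="\<lambda>t. t powr (p - 1) * exp (- (q * t))"])
      (auto intro!: derivative_eq_intros nn_integral_Gamma im simp: inj_on_def power2_eq_square)
  also have "(\<integral>\<^sup>+t\<in>{0<..}. ennreal (\<bar>- 1 / t\<^sup>2\<bar> * ((1/t) powr (p - 1) * exp (- (q * (1/t))))) \<partial>lborel) =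
    (\<integral>\<^sup>+t\<in>{0<..}. ennreal (t powr (- p - 1) * exp (- (q / t))) \<partial>lborel)" (is "integral\<^sup>N _ ?l = integral\<^sup>N _ ?r")
  proof (rule nn_integral_cong)
    fix t :: real
    have "(1/t) powr (p - 1) = t powr (- p - 1) * t\<^sup>2" if "t > 0"
      using that by (simp add: powr_divide powr_diff powr_minus power2_eq_square field_simps)
    then show "?l t = ?r t" by (auto simp: indicator_def mult_ac divide_simps)
  qed
  finally show ?thesis .
qed

text \<open>The Cauchy-Schloemilch substitution: the exponent is a completed square in r sqrt(t) -
  \<alpha> / (2 sqrt(t)), whose derivative mixes the weights t^(-1/2) and t^(-3/2). The two weights
  contribute equally, so each gives half of a Gaussian integral. The result writes exp(-\<alpha> r)
  / r as a superposition of Gaussians in r.\<close>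

lemma nn_integral_Schloemilch:
  fixes r \<alpha> :: real
  assumes r: "r > 0" and \<alpha>: "\<alpha> > 0"
  shows "(\<integral>\<^sup>+t\<in>{0<..}. ennreal (t powr (- 1 / 2) * exp (- (r\<^sup>2 * t) - \<alpha>\<^sup>2 / (4 * t))) \<partial>lborel) =
    ennreal (sqrt pi / r * exp (- (\<alpha> * r)))"
proof -
  let ?e = "\<lambda>t. exp (- (r\<^sup>2 * t) - \<alpha>\<^sup>2 / (4 * t))"
  define f where "f t = t powr (- 1 / 2) * ?e t" for t
  define h where "h t = t powr (- 3 / 2) * ?e t" for t
  have [measurable]: "f \<in> borel_measurable borel" "h \<in> borel_measurable borel"
    unfolding f_def[abs_def] h_def[abs_def] by measurable
  have f0: "0 \<le> f t" and h0: "0 \<le> h t" for t by (auto simp: f_def h_def)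
  define I where "I = (\<integral>\<^sup>+t\<in>{0<..}. ennreal (f t) \<partial>lborel)"
  define c where "c = \<alpha>\<^sup>2 / (4 * r\<^sup>2)"
  have c: "c > 0" using r \<alpha> by (simp add: c_def)
  \<comment> \<open>Finiteness comes first, because substitution is available only for integrals
    with a real value. Dropping \<alpha> leaves a Gamma integral with p = 1/2.\<close>
  have "I \<le> (\<integral>\<^sup>+t\<in>{0<..}. ennreal (t powr (1/2 - 1) * exp (- (r\<^sup>2 * t))) \<partial>lborel)"
    unfolding I_def by (intro nn_integral_mono) (auto simp: f_def indicator_def intro!: ennreal_leI mult_left_mono)
  also have "\<dots> < \<infinity>"
    by (subst nn_integral_Gamma) (use r in auto)
  finally obtain J where J: "J \<ge> 0" "I = ennreal J"
    by (metis ennreal_cases infinity_ennreal_def less_irrefl)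
  have im: "(\<lambda>t::real. c / t) ` {0<..} = {0<..}"
  proof (intro equalityI subsetI)
    fix x :: real assume "x \<in> {0<..}"
    then show "x \<in> (\<lambda>t. c / t) ` {0<..}" using c by (intro image_eqI[of _ _ "c/x"]) auto
  qed (use c in auto)
  \<comment> \<open>The involution \<open>t \<mapsto> \<alpha>\<^sup>2 / (4 r\<^sup>2 t)\<close> exchanges the weights \<open>t\<^sup>-\<^sup>1\<^sup>/\<^sup>2\<close> and \<open>t\<^sup>-\<^sup>3\<^sup>/\<^sup>2\<close>.\<close>
  have "(\<integral>\<^sup>+t\<in>{0<..}. ennreal (\<bar>- c / t\<^sup>2\<bar> * f (c / t)) \<partial>lborel) = ennreal J"
    using c by (subst set_nn_integral_substitution[where g="\<lambda>t. c/t" and T="{0<..}"])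
      (auto intro!: derivative_eq_intros im simp: inj_on_def power2_eq_square J f0 simp flip: I_def)
  also have "(\<integral>\<^sup>+t\<in>{0<..}. ennreal (\<bar>- c / t\<^sup>2\<bar> * f (c / t)) \<partial>lborel) = (\<integral>\<^sup>+t\<in>{0<..}. ennreal (\<alpha> / (2 * r) * h t) \<partial>lborel)" (is "integral\<^sup>N _ ?l = integral\<^sup>N _ ?r")
  proof (rule nn_integral_cong)
    fix t :: real
    have "\<bar>- c / t\<^sup>2\<bar> * f (c / t) = \<alpha> / (2 * r) * h t" if t: "t > 0"
    proof -
      have p1: "(c / t) powr (- 1 / 2) = c powr (-1/2) * t powr (1/2)"
        using t c by (simp add: powr_divide powr_minus field_simps)
      have p2: "c powr (-1/2) = 2 * r / \<alpha>"
        using r \<alpha> by (simp add: powr_minus c_def powr_half_sqrt real_sqrt_divide real_sqrt_mult field_simps)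
      have p3: "t powr (1/2) / t\<^sup>2 = t powr (-3/2)" using t powr_diff[of t "1/2" 2] by simp
      have p4: "c * (2 * r / \<alpha>) = \<alpha> / (2 * r)"
        using r \<alpha> by (simp add: c_def power2_eq_square field_simps)
      have p5: "- (r\<^sup>2 * (c / t)) - \<alpha>\<^sup>2 / (4 * (c / t)) = - (r\<^sup>2 * t) - \<alpha>\<^sup>2 / (4 * t)"
        using r \<alpha> t by (simp add: c_def power2_eq_square field_simps)
      have "\<bar>- c / t\<^sup>2\<bar> * f (c / t) = (c * (2 * r / \<alpha>)) * (t powr (1/2) / t\<^sup>2) * ?e t"
        using c by (simp only: f_def p1 p5 p2) (simp add: mult_ac)
      then show ?thesis by (simp only: p3 p4 h_def mult.assoc)
    qed
    then show "?l t = ?r t" by (auto simp: indicator_def)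
  qed
  finally have Ih: "(\<integral>\<^sup>+t\<in>{0<..}. ennreal (\<alpha> / (2 * r) * h t) \<partial>lborel) = ennreal J" .
  define g where "g t = r * sqrt t - \<alpha> / 2 / sqrt t" for t
  define g' where "g' t = r / 2 * t powr (-1/2) + \<alpha> / 4 * t powr (-3/2)" for t
  have [measurable]: "g \<in> borel_measurable borel" "g' \<in> borel_measurable borel"
    unfolding g_def[abs_def] g'_def[abs_def] by measurable
  have g'pos: "g' t > 0" if "t > 0" for t
    using r \<alpha> that by (simp add: g'_def add_pos_pos)
  have dg: "(g has_field_derivative g' t) (at t)" if t: "t > 0" for t
  proof -
    have 1: "t powr (-1/2) = 1 / sqrt t" using t by (simp add: powr_minus powr_half_sqrt field_simps)
    have "t powr (-3/2) = t powr (-1/2 - 1)" by simp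
    then have 2: "t powr (-3/2) = 1 / (sqrt t * t)" unfolding powr_diff 1 using t by simp
    show ?thesis unfolding g_def[abs_def] g'_def 1 2 using t
      by (auto intro!: derivative_eq_intros simp: field_simps)
  qed
  have mono: "g x < g y" if "0 < x" "x < y" for x y
  proof (rule DERIV_pos_imp_increasing[OF that(2)])
    fix z assume "x \<le> z" "z \<le> y"
    with that have "z > 0" by simp
    then show "\<exists>d. (g has_real_derivative d) (at z) \<and> 0 < d" using dg g'pos by blast
  qed
  have inj: "inj_on g {0<..}"
    by (rule linorder_inj_onI) (auto dest: mono)
  have surj: "g ` {0<..} = UNIV"
  proof (intro equalityI subsetI UNIV_I)
    fix y :: real
    \<comment> \<open>u stands for sqrt(t): it is the positive root of r u^2 - y u - \<alpha>/2 = 0,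
      which is g(u^2) = y cleared of its denominator.\<close>
    define u where "u = (y + sqrt (y\<^sup>2 + 2 * \<alpha> * r)) / (2 * r)"
    have "sqrt (y\<^sup>2) < sqrt (y\<^sup>2 + 2 * \<alpha> * r)" using r \<alpha> by (intro real_sqrt_less_mono) auto
    then have u: "u > 0" using r by (simp add: u_def)
    have "(2 * r * u - y)\<^sup>2 = y\<^sup>2 + 2 * \<alpha> * r" using r \<alpha> by (simp add: u_def)
    then have "r * (4 * (r * u * u) - 2 * \<alpha> - 4 * (y * u)) = 0"
      by (simp add: power2_eq_square algebra_simps)
    then have "r * u * u - \<alpha> / 2 = y * u" using r by simp
    then have "g (u\<^sup>2) = y" using u by (simp add: g_def field_simps)
    with u show "y \<in> g ` {0<..}" by (intro image_eqI[of _ _ "u\<^sup>2"]) auto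
  qed
  have gauss: "(\<integral>\<^sup>+x. ennreal (exp (- x\<^sup>2)) \<partial>lborel) = ennreal (sqrt pi)"
  proof -
    have "has_bochner_integral lborel (\<lambda>x::real. exp (- x\<^sup>2)) (sqrt pi)"
      using has_bochner_integral_even_function[OF gaussian_moment_0] by simp
    then show ?thesis by (subst nn_integral_eq_integral) (auto simp: has_bochner_integral_iff)
  qed
  have "(\<integral>\<^sup>+t\<in>{0<..}. ennreal (\<bar>g' t\<bar> * exp (- (g t)\<^sup>2)) \<partial>lborel) = ennreal (sqrt pi)"
    using gauss by (subst set_nn_integral_substitution[where g=g and T=UNIV])
      (auto intro!: dg inj surj)
  also have "(\<integral>\<^sup>+t\<in>{0<..}. ennreal (\<bar>g' t\<bar> * exp (- (g t)\<^sup>2)) \<partial>lborel) =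
    (\<integral>\<^sup>+t. ennreal (exp (\<alpha> * r) * (r / 2)) * (ennreal (f t) * indicator {0<..} t) +
      ennreal (exp (\<alpha> * r) * (r / 2)) * (ennreal (\<alpha> / (2 * r) * h t) * indicator {0<..} t) \<partial>lborel)" (is "integral\<^sup>N _ ?l = integral\<^sup>N _ ?r")
  proof (rule nn_integral_cong)
    fix t :: real
    have "\<bar>g' t\<bar> * exp (- (g t)\<^sup>2) = exp (\<alpha> * r) * (r / 2) * f t + exp (\<alpha> * r) * (r / 2) * (\<alpha> / (2 * r) * h t)"
      if t: "t > 0"
    proof -
      have "(g t)\<^sup>2 = r\<^sup>2 * (sqrt t)\<^sup>2 - \<alpha> * r + (\<alpha> / 2)\<^sup>2 / (sqrt t)\<^sup>2"
        using t unfolding g_def power2_diff by (simp add: power_mult_distrib power_divide)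
      then have "- (g t)\<^sup>2 = \<alpha> * r + (- (r\<^sup>2 * t) - \<alpha>\<^sup>2 / (4 * t))"
        using t by (simp add: power_divide)
      then have "exp (- (g t)\<^sup>2) = exp (\<alpha> * r) * ?e t" by (simp only: exp_add)
      then show ?thesis using g'pos[OF t] r unfolding g'_def f_def h_def
        by (simp add: algebra_simps)
    qed
    then show "?l t = ?r t"
      using r \<alpha> f0[of t] h0[of t] by (auto simp: indicator_def simp flip: ennreal_mult ennreal_plus)
  qed
  also have "\<dots> = ennreal (exp (\<alpha> * r) * (r / 2)) * ennreal J + ennreal (exp (\<alpha> * r) * (r / 2)) * ennreal J"
    by (subst nn_integral_add, measurable, measurable, subst (1 2) nn_integral_cmult, measurable, measurable)
       (simp only: Ih J(2)[unfolded I_def])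
  also have "\<dots> = ennreal (exp (\<alpha> * r) * r * J)"
    using J r by (simp flip: ennreal_mult ennreal_plus)
  finally have "exp (\<alpha> * r) * r * J = sqrt pi"
    using J r by (subst (asm) ennreal_inj) auto
  then have "J = sqrt pi / r * exp (- (\<alpha> * r))"
    using r by (auto simp: exp_minus field_simps)
  then show ?thesis using J unfolding I_def f_def by simp
qed

section \<open>Gaussian integrals\<close>

abbreviation wave :: "'a::euclidean_space \<Rightarrow> 'a \<Rightarrow> complex" where
  "wave x \<xi> \<equiv> exp (- \<i> * complex_of_real (x \<bullet> \<xi>))"

text \<open>The parameter l is the variance, so that the Fourier transform carries exp(- l |v|^2 /
  2) and the same l becomes the factor in the exponent of the kernel on the sphere.\<close>

abbreviation gauss :: "real \<Rightarrow> 'a::euclidean_space \<Rightarrow> real" where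
  "gauss l x \<equiv> exp (- ((norm x)\<^sup>2 / (2 * l)))"

lemma integral_lborel_prod:
  fixes f :: "'a::euclidean_space \<Rightarrow> real \<Rightarrow> complex"
  assumes f: "\<And>b. b \<in> Basis \<Longrightarrow> integrable lborel (f b)"
  shows "(\<integral>x. (\<Prod>b\<in>(Basis::'a set). f b (x \<bullet> b)) \<partial>lborel) = (\<Prod>b\<in>Basis. \<integral>x. f b x \<partial>lborel)"
proof -
  interpret product_sigma_finite "\<lambda>_::'a. lborel :: real measure" ..
  have [measurable]: "b \<in> Basis \<Longrightarrow> f b \<in> borel_measurable borel" for b using f by auto
  have *: "(\<Prod>b\<in>Basis. f b ((\<Sum>c\<in>Basis. g c *\<^sub>R c) \<bullet> b)) = (\<Prod>b\<in>Basis. f b (g b))" for g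
    by (intro prod.cong) auto
  have m: "(\<lambda>x::'a. \<Prod>b\<in>Basis. f b (x \<bullet> b)) \<in> borel_measurable borel" by measurable
  have m': "(\<lambda>f. \<Sum>b\<in>Basis. f b *\<^sub>R b) \<in> measurable (\<Pi>\<^sub>M b\<in>(Basis::'a set). lborel) borel"
    by measurable
  show ?thesis
    by (subst lborel_eq, subst integral_distr[OF m' m], subst *, rule product_integral_prod) (auto intro: f)
qed

lemma power2_norm_sum_Basis: "(norm x)\<^sup>2 = (\<Sum>b\<in>Basis. (x \<bullet> b)\<^sup>2)" for x :: "'a::euclidean_space"
  unfolding power2_norm_eq_inner euclidean_inner[of x x] by (simp add: power2_eq_square)

text \<open>Completing the square in each coordinate. The linear term v enters the value only
  through its norm; this is what frees the kernel integral from the direction of e.\<close>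

lemma nn_integral_gaussian:
  fixes v :: "'a::euclidean_space"
  assumes t: "t > 0"
  shows "(\<integral>\<^sup>+x. ennreal (exp (- (t * (norm x)\<^sup>2) + x \<bullet> v)) \<partial>lborel) =
    ennreal ((pi / t) powr (real DIM('a) / 2) * exp ((norm v)\<^sup>2 / (4 * t)))"
proof -
  have *: "(\<integral>\<^sup>+x. ennreal (exp (- (t * x\<^sup>2) + x * c)) \<partial>lborel) = ennreal (sqrt (pi / t) * exp (c\<^sup>2 / (4 * t)))"
    for c :: real
  proof -
    \<comment> \<open>Mean c / (2t) and variance 1 / (2t) turn the exponent into that of a normal
      density.\<close>
    define \<sigma> where "\<sigma> = sqrt (1 / (2 * t))"
    have \<sigma>: "\<sigma> > 0" "\<sigma>\<^sup>2 = 1 / (2 * t)" using t by (auto simp: \<sigma>_def)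
    have eq: "exp (- (t * x\<^sup>2) + x * c) = sqrt (pi / t) * exp (c\<^sup>2 / (4 * t)) * normal_density (c / (2 * t)) \<sigma> x" for x
    proof -
      have "- (t * x\<^sup>2) + x * c = c\<^sup>2 / (4 * t) + (- (x - c / (2 * t))\<^sup>2 / (2 * \<sigma>\<^sup>2))"
        using t unfolding \<sigma> by (simp add: power2_eq_square field_simps)
      then have "exp (- (t * x\<^sup>2) + x * c) = exp (c\<^sup>2 / (4 * t)) * exp (- (x - c / (2 * t))\<^sup>2 / (2 * \<sigma>\<^sup>2))"
        by (simp only: exp_add)
      then show ?thesis using t unfolding normal_density_def \<sigma> by (simp add: real_sqrt_divide)
    qed
    have "(\<integral>\<^sup>+x. ennreal (exp (- (t * x\<^sup>2) + x * c)) \<partial>lborel) =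
       ennreal (\<integral>x. sqrt (pi / t) * exp (c\<^sup>2 / (4 * t)) * normal_density (c / (2 * t)) \<sigma> x \<partial>lborel)"
      unfolding eq using \<sigma> t by (intro nn_integral_eq_integral) (auto intro!: integrable_normal_density)
    also have "\<dots> = ennreal (sqrt (pi / t) * exp (c\<^sup>2 / (4 * t)))"
      using \<sigma> by (simp add: integral_normal_density)
    finally show ?thesis .
  qed
  have "(\<integral>\<^sup>+x. ennreal (exp (- (t * (norm x)\<^sup>2) + x \<bullet> v)) \<partial>lborel) =
    (\<integral>\<^sup>+x. (\<Prod>b\<in>Basis. ennreal (exp (- (t * (x \<bullet> b)\<^sup>2) + (x \<bullet> b) * (v \<bullet> b)))) \<partial>lborel)" (is "integral\<^sup>N _ ?l = integral\<^sup>N _ ?r")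
  proof (rule nn_integral_cong)
    fix x :: 'a
    have "- (t * (norm x)\<^sup>2) + x \<bullet> v = (\<Sum>b\<in>Basis. - (t * (x \<bullet> b)\<^sup>2) + (x \<bullet> b) * (v \<bullet> b))"
      unfolding power2_norm_sum_Basis euclidean_inner[of x v]
      by (simp add: sum_distrib_left sum_subtractf)
    then show "?l x = ?r x" by (simp add: exp_sum prod_ennreal)
  qed
  also have "\<dots> = (\<Prod>b\<in>(Basis::'a set). \<integral>\<^sup>+x. ennreal (exp (- (t * x\<^sup>2) + x * (v \<bullet> b))) \<partial>lborel)"
    by (rule nn_integral_lborel_prod) auto
  also have "\<dots> = (\<Prod>b\<in>(Basis::'a set). ennreal (sqrt (pi / t) * exp ((v \<bullet> b)\<^sup>2 / (4 * t))))"
    by (simp only: *)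
  also have "\<dots> = ennreal (sqrt (pi / t) ^ DIM('a) * exp (\<Sum>b\<in>(Basis::'a set). (v \<bullet> b)\<^sup>2 / (4 * t)))"
    using t by (simp add: prod_ennreal prod.distrib exp_sum)
  also have "sqrt (pi / t) ^ DIM('a) = (pi / t) powr (real DIM('a) / 2)"
    using t by (simp add: powr_half_sqrt[symmetric] powr_powr flip: powr_realpow)
  also have "(\<Sum>b\<in>(Basis::'a set). (v \<bullet> b)\<^sup>2 / (4 * t)) = (norm v)\<^sup>2 / (4 * t)"
    unfolding power2_norm_sum_Basis by (simp flip: sum_divide_distrib)
  finally show ?thesis .
qed

lemma integrable_gaussian:
  assumes "t > 0"
  shows "integrable lborel (\<lambda>x::'a::euclidean_space. exp (- (t * (norm x)\<^sup>2)))"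
  using nn_integral_gaussian[OF assms, of "0::'a"] by (intro integrableI_nonneg) auto

text \<open>The characteristic function of the standard normal distribution, dilated by
  sqrt(l).\<close>

lemma fourier_gaussian_real:
  fixes c l :: real
  assumes l: "l > 0"
  shows "integrable lborel (\<lambda>x. exp (\<i> * of_real (x * c)) * of_real (exp (- (x\<^sup>2 / (2 * l)))))" (is ?A)
    and "(\<integral>x. exp (\<i> * of_real (x * c)) * complex_of_real (exp (- (x\<^sup>2 / (2 * l)))) \<partial>lborel) =
      of_real (sqrt (2 * pi * l) * exp (- (l * c\<^sup>2 / 2)))" (is ?B)
proof -
  let ?e = "\<lambda>x. exp (\<i> * of_real (sqrt l * c * x))"
  have "integrable lborel (\<lambda>x::real. exp (- (1 / (2 * l) * (norm x)\<^sup>2)))"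
    using l by (intro integrable_gaussian) auto
  then show ?A
    by (rule Bochner_Integration.integrable_bound) (auto simp: norm_mult)
  have "(\<integral>x. std_normal_density x *\<^sub>R ?e x \<partial>lborel) = char std_normal_distribution (sqrt l * c)"
    unfolding char_def by (subst integral_density) (auto simp: normal_density_nonneg)
  also have "\<dots> = of_real (exp (- (l * c\<^sup>2 / 2)))"
    using l by (simp add: char_std_normal_distribution power_mult_distrib)
  finally have 1: "(\<integral>x. std_normal_density x *\<^sub>R ?e x \<partial>lborel) = of_real (exp (- (l * c\<^sup>2 / 2)))" .
  have "(\<integral>x. exp (\<i> * of_real (x * c)) * complex_of_real (exp (- (x\<^sup>2 / (2 * l)))) \<partial>lborel) =
    sqrt l *\<^sub>R (\<integral>x. exp (\<i> * of_real (sqrt l * x * c)) * complex_of_real (exp (- ((sqrt l * x)\<^sup>2 / (2 * l)))) \<partial>lborel)"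
    using l by (subst lborel_integral_real_affine[where c="sqrt l" and t=0]) auto
  also have "(\<lambda>x. exp (\<i> * of_real (sqrt l * x * c)) * complex_of_real (exp (- ((sqrt l * x)\<^sup>2 / (2 * l))))) =
      (\<lambda>x. sqrt (2 * pi) *\<^sub>R (std_normal_density x *\<^sub>R ?e x))"
    using l by (auto simp: fun_eq_iff std_normal_density_def power_mult_distrib mult_ac scaleR_conv_of_real)
  also have "integral\<^sup>L lborel \<dots> = sqrt (2 * pi) *\<^sub>R of_real (exp (- (l * c\<^sup>2 / 2)))"
    unfolding integral_scaleR_right 1 ..
  finally show ?B by (simp add: real_sqrt_mult scaleR_conv_of_real mult_ac)
qed

lemma fourier_gaussian:
  fixes v :: "'a::euclidean_space"
  assumes l: "l > 0"
  shows "(\<integral>x. exp (\<i> * of_real (x \<bullet> v)) * complex_of_real (gauss l x) \<partial>lborel) =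
    of_real ((2 * pi * l) powr (real DIM('a) / 2) * exp (- (l * (norm v)\<^sup>2 / 2)))"
proof -
  have "exp (\<i> * of_real (x \<bullet> v)) * complex_of_real (gauss l x) =
      (\<Prod>b\<in>Basis. exp (\<i> * of_real ((x \<bullet> b) * (v \<bullet> b))) * complex_of_real (exp (- ((x \<bullet> b)\<^sup>2 / (2 * l)))))" for x
  proof -
    have "exp (\<i> * of_real (x \<bullet> v)) = (\<Prod>b\<in>Basis. exp (\<i> * of_real ((x \<bullet> b) * (v \<bullet> b))))"
      by (simp add: euclidean_inner[of x v] sum_distrib_left exp_sum)
    moreover have "- ((norm x)\<^sup>2 / (2 * l)) = (\<Sum>b\<in>Basis. - ((x \<bullet> b)\<^sup>2 / (2 * l)))"
      unfolding power2_norm_sum_Basis by (simp add: sum_negf flip: sum_divide_distrib)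
    then have "gauss l x = (\<Prod>b\<in>Basis. exp (- ((x \<bullet> b)\<^sup>2 / (2 * l))))" by (simp add: exp_sum)
    ultimately show ?thesis by (simp add: prod.distrib)
  qed
  then have "(\<integral>x. exp (\<i> * of_real (x \<bullet> v)) * complex_of_real (gauss l x) \<partial>lborel) =
    (\<Prod>b\<in>(Basis::'a set). complex_of_real (sqrt (2 * pi * l) * exp (- (l * (v \<bullet> b)\<^sup>2 / 2))))"
    by (simp only: integral_lborel_prod[where f="\<lambda>b x. exp (\<i> * of_real (x * (v \<bullet> b))) * complex_of_real (exp (- (x\<^sup>2 / (2 * l))))",
       OF fourier_gaussian_real(1)[OF l]] fourier_gaussian_real(2)[OF l])
  also have "\<dots> = of_real (sqrt (2 * pi * l) ^ DIM('a) * exp (\<Sum>b\<in>(Basis::'a set). - (l * (v \<bullet> b)\<^sup>2 / 2)))"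
    by (simp add: prod.distrib exp_sum)
  also have "sqrt (2 * pi * l) ^ DIM('a) = (2 * pi * l) powr (real DIM('a) / 2)"
    using l by (simp add: powr_half_sqrt[symmetric] powr_powr flip: powr_realpow)
  also have "(\<Sum>b\<in>(Basis::'a set). - (l * (v \<bullet> b)\<^sup>2 / 2)) = - (l * (norm v)\<^sup>2 / 2)"
    unfolding power2_norm_sum_Basis by (simp add: sum_negf sum_distrib_left flip: sum_divide_distrib)
  finally show ?thesis .
qed

section \<open>Surface measure and the sphere kernel\<close>

lemma nn_integral_Fubini:
  assumes "sigma_finite_measure M" "sigma_finite_measure N"
    and "(\<lambda>(x, y). f x y) \<in> borel_measurable (M \<Otimes>\<^sub>M N)"
  shows "(\<integral>\<^sup>+x. \<integral>\<^sup>+y. f x y \<partial>N \<partial>M) = (\<integral>\<^sup>+y. \<integral>\<^sup>+x. f x y \<partial>M \<partial>N)"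
proof -
  interpret M: sigma_finite_measure M by fact
  interpret N: sigma_finite_measure N by fact
  interpret pair_sigma_finite M N ..
  show ?thesis using Fubini'[of f] assms(3) by simp
qed

lemma nn_integral_lborel_scaleR:
  fixes f :: "'a::euclidean_space \<Rightarrow> ennreal"
  assumes [measurable]: "f \<in> borel_measurable borel" and c: "c > 0"
  shows "(\<integral>\<^sup>+x. f x \<partial>lborel) = ennreal (c ^ DIM('a)) * (\<integral>\<^sup>+x. f (c *\<^sub>R x) \<partial>lborel)"
  using c by (subst lborel_affine[of c 0]) (simp_all add: nn_integral_density nn_integral_distr nn_integral_cmult)

lemma finite_sphere_measure: "finite_measure (sphere_measure :: 'a::euclidean_space measure)"
proof (rule finite_measureI)
  show "emeasure (sphere_measure :: 'a measure) (space sphere_measure) \<noteq> \<infinity>"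
    unfolding space_sphere_measure emeasure_sphere_measure_space by simp
qed

lemma sphere_sigma_finite: "sigma_finite_measure (sphere_measure :: 'a::euclidean_space measure)"
  by (rule finite_measure.axioms) (rule finite_sphere_measure)

text \<open>The space of \<open>sphere_measure\<close> is the sphere and not the whole type, so
  measurability is established over \<open>borel\<close> and then restricted, here and in the two
  product versions below.\<close>

lemma measurable_sphere:
  "f \<in> measurable borel M \<Longrightarrow> f \<in> measurable (sphere_measure :: 'a::euclidean_space measure) M"
  unfolding measurable_cong_sets[OF sets_sphere_measure refl] by (rule measurable_restrict_space1)

lemma measurable_pair_sphere:
  fixes f :: "'b \<times> 'a::euclidean_space \<Rightarrow> 'c"
  assumes "f \<in> measurable (M \<Otimes>\<^sub>M borel) N"
  shows "f \<in> measurable (M \<Otimes>\<^sub>M sphere_measure) N"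
proof -
  have "(\<lambda>p. (fst p, snd p)) \<in> measurable (M \<Otimes>\<^sub>M (sphere_measure :: 'a measure)) (M \<Otimes>\<^sub>M borel)"
    by (intro measurable_Pair measurable_fst measurable_compose[OF measurable_snd] measurable_sphere) simp
  from measurable_compose[OF this assms] show ?thesis by simp
qed

lemma measurable_sphere_pair:
  fixes f :: "'a::euclidean_space \<times> 'b \<Rightarrow> 'c"
  assumes "f \<in> measurable (borel \<Otimes>\<^sub>M M) N"
  shows "f \<in> measurable (sphere_measure \<Otimes>\<^sub>M M) N"
proof -
  have "(\<lambda>p. (fst p, snd p)) \<in> measurable ((sphere_measure :: 'a measure) \<Otimes>\<^sub>M M) (borel \<Otimes>\<^sub>M M)"
    by (intro measurable_Pair measurable_snd measurable_compose[OF measurable_fst] measurable_sphere) simp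
  from measurable_compose[OF this assms] show ?thesis by simp
qed

section \<open>Surface measure in polar coordinates\<close>

lemma nn_integral_sphere_measure:
  fixes f :: "'a::euclidean_space \<Rightarrow> ennreal"
  assumes [measurable]: "f \<in> borel_measurable borel"
  shows "(\<integral>\<^sup>+\<omega>. f \<omega> \<partial>sphere_measure) = of_nat DIM('a) * (\<integral>\<^sup>+x\<in>ball 0 1 - {0}. f (x /\<^sub>R norm x) \<partial>lborel)"
proof -
  have m: "(\<lambda>x. x /\<^sub>R norm x) \<in> measurable (restrict_space lborel (ball 0 1 - {0::'a})) (restrict_space borel (sphere 0 1))"
    by (intro measurable_restrict_space3) (auto simp: dist_norm)
  have "f \<in> borel_measurable (restrict_space borel (sphere 0 1))"
    by (rule measurable_restrict_space1) simp
  with m show ?thesis unfolding sphere_measure_def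
    by (simp add: nn_integral_scale_measure nn_integral_distr nn_integral_restrict_space)
qed

lemma punctured_ball_measurable [measurable]: "ball 0 r - {0::'a::euclidean_space} \<in> sets borel"
  by simp

lemma nn_integral_ball_radial:
  fixes f :: "'a::euclidean_space \<Rightarrow> ennreal"
  assumes [measurable]: "f \<in> borel_measurable borel" and r: "r > 0"
  shows "(\<integral>\<^sup>+x\<in>ball 0 r - {0}. f (x /\<^sub>R norm x) \<partial>lborel) = ennreal (r ^ DIM('a) / DIM('a)) * (\<integral>\<^sup>+\<omega>. f \<omega> \<partial>sphere_measure)"
proof -
  have "(\<integral>\<^sup>+x\<in>ball 0 r - {0}. f (x /\<^sub>R norm x) \<partial>lborel) =
     ennreal (r ^ DIM('a)) * (\<integral>\<^sup>+x. f ((r *\<^sub>R x) /\<^sub>R norm (r *\<^sub>R x)) * indicator (ball 0 r - {0}) (r *\<^sub>R x) \<partial>lborel)"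
    by (rule nn_integral_lborel_scaleR) (measurable, fact r)
  also have "(\<integral>\<^sup>+x. f ((r *\<^sub>R x) /\<^sub>R norm (r *\<^sub>R x)) * indicator (ball 0 r - {0}) (r *\<^sub>R x) \<partial>lborel) =
     (\<integral>\<^sup>+x\<in>ball 0 1 - {0}. f (x /\<^sub>R norm x) \<partial>lborel)" (is "integral\<^sup>N _ ?l = integral\<^sup>N _ ?r")
  proof (rule nn_integral_cong)
    fix x :: 'a
    have "(r *\<^sub>R x) /\<^sub>R norm (r *\<^sub>R x) = x /\<^sub>R norm x" using r by simp
    then show "?l x = ?r x" using r by (simp only:) (auto simp: indicator_def)
  qed
  finally show ?thesis
    unfolding nn_integral_sphere_measure[OF assms(1)] using r
    by (simp add: ennreal_of_nat_eq_real_of_nat mult.assoc[symmetric] flip: ennreal_mult)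
qed

text \<open>Polar coordinates for a single radial weight, by a layer-cake argument: the decreasing
  weight is the integral over (|x|, infinity) of its negated derivative k, and Tonelli reduces
  everything to balls, where the scaling of surface measure is already known.\<close>

lemma nn_integral_polar_exp:
  fixes f :: "'a::euclidean_space \<Rightarrow> ennreal"
  assumes [measurable]: "f \<in> borel_measurable borel" and a: "0 < a" "a < real DIM('a) - 1"
  shows "(\<integral>\<^sup>+x. f (x /\<^sub>R norm x) * ennreal (norm x powr (- 1 - a) * exp (- norm x)) \<partial>lborel) =
    ennreal (Gamma (real DIM('a) - 1 - a)) * (\<integral>\<^sup>+\<omega>. f \<omega> \<partial>sphere_measure)"
proof -
  let ?n = "real DIM('a)"
  \<comment> \<open>k is minus the derivative of r^(-1-a) exp(-r).\<close>
  define k where "k r = (a + 1 + r) * r powr (- 2 - a) * exp (- r)" for r :: real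
  have [measurable]: "k \<in> borel_measurable borel" unfolding k_def[abs_def] by measurable
  have w: "ennreal (r powr (- 1 - a) * exp (- r)) = (\<integral>\<^sup>+\<rho>. ennreal (k \<rho>) * indicator {r<..} \<rho> \<partial>lborel)"
    if r: "r > 0" for r
  proof -
    have "(\<integral>\<^sup>+\<rho>. ennreal (k \<rho>) * indicator {r..} \<rho> \<partial>lborel) = ennreal (0 - (- (r powr (- 1 - a) * exp (- r))))"
    proof (rule nn_integral_FTC_atLeast)
      fix x assume "r \<le> x"
      then have x: "x > 0" using r by simp
      have eq: "- a - 2 = - 2 - a" by simp
      have "x powr (-1 - a) = x powr (-2-a) * x" using x powr_add[of x "-2-a" 1] by simp
      with x show "((\<lambda>x. - (x powr (- 1 - a) * exp (- x))) has_real_derivative k x) (at x)"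
        unfolding k_def by (auto intro!: derivative_eq_intros simp: algebra_simps eq)
      show "0 \<le> k x" using x a by (simp add: k_def)
    next
      show "((\<lambda>x. - (x powr (- 1 - a) * exp (- x))) \<longlongrightarrow> 0) at_top" using a by real_asymp
    qed simp
    also have "(\<integral>\<^sup>+\<rho>. ennreal (k \<rho>) * indicator {r..} \<rho> \<partial>lborel) = (\<integral>\<^sup>+\<rho>. ennreal (k \<rho>) * indicator {r<..} \<rho> \<partial>lborel)" (is "integral\<^sup>N _ ?l' = integral\<^sup>N _ ?r'")
    proof (rule nn_integral_cong_AE)
      show "AE \<rho> in lborel. ?l' \<rho> = ?r' \<rho>"
        using AE_lborel_singleton[of r] by eventually_elim (auto simp: indicator_def)
    qed
    finally show ?thesis by simp
  qed
  have "(\<integral>\<^sup>+x. f (x /\<^sub>R norm x) * ennreal (norm x powr (- 1 - a) * exp (- norm x)) \<partial>lborel) =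
     (\<integral>\<^sup>+x. \<integral>\<^sup>+\<rho>. f (x /\<^sub>R norm x) * indicator {y. y \<noteq> 0} x * (ennreal (k \<rho>) * (indicator {y. norm x < y} \<rho>)) \<partial>lborel \<partial>lborel)"
    apply (intro nn_integral_cong)
    subgoal for x by (cases "x = 0") (simp_all add: w nn_integral_cmult greaterThan_def)
    done
  also have "\<dots> = (\<integral>\<^sup>+\<rho>. \<integral>\<^sup>+x. f (x /\<^sub>R norm x) * indicator {y. y \<noteq> 0} x * (ennreal (k \<rho>) * (indicator {y. norm x < y} \<rho>)) \<partial>lborel \<partial>lborel)"
    by (intro nn_integral_Fubini sigma_finite_lborel) measurable
  also have "\<dots> = (\<integral>\<^sup>+\<rho>. ennreal (k \<rho>) * indicator {0<..} \<rho> * (\<integral>\<^sup>+x\<in>ball 0 \<rho> - {0}. f (x /\<^sub>R norm x) \<partial>lborel) \<partial>lborel)" (is "integral\<^sup>N _ ?l = integral\<^sup>N _ ?r")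
  proof (rule nn_integral_cong)
    fix \<rho> :: real
    have "(\<integral>\<^sup>+x. f (x /\<^sub>R norm x) * indicator {y. y \<noteq> 0} x * (ennreal (k \<rho>) * (indicator {y. norm x < y} \<rho>)) \<partial>lborel) =
      (\<integral>\<^sup>+x. ennreal (k \<rho>) * indicator {0<..} \<rho> * (f (x /\<^sub>R norm x) * indicator (ball 0 \<rho> - {0}) x) \<partial>lborel)" (is "integral\<^sup>N _ ?l' = integral\<^sup>N _ ?r'")
    proof (rule nn_integral_cong)
      fix x :: 'a
      show "?l' x = ?r' x"
        using norm_ge_zero[of x] by (auto simp: indicator_def mult_ac simp del: norm_ge_zero)
    qed
    then show "?l \<rho> = ?r \<rho>" by (simp add: nn_integral_cmult)
  qed
  also have "\<dots> = (\<integral>\<^sup>+\<rho>. (ennreal ((a + 1) / ?n) * (ennreal (\<rho> powr (?n - 1 - a - 1) * exp (- (1 * \<rho>))) * indicator {0<..} \<rho>) +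
       ennreal (1 / ?n) * (ennreal (\<rho> powr (?n - a - 1) * exp (- (1 * \<rho>))) * indicator {0<..} \<rho>))
        * (\<integral>\<^sup>+\<omega>. f \<omega> \<partial>sphere_measure) \<partial>lborel)" (is "integral\<^sup>N _ ?l = integral\<^sup>N _ ?r")
  proof (rule nn_integral_cong)
    fix \<rho> :: real
    show "?l \<rho> = ?r \<rho>"
    proof (cases "\<rho> > 0")
      case True
      have "?n - 1 - a - 1 = (-2-a) + ?n" "?n - a - 1 = (-2-a) + ?n + 1" by auto
      then have e: "\<rho> powr (?n - 1 - a - 1) = \<rho> powr (-2-a) * \<rho> ^ DIM('a)"
        "\<rho> powr (?n - a - 1) = \<rho> powr (-2-a) * \<rho> ^ DIM('a) * \<rho>"
        using True by (simp_all only: powr_add powr_realpow powr_one)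
      have "k \<rho> * (\<rho> ^ DIM('a) / DIM('a)) = (a + 1) / ?n * (\<rho> powr (?n - 1 - a - 1) * exp (- (1 * \<rho>))) +
         1 / ?n * (\<rho> powr (?n - a - 1) * exp (- (1 * \<rho>)))"
        unfolding k_def e by (simp add: add_divide_distrib[symmetric] algebra_simps)
      moreover have "k \<rho> \<ge> 0" using True a by (simp add: k_def)
      ultimately show ?thesis using True a nn_integral_ball_radial[OF assms(1) True]
        by (simp add: mult.assoc[symmetric] flip: ennreal_mult ennreal_plus)
    qed simp
  qed
  also have "\<dots> = (ennreal ((a + 1) / ?n) * ennreal (Gamma (?n - 1 - a) / 1 powr (?n - 1 - a)) +
       ennreal (1 / ?n) * ennreal (Gamma (?n - a) / 1 powr (?n - a))) * (\<integral>\<^sup>+\<omega>. f \<omega> \<partial>sphere_measure)"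
    apply (subst nn_integral_multc, measurable)
    apply (subst nn_integral_add, measurable)
    apply (subst nn_integral_cmult, measurable)
    apply (subst nn_integral_cmult, measurable)
    apply (subst nn_integral_Gamma, use a in simp, simp)
    apply (subst nn_integral_Gamma, use a in simp, simp)
    apply (rule refl)
    done
  also have "ennreal ((a + 1) / ?n) * ennreal (Gamma (?n - 1 - a) / 1 powr (?n - 1 - a)) +
       ennreal (1 / ?n) * ennreal (Gamma (?n - a) / 1 powr (?n - a)) = ennreal (Gamma (?n - 1 - a))"
  proof -
    have "?n - 1 - a \<notin> \<int>\<^sub>\<le>\<^sub>0" using a nonpos_Ints_nonpos by fastforce
    \<comment> \<open>The functional equation gives the two Gamma terms the weights (a + 1) / n and
      (n - 1 - a) / n, which add up to 1.\<close>
    from Gamma_plus1[OF this] have "Gamma (?n - a) = (?n - 1 - a) * Gamma (?n - 1 - a)" by simp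
    then have "(a + 1) / ?n * (Gamma (?n - 1 - a) / 1 powr (?n - 1 - a)) + 1 / ?n * (Gamma (?n - a) / 1 powr (?n - a)) = Gamma (?n - 1 - a)"
      by (simp add: field_simps)
    moreover have "Gamma (?n - a) > 0" "Gamma (?n - 1 - a) > 0" using a by (auto intro!: Gamma_real_pos)
    ultimately show ?thesis using a by (simp flip: ennreal_mult ennreal_plus)
  qed
  finally show ?thesis .
qed

text \<open>For a unit vector e, 1 - \<omega> \<bullet> e is |\<omega> - e|^2 / 2, so this is a row
  integral of the Gaussian kernel exp(- l |\<omega> - e|^2 / 2) on the sphere.\<close>

definition sphere_kernel :: "real \<Rightarrow> 'a::euclidean_space \<Rightarrow> ennreal" where
  "sphere_kernel l e = (\<integral>\<^sup>+\<omega>. ennreal (exp (- (l * (1 - \<omega> \<bullet> e)))) \<partial>sphere_measure)"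

lemma sphere_kernel_measurable [measurable (raw)]:
  assumes [measurable]: "g \<in> borel_measurable M" "h \<in> borel_measurable M"
  shows "(\<lambda>p. sphere_kernel (g p) (h p :: 'a::euclidean_space)) \<in> borel_measurable M"
proof -
  interpret sigma_finite_measure "sphere_measure :: 'a measure" by (rule sphere_sigma_finite)
  have "(\<lambda>p. sphere_kernel (fst p) (snd p :: 'a)) \<in> borel_measurable (borel \<Otimes>\<^sub>M borel)"
    unfolding sphere_kernel_def
    by (rule borel_measurable_nn_integral, rule measurable_pair_sphere) measurable
  from measurable_compose[OF _ this, of "\<lambda>p. (g p, h p)" M] show ?thesis by simp
qed

text \<open>The quotient of the two evaluations of one integral. The powers of pi and 2 and
  \<open>Gamma a\<close> come from the integrals in x and l,
  \<open>Gamma ((real n - 1) / 2 - a)\<close> with its power of 4 from the one in t, and the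
  denominator from polar coordinates.\<close>

definition sphere_kernel_mass :: "nat \<Rightarrow> real \<Rightarrow> real" where
  "sphere_kernel_mass n a = pi powr ((real n - 1) / 2) * Gamma a * 2 powr a * Gamma ((real n - 1) / 2 - a)
      * 4 powr ((real n - 1) / 2 - a) / Gamma (real n - 1 - a)"

lemma sphere_kernel_mass_nonneg:
  assumes "0 < a" "a < (real n - 1) / 2"
  shows "sphere_kernel_mass n a \<ge> 0"
  using assms Gamma_real_pos[of a] Gamma_real_pos[of "(real n - 1) / 2 - a"] Gamma_real_pos[of "real n - 1 - a"]
  by (simp add: sphere_kernel_mass_def)

text \<open>The integral over l replaces the kernel by a multiple of (1 - \<omega> \<bullet>
  e)^(-a), and a < (n - 1)/2 makes that singularity integrable over the sphere. The result does not
  depend on e.\<close>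

lemma sphere_kernel_integral:
  fixes e :: "'a::euclidean_space"
  assumes e: "norm e = 1" and a: "0 < a" "a < (real DIM('a) - 1) / 2"
  shows "(\<integral>\<^sup>+l\<in>{0<..}. ennreal (l powr (a - 1)) * sphere_kernel l e \<partial>lborel) = ennreal (sphere_kernel_mass DIM('a) a)"
proof -
  let ?n = "real DIM('a)"
  let ?k = "\<lambda>x l. exp (- (l * (norm x - x \<bullet> e)))"
  \<comment> \<open>This is \<open>Gamma a\<close> times (|x| - x \<bullet> e)^(-a), homogeneous of
    degree -a. Kept as an integral, it is simply infinite on the ray through e and needs no case
    distinction there.\<close>
  define \<Phi> where "\<Phi> x = (\<integral>\<^sup>+l\<in>{0<..}. ennreal (l powr (a - 1) * ?k x l) \<partial>lborel)" for x
  have [measurable]: "\<Phi> \<in> borel_measurable borel" unfolding \<Phi>_def by measurable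
  \<comment> \<open>The weight is chosen to join with exp(- l |x|) into exp(- (1 + l) |x|) / |x|,
    the shape of \<open>nn_integral_Schloemilch\<close>.\<close>
  define X where "X = (\<integral>\<^sup>+x. \<Phi> x * ennreal (exp (- norm x) / norm x) \<partial>lborel)"

  have meas: "(\<lambda>l. ennreal (l powr (a - 1) * exp (- (l * c))) * indicator {0<..} l) \<in> borel_measurable lborel" for c
    by measurable
  have hom: "\<Phi> x = ennreal (norm x powr (- a)) * \<Phi> (x /\<^sub>R norm x)" if x: "x \<noteq> 0" for x
  proof -
    have "\<Phi> x = ennreal (1 / norm x) * (\<integral>\<^sup>+l. ennreal ((1 / norm x * l) powr (a - 1) * exp (- (1 / norm x * l * (norm x - x \<bullet> e)))) * indicator {0<..} (1 / norm x * l) \<partial>lborel)"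
      unfolding \<Phi>_def using x by (subst nn_integral_real_affine[where c="1 / norm x" and t=0]) auto
    also have "(\<integral>\<^sup>+l. ennreal ((1 / norm x * l) powr (a - 1) * exp (- (1 / norm x * l * (norm x - x \<bullet> e)))) * indicator {0<..} (1 / norm x * l) \<partial>lborel) =
      (\<integral>\<^sup>+l. ennreal (norm x powr (1 - a)) * (ennreal (l powr (a - 1) * ?k (x /\<^sub>R norm x) l) * indicator {0<..} l) \<partial>lborel)" (is "integral\<^sup>N _ ?l' = integral\<^sup>N _ ?r'")
    proof (rule nn_integral_cong)
      fix l :: real
      have "(1 / norm x * l) powr (a - 1) * exp (- (1 / norm x * l * (norm x - x \<bullet> e))) =
          norm x powr (1 - a) * (l powr (a - 1) * ?k (x /\<^sub>R norm x) l)" if l: "l > 0"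
      proof -
        have "(1 / norm x * l) powr (a - 1) = norm x powr (1 - a) * l powr (a - 1)"
          using l x powr_minus[of "norm x" "1 - a"] by (simp add: powr_divide field_simps)
        moreover have "1 / norm x * l * (norm x - x \<bullet> e) = l * (norm (x /\<^sub>R norm x) - (x /\<^sub>R norm x) \<bullet> e)"
          using x by (simp add: field_simps)
        ultimately show ?thesis by simp
      qed
      then show "?l' l = ?r' l"
        using x by (auto simp: indicator_def zero_less_divide_iff simp flip: ennreal_mult)
    qed
    also have "\<dots> = ennreal (norm x powr (1 - a)) * \<Phi> (x /\<^sub>R norm x)"
      unfolding \<Phi>_def by (rule nn_integral_cmult) (rule meas)
    also have "ennreal (1 / norm x) * (ennreal (norm x powr (1 - a)) * \<Phi> (x /\<^sub>R norm x)) = ennreal (norm x powr (- a)) * \<Phi> (x /\<^sub>R norm x)"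
      using x by (simp add: mult.assoc[symmetric] powr_diff powr_minus divide_simps flip: ennreal_mult)
    finally show ?thesis .
  qed

  have "X = (\<integral>\<^sup>+x. \<Phi> (x /\<^sub>R norm x) * ennreal (norm x powr (- 1 - a) * exp (- norm x)) \<partial>lborel)"
    unfolding X_def
  proof (rule nn_integral_cong)
    fix x :: 'a
    show "\<Phi> x * ennreal (exp (- norm x) / norm x) = \<Phi> (x /\<^sub>R norm x) * ennreal (norm x powr (- 1 - a) * exp (- norm x))"
    \<comment> \<open>At the origin division by 0 and \<open>0 powr\<close> both give 0, so both
      weights vanish there and absorb an infinite \<Phi>.\<close>
    proof (cases "x = 0")
      case False
      have eq: "- 1 - a = - a - 1" by simp
      have "norm x powr (- a) * (exp (- norm x) / norm x) = norm x powr (- 1 - a) * exp (- norm x)"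
        using False powr_diff[of "norm x" "- a" 1] unfolding eq by simp
      then show ?thesis unfolding hom[OF False]
        by (metis ennreal_mult' mult.assoc mult.commute powr_ge_zero)
    qed simp
  qed
  also have "\<dots> = ennreal (Gamma (?n - 1 - a)) * (\<integral>\<^sup>+\<omega>. \<Phi> \<omega> \<partial>sphere_measure)"
    by (rule nn_integral_polar_exp) (use a in auto)
  also have "(\<integral>\<^sup>+\<omega>. \<Phi> \<omega> \<partial>sphere_measure) =
      (\<integral>\<^sup>+l. \<integral>\<^sup>+\<omega>. ennreal (l powr (a - 1) * ?k \<omega> l) * indicator {0<..} l \<partial>sphere_measure \<partial>lborel)"
    unfolding \<Phi>_def by (rule nn_integral_Fubini[OF sphere_sigma_finite sigma_finite_lborel], rule measurable_sphere_pair) measurable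
  also have "\<dots> = (\<integral>\<^sup>+l\<in>{0<..}. ennreal (l powr (a - 1)) * sphere_kernel l e \<partial>lborel)"
    (is "_ = ?A")
  proof (rule nn_integral_cong)
    fix l :: real
    have "(\<integral>\<^sup>+\<omega>. ennreal (l powr (a - 1) * ?k \<omega> l) * indicator {0<..} l \<partial>sphere_measure) =
      (\<integral>\<^sup>+\<omega>. ennreal (l powr (a - 1)) * indicator {0<..} l * ennreal (exp (- (l * (1 - \<omega> \<bullet> e)))) \<partial>sphere_measure)"
      by (intro nn_integral_cong) (auto simp: indicator_def ennreal_mult)
    also have "\<dots> = ennreal (l powr (a - 1)) * indicator {0<..} l * sphere_kernel l e"
      unfolding sphere_kernel_def by (rule nn_integral_cmult, rule measurable_sphere) measurable
    finally show "(\<integral>\<^sup>+\<omega>. ennreal (l powr (a - 1) * ?k \<omega> l) * indicator {0<..} l \<partial>sphere_measure) =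
      ennreal (l powr (a - 1)) * sphere_kernel l e * indicator {0<..} l" by (simp add: mult_ac)
  qed
  finally have X1: "X = ennreal (Gamma (?n - 1 - a)) * ?A" .

  \<comment> \<open>The integrand after \<open>nn_integral_Schloemilch\<close> with r = |x| and
    \<alpha> = 1 + l; the factor 1 / sqrt(pi) normalises it.\<close>
  define G where "G x l t = ennreal (1 / sqrt pi * (l powr (a - 1) * t powr (- 1 / 2)) * exp (- ((1 + l)\<^sup>2 / (4 * t))))
    * (indicator {0<..} l * indicator {0<..} t) * ennreal (exp (- (t * (norm x)\<^sup>2) + x \<bullet> (l *\<^sub>R e)))" for x l t
  have [measurable (raw)]: "(\<lambda>p. G (f p) (g p) (h p)) \<in> borel_measurable M"
    if [measurable]: "f \<in> borel_measurable M" "g \<in> borel_measurable M" "h \<in> borel_measurable M"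
    for f g h and M :: "'m measure" unfolding G_def by measurable
  have "X = (\<integral>\<^sup>+x. \<integral>\<^sup>+l. \<integral>\<^sup>+t. G x l t \<partial>lborel \<partial>lborel \<partial>lborel)"
    unfolding X_def
  proof (rule nn_integral_cong_AE)
    show "AE x in lborel. \<Phi> x * ennreal (exp (- norm x) / norm x) = (\<integral>\<^sup>+l. \<integral>\<^sup>+t. G x l t \<partial>lborel \<partial>lborel)"
      using AE_lborel_singleton[of 0]
    proof eventually_elim
      fix x :: 'a assume x: "x \<noteq> 0"
      have "(\<integral>\<^sup>+t. G x l t \<partial>lborel) = ennreal (l powr (a - 1) * ?k x l) * indicator {0<..} l
         * ennreal (exp (- norm x) / norm x)" for l
      proof (cases "l > 0")
        case True
        have "(\<integral>\<^sup>+t. G x l t \<partial>lborel) = (\<integral>\<^sup>+t. ennreal (1 / sqrt pi * l powr (a - 1) * exp (x \<bullet> (l *\<^sub>R e)))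
           * (ennreal (t powr (- 1 / 2) * exp (- ((norm x)\<^sup>2 * t) - (1 + l)\<^sup>2 / (4 * t))) * indicator {0<..} t) \<partial>lborel)" (is "integral\<^sup>N _ ?l'' = integral\<^sup>N _ ?r''")
        proof (rule nn_integral_cong)
          fix t :: real
          have "1 / sqrt pi * (l powr (a - 1) * t powr (- 1 / 2)) * exp (- ((1 + l)\<^sup>2 / (4 * t))) * exp (- (t * (norm x)\<^sup>2) + x \<bullet> (l *\<^sub>R e))
            = 1 / sqrt pi * l powr (a - 1) * exp (x \<bullet> (l *\<^sub>R e)) * (t powr (- 1 / 2) * exp (- ((norm x)\<^sup>2 * t) - (1 + l)\<^sup>2 / (4 * t)))"
            by (simp add: exp_diff exp_add exp_minus field_simps)
          then show "?l'' t = ?r'' t"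
            using True unfolding G_def by (auto simp: indicator_def simp flip: ennreal_mult)
        qed
        also have "\<dots> = ennreal (1 / sqrt pi * l powr (a - 1) * exp (x \<bullet> (l *\<^sub>R e))) * ennreal (sqrt pi / norm x * exp (- ((1 + l) * norm x)))"
          using x True by (subst nn_integral_cmult, measurable, subst nn_integral_Schloemilch) auto
        also have "\<dots> = ennreal (l powr (a - 1) * ?k x l * (exp (- norm x) / norm x))"
        proof -
          have "exp (x \<bullet> (l *\<^sub>R e)) * exp (- ((1 + l) * norm x)) = ?k x l * exp (- norm x)"
            unfolding exp_add[symmetric] by (simp add: algebra_simps)
          then have "1 / sqrt pi * l powr (a - 1) * exp (x \<bullet> (l *\<^sub>R e)) * (sqrt pi / norm x * exp (- ((1 + l) * norm x))) =
             l powr (a - 1) * ?k x l * (exp (- norm x) / norm x)" using x by (simp add: field_simps)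
          then show ?thesis by (simp flip: ennreal_mult)
        qed
        finally show ?thesis using True by (simp add: mult.assoc flip: ennreal_mult)
      qed (simp add: G_def)
      then show "\<Phi> x * ennreal (exp (- norm x) / norm x) = (\<integral>\<^sup>+l. \<integral>\<^sup>+t. G x l t \<partial>lborel \<partial>lborel)"
        unfolding \<Phi>_def by (simp add: nn_integral_multc)
    qed
  qed
  \<comment> \<open>Three exchanges move t outermost and x innermost. The integrals are then, from
    the inside, a Gaussian in x, a Gamma integral in l and an inverse Gamma integral in t.\<close>
  also have "\<dots> = (\<integral>\<^sup>+l. \<integral>\<^sup>+x. \<integral>\<^sup>+t. G x l t \<partial>lborel \<partial>lborel \<partial>lborel)"
    by (intro nn_integral_Fubini sigma_finite_lborel) measurable
  also have "\<dots> = (\<integral>\<^sup>+l. \<integral>\<^sup>+t. \<integral>\<^sup>+x. G x l t \<partial>lborel \<partial>lborel \<partial>lborel)"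
    by (intro nn_integral_cong nn_integral_Fubini sigma_finite_lborel) measurable
  also have "\<dots> = (\<integral>\<^sup>+t. \<integral>\<^sup>+l. \<integral>\<^sup>+x. G x l t \<partial>lborel \<partial>lborel \<partial>lborel)"
    by (intro nn_integral_Fubini sigma_finite_lborel) measurable
  also have "\<dots> = (\<integral>\<^sup>+t. ennreal (pi powr ((?n - 1) / 2) * Gamma a * 2 powr a) *
      (ennreal (t powr (- ((?n - 1) / 2 - a) - 1) * exp (- (1 / 4 / t))) * indicator {0<..} t) \<partial>lborel)" (is "integral\<^sup>N _ ?l = integral\<^sup>N _ ?r")
  proof (rule nn_integral_cong)
    fix t :: real
    show "?l t = ?r t"
    proof (cases "t > 0")
      case t: True
      have "(\<integral>\<^sup>+x. G x l t \<partial>lborel) = ennreal (pi powr ((?n - 1) / 2) * t powr (- 1 / 2 - ?n / 2) * exp (- (1 / 4 / t))) *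
         (ennreal (l powr (a - 1) * exp (- (1 / (2 * t) * l))) * indicator {0<..} l)" for l
      proof (cases "l > 0")
        case l: True
        have "(\<integral>\<^sup>+x. G x l t \<partial>lborel) = ennreal (1 / sqrt pi * (l powr (a - 1) * t powr (- 1 / 2)) * exp (- ((1 + l)\<^sup>2 / (4 * t))))
           * (\<integral>\<^sup>+x. ennreal (exp (- (t * (norm x)\<^sup>2) + x \<bullet> (l *\<^sub>R e))) \<partial>lborel)"
          unfolding G_def using t l by (simp add: nn_integral_cmult)
        also have "\<dots> = ennreal (1 / sqrt pi * (l powr (a - 1) * t powr (- 1 / 2)) * exp (- ((1 + l)\<^sup>2 / (4 * t))) *
           ((pi / t) powr (?n / 2) * exp (l\<^sup>2 / (4 * t))))"
          unfolding nn_integral_gaussian[OF t] using e t l by (simp flip: ennreal_mult)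
        also have "1 / sqrt pi * (l powr (a - 1) * t powr (- 1 / 2)) * exp (- ((1 + l)\<^sup>2 / (4 * t))) *
           ((pi / t) powr (?n / 2) * exp (l\<^sup>2 / (4 * t))) =
           (1 / sqrt pi * pi powr (?n / 2)) * (t powr (- 1 / 2) * t powr (- (?n / 2))) * l powr (a - 1) * (exp (- ((1 + l)\<^sup>2 / (4 * t))) * exp (l\<^sup>2 / (4 * t)))"
          using t by (simp add: powr_divide powr_minus field_simps)
        also have "1 / sqrt pi * pi powr (?n / 2) = pi powr ((?n - 1) / 2)"
          by (simp add: diff_divide_distrib powr_diff powr_half_sqrt)
        also have "t powr (- 1 / 2) * t powr (- (?n / 2)) = t powr (- 1 / 2 - ?n / 2)"
          by (simp flip: powr_add)
        \<comment> \<open>Since |e| = 1, the squares of l cancel. The remaining exponent is linear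
          in l, which is what makes the next integral a Gamma integral.\<close>
        also have "exp (- ((1 + l)\<^sup>2 / (4 * t))) * exp (l\<^sup>2 / (4 * t)) = exp (- (1 / 4 / t)) * exp (- (1 / (2 * t) * l))"
          unfolding exp_add[symmetric] using t by (simp add: power2_eq_square field_simps)
        finally show ?thesis using l by (simp add: mult_ac flip: ennreal_mult)
      qed (simp add: G_def)
      then have "(\<integral>\<^sup>+l. \<integral>\<^sup>+x. G x l t \<partial>lborel \<partial>lborel) =
         ennreal (pi powr ((?n - 1) / 2) * t powr (- 1 / 2 - ?n / 2) * exp (- (1 / 4 / t))) * ennreal (Gamma a / (1 / (2 * t)) powr a)"
        using t a by (simp only:) (subst nn_integral_cmult, measurable, subst nn_integral_Gamma, auto)
      also have "\<dots> = ennreal (pi powr ((?n - 1) / 2) * t powr (- 1 / 2 - ?n / 2) * exp (- (1 / 4 / t)) * (Gamma a * (2 powr a * t powr a)))"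
        using t a Gamma_real_pos[of a] by (simp add: powr_divide powr_mult flip: ennreal_mult)
      also have "pi powr ((?n - 1) / 2) * t powr (- 1 / 2 - ?n / 2) * exp (- (1 / 4 / t)) * (Gamma a * (2 powr a * t powr a)) =
        pi powr ((?n - 1) / 2) * Gamma a * 2 powr a * ((t powr (- 1 / 2 - ?n / 2) * t powr a) * exp (- (1 / 4 / t)))"
        by (simp add: mult_ac)
      also have "t powr (- 1 / 2 - ?n / 2) * t powr a = t powr (- ((?n - 1) / 2 - a) - 1)"
        unfolding powr_add[symmetric] by (rule arg_cong[of _ _ "\<lambda>u. t powr u"]) (simp add: field_simps)
      finally show ?thesis using t a Gamma_real_pos[of a] by (simp flip: ennreal_mult)
    qed (simp add: G_def)
  qed
  also have "\<dots> = ennreal (pi powr ((?n - 1) / 2) * Gamma a * 2 powr a) *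
      ennreal (Gamma ((?n - 1) / 2 - a) / (1 / 4) powr ((?n - 1) / 2 - a))"
    using a by (subst nn_integral_cmult, measurable, subst nn_integral_inverse_Gamma) auto
  also have "\<dots> = ennreal (pi powr ((?n - 1) / 2) * Gamma a * 2 powr a * Gamma ((?n - 1) / 2 - a) * 4 powr ((?n - 1) / 2 - a))"
    using a Gamma_real_pos[of a] Gamma_real_pos[of "(?n - 1) / 2 - a"] by (simp add: powr_divide mult_ac flip: ennreal_mult)
  finally have X2: "X = ennreal (pi powr ((?n - 1) / 2) * Gamma a * 2 powr a * Gamma ((?n - 1) / 2 - a) * 4 powr ((?n - 1) / 2 - a))" .

  have G: "Gamma (?n - 1 - a) > 0" using a by (intro Gamma_real_pos) auto
  have "?A = ennreal (1 / Gamma (?n - 1 - a)) * ennreal (Gamma (?n - 1 - a)) * ?A"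
    using G by (simp flip: ennreal_mult)
  also have "\<dots> = ennreal (1 / Gamma (?n - 1 - a)) * X" unfolding X1 by (simp add: mult.assoc)
  finally show ?thesis unfolding X2 sphere_kernel_mass_def using G a Gamma_real_pos[of a] Gamma_real_pos[of "(?n - 1) / 2 - a"]
    by (simp flip: ennreal_mult)
qed

section \<open>Fourier transform of densities on the sphere\<close>

lemma cnj_measurable [measurable]: "cnj \<in> borel_measurable borel"
  by (intro borel_measurable_continuous_onI continuous_intros)

text \<open>The exchanges with plane waves in the duality argument have this shape: two integrable
  densities coupled by a bounded kernel, so that the product of the densities is a majorant.\<close>

lemma integral_Fubini_bounded:
  fixes u :: "'a \<Rightarrow> complex" and w :: "'b \<Rightarrow> complex"
  assumes M: "sigma_finite_measure M" and N: "sigma_finite_measure N"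
    and u: "integrable M u" and w: "integrable N w"
    and v[measurable]: "(\<lambda>(x, y). v x y) \<in> borel_measurable (M \<Otimes>\<^sub>M N)"
    and B: "\<And>x y. norm (v x y) \<le> B"
  shows "(\<integral>x. u x * (\<integral>y. w y * v x y \<partial>N) \<partial>M) = (\<integral>y. w y * (\<integral>x. u x * v x y \<partial>M) \<partial>N)"
proof -
  interpret M: sigma_finite_measure M by fact
  interpret N: sigma_finite_measure N by fact
  interpret pair_sigma_finite M N ..
  note [measurable] = borel_measurable_integrable[OF u] borel_measurable_integrable[OF w]
  have "integrable (M \<Otimes>\<^sub>M N) (\<lambda>(x, y). u x * w y)"
    using u w by (intro Fubini_integrable) (auto simp: norm_mult)
  then have "integrable (M \<Otimes>\<^sub>M N) (\<lambda>p. B *\<^sub>R (\<lambda>(x, y). u x * w y) p)"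
    by (rule integrable_scaleR_right)
  then have *: "integrable (M \<Otimes>\<^sub>M N) (\<lambda>(x, y). u x * w y * v x y)"
  proof (rule Bochner_Integration.integrable_bound)
    have "norm (u x * w y * v x y) \<le> norm (B *\<^sub>R (u x * w y))" for x y
      using mult_left_mono[OF B[of x y], of "norm (u x) * norm (w y)"] order_trans[OF norm_ge_zero B[of x y]]
      by (simp add: norm_mult mult_ac)
    then show "AE p in M \<Otimes>\<^sub>M N. norm (case p of (x, y) \<Rightarrow> u x * w y * v x y) \<le> norm (B *\<^sub>R (\<lambda>(x, y). u x * w y) p)"
      by auto
  qed measurable
  have "(\<integral>x. u x * (\<integral>y. w y * v x y \<partial>N) \<partial>M) = (\<integral>x. (\<integral>y. u x * w y * v x y \<partial>N) \<partial>M)"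
    by (simp add: mult.assoc)
  also have "\<dots> = (\<integral>y. (\<integral>x. u x * w y * v x y \<partial>M) \<partial>N)"
    using Fubini_integral[OF *] by simp
  also have "(\<lambda>y. (\<integral>x. u x * w y * v x y \<partial>M)) = (\<lambda>y. (\<integral>x. w y * (u x * v x y) \<partial>M))"
    by (simp add: mult_ac)
  finally show ?thesis by simp
qed

text \<open>When f is not integrable, the Bochner integral is 0 by convention and the bound is
  trivial.\<close>

lemma norm_integral_le_nn_integral:
  "ennreal (norm (integral\<^sup>L M f)) \<le> (\<integral>\<^sup>+x. ennreal (norm (f x)) \<partial>M)"
  by (cases "integrable M f") (simp_all add: integral_norm_bound_ennreal not_integrable_integral_eq)

definition fourier_sphere :: "('a::euclidean_space \<Rightarrow> complex) \<Rightarrow> 'a \<Rightarrow> complex" where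
  "fourier_sphere g \<xi> = (\<integral>\<omega>. g \<omega> * wave \<omega> \<xi> \<partial>sphere_measure)"

lemma sphere_dist_sqr:
  fixes x y :: "'a::euclidean_space"
  assumes "norm x = 1" "norm y = 1"
  shows "(norm (x - y))\<^sup>2 / 2 = 1 - y \<bullet> x"
  using assms by (simp add: power2_norm_eq_inner inner_diff_left inner_diff_right inner_commute norm_eq_1)

lemma integrable_sphere_measure:
  fixes g :: "'a::euclidean_space \<Rightarrow> complex"
  assumes "g \<in> borel_measurable borel" "\<And>x. norm (g x) \<le> B"
  shows "integrable sphere_measure g"
  using finite_sphere_measure assms
  by (intro finite_measure.integrable_const_bound[where B=B]) (auto intro: measurable_sphere)

lemma integrable_gaussian_mult:
  fixes u :: "'a::euclidean_space \<Rightarrow> complex"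
  assumes [measurable]: "u \<in> borel_measurable borel" and K: "\<And>x. norm (u x) \<le> K" and l: "l > 0"
  shows "integrable lborel (\<lambda>\<xi>. complex_of_real (gauss l \<xi>) * u \<xi>)"
proof (rule Bochner_Integration.integrable_bound)
  show "integrable lborel (\<lambda>x::'a. K * exp (- (1 / (2 * l) * (norm x)\<^sup>2)))"
    using l by (intro integrable_mult_right integrable_gaussian) auto
  have "norm (complex_of_real (gauss l \<xi>) * u \<xi>) \<le> norm (K * exp (- (1 / (2 * l) * (norm \<xi>)\<^sup>2)))" for \<xi>
    using mult_right_mono[OF K[of \<xi>], of "gauss l \<xi>"] order_trans[OF norm_ge_zero K[of \<xi>]]
    by (simp add: norm_mult mult_ac)
  then show "AE \<xi> in lborel. norm (complex_of_real (gauss l \<xi>) * u \<xi>) \<le> norm (K * exp (- (1 / (2 * l) * (norm \<xi>)\<^sup>2)))"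
    by auto
qed measurable

text \<open>As a function of x - y this has mass (2 pi)^n and concentrates at 0 as l grows: the
  regularised form of Fourier inversion.\<close>

lemma gaussian_fourier_kernel:
  fixes x y :: "'a::euclidean_space"
  assumes "l > 0"
  shows "(\<integral>\<xi>. complex_of_real (gauss l \<xi>) * wave x \<xi> * exp (\<i> * of_real (y \<bullet> \<xi>)) \<partial>lborel)
    = of_real ((2 * pi * l) powr (real DIM('a) / 2) * exp (- (l * (norm (x - y))\<^sup>2 / 2)))"
proof -
  have "complex_of_real (gauss l \<xi>) * wave x \<xi> * exp (\<i> * of_real (y \<bullet> \<xi>)) =
     exp (\<i> * of_real (\<xi> \<bullet> (y - x))) * complex_of_real (gauss l \<xi>)" for \<xi>
  proof -
    have "\<i> * of_real (\<xi> \<bullet> (y - x)) = (- \<i> * of_real (x \<bullet> \<xi>)) + \<i> * of_real (y \<bullet> \<xi>)"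
      by (simp add: inner_diff_right inner_commute algebra_simps)
    then show ?thesis by (simp only: exp_add mult_ac)
  qed
  then show ?thesis using fourier_gaussian[OF assms, of "y - x"] by (simp only: norm_minus_commute[of x y])
qed

context
  fixes g :: "'a::euclidean_space \<Rightarrow> complex" and B :: real
  assumes g [measurable]: "g \<in> borel_measurable borel" and B: "\<And>x. norm (g x) \<le> B"
begin

lemma borel_measurable_fourier_sphere: "fourier_sphere g \<in> borel_measurable borel"
proof -
  interpret sigma_finite_measure "sphere_measure :: 'a measure" by (rule sphere_sigma_finite)
  show ?thesis unfolding fourier_sphere_def[abs_def]
    by (rule borel_measurable_lebesgue_integral, rule measurable_pair_sphere) measurable
qed

lemma norm_fourier_sphere_le: "norm (fourier_sphere g \<xi>) \<le> B * measure (sphere_measure :: 'a measure) (sphere 0 1)"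
proof -
  interpret finite_measure "sphere_measure :: 'a measure" by (rule finite_sphere_measure)
  have i: "integrable sphere_measure (\<lambda>\<omega>. g \<omega> * wave \<omega> \<xi>)"
    by (rule integrable_sphere_measure[where B=B]) (auto simp: norm_mult B)
  have "norm (fourier_sphere g \<xi>) \<le> (\<integral>\<omega>. norm (g \<omega> * wave \<omega> \<xi>) \<partial>sphere_measure)"
    unfolding fourier_sphere_def by (rule integral_norm_bound)
  also have "\<dots> \<le> (\<integral>\<omega>. B \<partial>(sphere_measure :: 'a measure))"
    by (rule integral_mono[OF integrable_norm[OF i]]) (auto simp: norm_mult B)
  finally show ?thesis by (simp add: mult.commute)
qed

lemma cnj_fourier_sphere:
  "cnj (fourier_sphere g \<xi>) = (\<integral>\<omega>. cnj (g \<omega>) * exp (\<i> * of_real (\<omega> \<bullet> \<xi>)) \<partial>sphere_measure)"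
  unfolding fourier_sphere_def Bochner_Integration.integral_cnj[symmetric]
  by (simp add: exp_cnj del: Bochner_Integration.integral_cnj)

text \<open>One factor of the square is written as an integral over the sphere, then the other. The
  squared transform of a surface density need not be integrable, so it is the Gaussian that licenses
  both exchanges.\<close>

lemma integral_gaussian_fourier_sphere:
  assumes l: "l > 0"
  shows "complex_of_real (\<integral>\<xi>. gauss l \<xi> * (norm (fourier_sphere g \<xi>))\<^sup>2 \<partial>lborel) = (\<integral>\<omega>. g \<omega> * (\<integral>\<omega>'. cnj (g \<omega>') *
      of_real ((2 * pi * l) powr (real DIM('a) / 2) * exp (- (l * (norm (\<omega> - \<omega>'))\<^sup>2 / 2))) \<partial>sphere_measure) \<partial>sphere_measure)"
proof -
  let ?K = "\<lambda>(w :: 'a) (v :: 'a). of_real ((2 * pi * l) powr (real DIM('a) / 2) * exp (- (l * (norm (w - v))\<^sup>2 / 2)))"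
  define P where "P \<xi> = complex_of_real (gauss l \<xi>)" for \<xi> :: 'a
  note [measurable] = borel_measurable_fourier_sphere
  have [measurable]: "P \<in> borel_measurable borel" unfolding P_def[abs_def] by measurable
  note ig = integrable_sphere_measure[OF g B]
  have icg: "integrable sphere_measure (\<lambda>\<omega>. cnj (g \<omega>))"
    by (rule integrable_sphere_measure[where B=B]) (auto simp: B)
  have "complex_of_real (\<integral>\<xi>. gauss l \<xi> * (norm (fourier_sphere g \<xi>))\<^sup>2 \<partial>lborel) =
     (\<integral>\<xi>. (P \<xi> * cnj (fourier_sphere g \<xi>)) * fourier_sphere g \<xi> \<partial>lborel)"
    unfolding integral_complex_of_real[symmetric] of_real_mult complex_norm_square P_def by (simp only: mult_ac)
  also have "\<dots> = (\<integral>\<xi>. (P \<xi> * cnj (fourier_sphere g \<xi>)) * (\<integral>\<omega>. g \<omega> * wave \<omega> \<xi> \<partial>sphere_measure) \<partial>lborel)"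
    by (simp add: fourier_sphere_def)
  also have "\<dots> = (\<integral>\<omega>. g \<omega> * (\<integral>\<xi>. (P \<xi> * cnj (fourier_sphere g \<xi>)) * wave \<omega> \<xi> \<partial>lborel) \<partial>sphere_measure)"
  proof (rule integral_Fubini_bounded[OF sigma_finite_lborel sphere_sigma_finite _ ig, where B=1])
    show "integrable lborel (\<lambda>\<xi>. P \<xi> * cnj (fourier_sphere g \<xi>))"
      unfolding P_def by (rule integrable_gaussian_mult[OF _ _ l]) (auto intro: norm_fourier_sphere_le)
    show "(\<lambda>(\<xi>, \<omega>). wave \<omega> \<xi>) \<in> borel_measurable (lborel \<Otimes>\<^sub>M sphere_measure)"
      by (rule measurable_pair_sphere) measurable
  qed simp
  also have "\<dots> = (\<integral>\<omega>. g \<omega> * (\<integral>\<omega>'. cnj (g \<omega>') * ?K \<omega> \<omega>' \<partial>sphere_measure) \<partial>sphere_measure)"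
  proof -
    have "(\<integral>\<xi>. (P \<xi> * cnj (fourier_sphere g \<xi>)) * wave \<omega> \<xi> \<partial>lborel) = (\<integral>\<omega>'. cnj (g \<omega>') * ?K \<omega> \<omega>' \<partial>sphere_measure)" for \<omega>
    proof -
      have "(\<integral>\<xi>. (P \<xi> * cnj (fourier_sphere g \<xi>)) * wave \<omega> \<xi> \<partial>lborel) =
        (\<integral>\<xi>. (P \<xi> * wave \<omega> \<xi>) * (\<integral>\<omega>'. cnj (g \<omega>') * exp (\<i> * of_real (\<omega>' \<bullet> \<xi>)) \<partial>sphere_measure) \<partial>lborel)"
        by (simp add: cnj_fourier_sphere mult_ac)
      also have "\<dots> = (\<integral>\<omega>'. cnj (g \<omega>') * (\<integral>\<xi>. (P \<xi> * wave \<omega> \<xi>) * exp (\<i> * of_real (\<omega>' \<bullet> \<xi>)) \<partial>lborel) \<partial>sphere_measure)"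
      proof (rule integral_Fubini_bounded[OF sigma_finite_lborel sphere_sigma_finite _ icg, where B=1])
        show "integrable lborel (\<lambda>\<xi>. P \<xi> * wave \<omega> \<xi>)"
          unfolding P_def by (rule integrable_gaussian_mult[OF _ _ l, where K=1]) auto
        show "(\<lambda>(\<xi>, \<omega>). exp (\<i> * of_real (\<omega> \<bullet> \<xi>))) \<in> borel_measurable (lborel \<Otimes>\<^sub>M sphere_measure)"
          by (rule measurable_pair_sphere) measurable
      qed simp
      finally show ?thesis unfolding P_def gaussian_fourier_kernel[OF l] .
    qed
    then show ?thesis by simp
  qed
  finally show ?thesis .
qed

text \<open>Schur test: the Gaussian kernel is symmetric, so \<open>2 |g(\<omega>) g(\<omega>')| \<le> |g(\<omega>)|\<^sup>2 + |g(\<omega>')|\<^sup>2\<close> suffices.\<close>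

lemma nn_integral_gaussian_fourier_sphere_le:
  assumes l: "l > 0"
  shows "(\<integral>\<^sup>+\<xi>. ennreal (gauss l \<xi> * (norm (fourier_sphere g \<xi>))\<^sup>2) \<partial>lborel) \<le>
    ennreal ((2 * pi * l) powr (real DIM('a) / 2)) * (\<integral>\<^sup>+\<omega>. ennreal ((norm (g \<omega>))\<^sup>2) * sphere_kernel l \<omega> \<partial>sphere_measure)"
proof -
  let ?S = "sphere_measure :: 'a measure"
  note [measurable] = borel_measurable_fourier_sphere
  define c where "c = (2 * pi * l) powr (real DIM('a) / 2)"
  define K where "K x y = exp (- (l * (norm (x - y))\<^sup>2 / 2))" for x y :: 'a
  have [measurable (raw)]: "(\<lambda>p. K (f p) (h p)) \<in> borel_measurable M"
    if [measurable]: "f \<in> borel_measurable M" "h \<in> borel_measurable M" for f h and M :: "'m measure"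
    unfolding K_def by measurable
  have c: "c \<ge> 0" by (simp add: c_def)
  have K0: "K x y \<ge> 0" for x y by (simp add: K_def)
  have Ksym: "K x y = K y x" for x y by (simp add: K_def norm_minus_commute)
  let ?k = "\<lambda>w v. ennreal ((norm (g w))\<^sup>2 * K w v)"
  let ?L = "\<lambda>z. norm (g z * (\<integral>\<omega>'. cnj (g \<omega>') * of_real (c * K z \<omega>') \<partial>?S))"
  define I where "I = (\<integral>\<^sup>+\<omega>. \<integral>\<^sup>+\<omega>'. ?k \<omega> \<omega>' \<partial>?S \<partial>?S)"
  have "integrable lborel (\<lambda>\<xi>. gauss l \<xi> * (norm (fourier_sphere g \<xi>))\<^sup>2)"
  proof -
    have "integrable lborel (\<lambda>\<xi>. complex_of_real (gauss l \<xi>) * of_real ((norm (fourier_sphere g \<xi>))\<^sup>2))"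
      by (rule integrable_gaussian_mult[OF _ _ l, where K="(B * measure ?S (sphere 0 1))\<^sup>2"])
        (auto simp: norm_power intro!: power_mono norm_fourier_sphere_le)
    then have "integrable lborel (\<lambda>\<xi>. complex_of_real (gauss l \<xi> * (norm (fourier_sphere g \<xi>))\<^sup>2))"
      by simp
    then show ?thesis by (simp only: complex_of_real_integrable_eq)
  qed
  then have "(\<integral>\<^sup>+\<xi>. ennreal (gauss l \<xi> * (norm (fourier_sphere g \<xi>))\<^sup>2) \<partial>lborel) =
    ennreal (\<integral>\<xi>. gauss l \<xi> * (norm (fourier_sphere g \<xi>))\<^sup>2 \<partial>lborel)"
    by (rule nn_integral_eq_integral) auto
  also have "\<dots> \<le> ennreal (norm (complex_of_real (\<integral>\<xi>. gauss l \<xi> * (norm (fourier_sphere g \<xi>))\<^sup>2 \<partial>lborel)))"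
    by (rule ennreal_leI) simp
  also have "\<dots> \<le> (\<integral>\<^sup>+\<omega>. ennreal (?L \<omega>) \<partial>?S)"
    unfolding integral_gaussian_fourier_sphere[OF l] c_def K_def by (rule norm_integral_le_nn_integral)
  also have "\<dots> \<le> (\<integral>\<^sup>+\<omega>. \<integral>\<^sup>+\<omega>'. ennreal (norm (g \<omega>) * norm (g \<omega>') * (c * K \<omega> \<omega>')) \<partial>?S \<partial>?S)" (is "integral\<^sup>N _ ?l \<le> integral\<^sup>N _ ?r")
  proof (rule nn_integral_mono)
    fix \<omega> :: 'a
    have "ennreal (?L \<omega>) = ennreal (norm (\<integral>\<omega>'. g \<omega> * (cnj (g \<omega>') * of_real (c * K \<omega> \<omega>')) \<partial>?S))" by simp
    also have "\<dots> \<le> (\<integral>\<^sup>+\<omega>'. ennreal (norm (g \<omega> * (cnj (g \<omega>') * of_real (c * K \<omega> \<omega>')))) \<partial>?S)"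
      by (rule norm_integral_le_nn_integral)
    finally show "?l \<omega> \<le> ?r \<omega>" using c K0 by (simp add: norm_mult mult_ac)
  qed
  also have "\<dots> \<le> (\<integral>\<^sup>+\<omega>. \<integral>\<^sup>+\<omega>'. ennreal (c / 2) * ?k \<omega> \<omega>' + ennreal (c / 2) * ?k \<omega>' \<omega> \<partial>?S \<partial>?S)"
  proof (intro nn_integral_mono)
    fix \<omega> \<omega>' :: 'a
    have "norm (g \<omega>) * norm (g \<omega>') \<le> ((norm (g \<omega>))\<^sup>2 + (norm (g \<omega>'))\<^sup>2) / 2"
      using sum_squares_bound[of "norm (g \<omega>)" "norm (g \<omega>')"] by simp
    then have "norm (g \<omega>) * norm (g \<omega>') * (c * K \<omega> \<omega>') \<le> ((norm (g \<omega>))\<^sup>2 + (norm (g \<omega>'))\<^sup>2) / 2 * (c * K \<omega> \<omega>')"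
      using c K0 by (intro mult_right_mono) auto
    also have "\<dots> = c / 2 * ((norm (g \<omega>))\<^sup>2 * K \<omega> \<omega>') + c / 2 * ((norm (g \<omega>'))\<^sup>2 * K \<omega>' \<omega>)"
      by (simp add: Ksym[of \<omega>' \<omega>] algebra_simps)
    finally show "ennreal (norm (g \<omega>) * norm (g \<omega>') * (c * K \<omega> \<omega>')) \<le> ennreal (c / 2) * ?k \<omega> \<omega>' + ennreal (c / 2) * ?k \<omega>' \<omega>"
      using c K0 by (simp add: ennreal_leI flip: ennreal_mult ennreal_plus)
  qed
  also have "\<dots> = ennreal (c / 2) * I + ennreal (c / 2) * I"
  proof -
    interpret sigma_finite_measure ?S by (rule sphere_sigma_finite)
    have m[measurable]: "(\<lambda>\<omega>'. ?k \<omega> \<omega>') \<in> borel_measurable ?S"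
       "(\<lambda>\<omega>'. ?k \<omega>' \<omega>) \<in> borel_measurable ?S" for \<omega> by (rule measurable_sphere; measurable)+
    have p1: "(\<lambda>(\<omega>, \<omega>'). ?k \<omega> \<omega>') \<in> borel_measurable (?S \<Otimes>\<^sub>M ?S)"
      by (rule measurable_sphere_pair, rule measurable_pair_sphere) measurable
    have p2: "(\<lambda>(\<omega>, \<omega>'). ?k \<omega>' \<omega>) \<in> borel_measurable (?S \<Otimes>\<^sub>M ?S)"
      by (rule measurable_sphere_pair, rule measurable_pair_sphere) measurable
    have n[measurable]: "(\<lambda>\<omega>. \<integral>\<^sup>+\<omega>'. ?k \<omega> \<omega>' \<partial>?S) \<in> borel_measurable ?S"
       "(\<lambda>\<omega>. \<integral>\<^sup>+\<omega>'. ?k \<omega>' \<omega> \<partial>?S) \<in> borel_measurable ?S"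
      using borel_measurable_nn_integral[OF p1] borel_measurable_nn_integral[OF p2] by auto
    have "(\<integral>\<^sup>+\<omega>. \<integral>\<^sup>+\<omega>'. ?k \<omega>' \<omega> \<partial>?S \<partial>?S) = I"
      unfolding I_def by (rule nn_integral_Fubini[OF sphere_sigma_finite sphere_sigma_finite p2])
    then show ?thesis by (simp add: nn_integral_add nn_integral_cmult I_def)
  qed
  also have "\<dots> = ennreal c * I"
    using c by (simp flip: distrib_right ennreal_plus)
  also have "I = (\<integral>\<^sup>+\<omega>. ennreal ((norm (g \<omega>))\<^sup>2) * sphere_kernel l \<omega> \<partial>sphere_measure)"
    unfolding I_def
  proof (rule nn_integral_cong)
    fix \<omega> assume "\<omega> \<in> space ?S"
    then have w: "norm \<omega> = 1" by simp
    have "(\<integral>\<^sup>+\<omega>'. ?k \<omega> \<omega>' \<partial>?S) = (\<integral>\<^sup>+\<omega>'. ennreal ((norm (g \<omega>))\<^sup>2) * ennreal (exp (- (l * (1 - \<omega>' \<bullet> \<omega>)))) \<partial>?S)" (is "integral\<^sup>N _ ?l' = integral\<^sup>N _ ?r'")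
    proof (rule nn_integral_cong)
      fix \<omega>' assume "\<omega>' \<in> space ?S"
      then have "(norm (\<omega> - \<omega>'))\<^sup>2 / 2 = 1 - \<omega>' \<bullet> \<omega>" using w by (intro sphere_dist_sqr) auto
      then have "K \<omega> \<omega>' = exp (- (l * (1 - \<omega>' \<bullet> \<omega>)))" unfolding K_def by (metis times_divide_eq_right)
      then show "?l' \<omega>' = ?r' \<omega>'" by (simp add: ennreal_mult)
    qed
    also have "\<dots> = ennreal ((norm (g \<omega>))\<^sup>2) * sphere_kernel l \<omega>"
      unfolding sphere_kernel_def by (rule nn_integral_cmult, rule measurable_sphere) measurable
    finally show "(\<integral>\<^sup>+\<omega>'. ?k \<omega> \<omega>' \<partial>?S) = ennreal ((norm (g \<omega>))\<^sup>2) * sphere_kernel l \<omega>" .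
  qed
  finally show ?thesis unfolding c_def .
qed

end

section \<open>The sharp constant and the dual inequality\<close>

lemma Gamma_duplication_real:
  fixes x :: real
  assumes "x > 0"
  shows "Gamma x * Gamma (x + 1/2) = 2 powr (1 - 2 * x) * sqrt pi * Gamma (2 * x)"
proof -
  have n: "complex_of_real x \<notin> \<int>\<^sub>\<le>\<^sub>0" "complex_of_real x + 1/2 \<notin> \<int>\<^sub>\<le>\<^sub>0"
    using assms by (auto elim!: nonpos_Ints_cases simp: complex_eq_iff)
  have 1: "complex_of_real x + 1/2 = of_real (x + 1/2)" "2 * complex_of_real x = of_real (2 * x)" by simp_all
  have 2: "exp ((1 - 2 * complex_of_real x) * complex_of_real (ln 2)) = of_real (exp ((1 - 2 * x) * ln 2))"
    by (simp flip: exp_of_real)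
  have "complex_of_real (Gamma x * Gamma (x + 1/2)) = of_real (exp ((1 - 2 * x) * ln 2) * sqrt pi * Gamma (2 * x))"
    using Gamma_legendre_duplication[OF n] unfolding 2
    by (simp only: 1 Gamma_complex_of_real of_real_mult[symmetric])
  then show ?thesis unfolding of_real_eq_iff by (simp add: powr_def)
qed

text \<open>Here \<open>Gamma s * 2 powr s\<close> is the normalisation of |xi|^(-2s) as a
  superposition of Gaussians. With a = n/2 - s the kernel mass contains Gamma(s - 1/2), and the
  duplication formula trades it for Gamma(2s - 1) / Gamma(s).\<close>

lemma sphere_trace_const:
  fixes s :: real
  assumes s: "1 / 2 < s" "s < real n / 2"
  shows sphere_trace_const_pos: "sphere_trace_const n s > 0" (is ?A)
    and sphere_trace_const_square: "(sphere_trace_const n s)\<^sup>2 =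
      (2 * pi) powr (- (real n / 2)) * sphere_kernel_mass n (real n / 2 - s) / (Gamma s * 2 powr s)" (is ?B)
proof -
  define X where "X = 2 powr (1 - 2 * s) *
       (Gamma (2 * s - 1) * Gamma (real n / 2 - s) / ((Gamma s)\<^sup>2 * Gamma (real n / 2 - 1 + s)))"
  have n: "real n > 1" using s by linarith
  then have "n > 1" by simp
  then have n2: "real n / 2 \<ge> 1" by simp
  have G: "Gamma (2 * s - 1) > 0" "Gamma (real n / 2 - s) > 0" "Gamma s > 0" "Gamma (real n / 2 - 1 + s) > 0"
      "Gamma (s - 1/2) > 0" using s n2 by (auto intro!: Gamma_real_pos)
  then have X: "X > 0" by (simp add: X_def)
  then show ?A unfolding sphere_trace_const_def X_def[symmetric] by simp
  have dup: "Gamma (s - 1/2) = 2 powr (2 - 2 * s) * sqrt pi * Gamma (2 * s - 1) / Gamma s"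
  proof -
    have "s - 1/2 + 1/2 = s" "1 - 2 * (s - 1/2) = 2 - 2 * s" "2 * (s - 1/2) = 2 * s - 1" by simp_all
    then have "Gamma (s - 1/2) * Gamma s = 2 powr (2 - 2 * s) * sqrt pi * Gamma (2 * s - 1)"
      using Gamma_duplication_real[of "s - 1/2"] s by simp
    then show ?thesis using G by (simp only: nonzero_eq_divide_eq[OF G(3)[THEN less_imp_neq, symmetric]])
  qed
  have p: "pi powr ((real n - 1) / 2) = pi powr (real n / 2) / sqrt pi"
    by (simp add: diff_divide_distrib powr_diff powr_half_sqrt)
  have e: "real n / 2 - s + s = real n / 2" "(real n - 1) / 2 - (real n / 2 - s) = s - 1/2"
      "real n - 1 - (real n / 2 - s) = real n / 2 - 1 + s" by (simp_all add: field_simps)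
  have f: "(4::real) powr (s - 1/2) = 2 powr (2 * s - 1)"
    using powr_powr[of 2 2 "s - 1/2"] by (simp add: right_diff_distrib)
  \<comment> \<open>The left side lists the powers of 2 as they arise when the right side of the
    claim is unfolded, so that the final comparison only has to match factors.\<close>
  have t: "(2::real) powr (- (real n / 2)) * 2 powr (real n / 2 - s) * 2 powr (2 * s - 1) * 2 powr (2 - 2 * s) / 2 powr s = 2 powr (1 - 2 * s)"
    by (simp flip: powr_add powr_diff)
  have "(sphere_trace_const n s)\<^sup>2 = X"
    unfolding sphere_trace_const_def X_def[symmetric] using X by (simp add: powr_half_sqrt)
  also have "X = (2 powr (- (real n / 2)) * 2 powr (real n / 2 - s) * 2 powr (2 * s - 1) * 2 powr (2 - 2 * s) / 2 powr s) *
     (Gamma (2 * s - 1) * Gamma (real n / 2 - s) / ((Gamma s)\<^sup>2 * Gamma (real n / 2 - 1 + s)))"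
    unfolding t X_def ..
  also have "\<dots> = (2 * pi) powr (- (real n / 2)) * sphere_kernel_mass n (real n / 2 - s) / (Gamma s * 2 powr s)"
    unfolding sphere_kernel_mass_def e p f dup using G by (simp add: powr_mult powr_minus power2_eq_square field_simps)
  finally show ?B .
qed

text \<open>The second factor is (2 pi l)^(n/2) divided by (2 pi)^n, so the normalisation of the
  Sobolev norm is built in. As a function of l > 0 the weight is a multiple of l^(a-1) with a = n/2
  - s.\<close>

definition sphere_weight :: "nat \<Rightarrow> real \<Rightarrow> real \<Rightarrow> real" where
  "sphere_weight n s l = l powr (- s - 1) * (l / (2 * pi)) powr (real n / 2)"

lemma sphere_weight_nonneg: "sphere_weight n s l \<ge> 0"
  by (simp add: sphere_weight_def)

lemma sphere_weight_measurable [measurable]: "sphere_weight n s \<in> borel_measurable borel"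
  unfolding sphere_weight_def[abs_def] by measurable

lemma sphere_weight_eq:
  assumes "l > 0"
  shows "l powr (- s - 1) * (2 * pi * l) powr (real n / 2) = (2 * pi) powr real n * sphere_weight n s l"
proof -
  have "(2 * pi) powr (real n / 2) * (2 * pi) powr (real n / 2) = (2 * pi) powr real n" by (simp flip: powr_add)
  then show ?thesis unfolding sphere_weight_def using assms by (simp add: powr_mult powr_divide field_simps)
qed

text \<open>The common row sum of the superposed kernel: independence of the unit vector e is what
  makes the Schur test applicable with constant weights and the constant density optimal.\<close>

lemma nn_integral_sphere_weight:
  fixes s :: real and e :: "'a::euclidean_space"
  assumes s: "1 / 2 < s" "s < real DIM('a) / 2" and e: "norm e = 1"
  shows "(\<integral>\<^sup>+l\<in>{0<..}. ennreal (sphere_weight DIM('a) s l) * sphere_kernel l e \<partial>lborel) =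
    ennreal ((sphere_trace_const DIM('a) s)\<^sup>2 * (Gamma s * 2 powr s))"
proof -
  let ?n = "real DIM('a)"
  define a where "a = ?n / 2 - s"
  have a: "0 < a" "a < (?n - 1) / 2" using s by (auto simp: a_def)
  have G: "Gamma s > 0" using s by (intro Gamma_real_pos) auto
  define p where "p = (2 * pi) powr (- (?n / 2))"
  have "sphere_weight DIM('a) s l = p * l powr (a - 1)" if "l > 0" for l
  proof -
    have "(l / (2 * pi)) powr (?n / 2) = l powr (?n / 2) * p"
      using that by (simp add: p_def powr_divide powr_minus_divide)
    moreover have "a - 1 = (- s - 1) + ?n / 2" by (simp add: a_def)
    ultimately show ?thesis by (simp only: sphere_weight_def powr_add mult_ac)
  qed
  then have "(\<integral>\<^sup>+l\<in>{0<..}. ennreal (sphere_weight DIM('a) s l) * sphere_kernel l e \<partial>lborel) =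
      (\<integral>\<^sup>+l. ennreal p * (ennreal (l powr (a - 1)) * sphere_kernel l e * indicator {0<..} l) \<partial>lborel)"
    by (intro nn_integral_cong) (auto simp: indicator_def ennreal_mult p_def mult.assoc)
  also have "\<dots> = ennreal (p * sphere_kernel_mass DIM('a) a)"
    using sphere_kernel_integral[OF e a] sphere_kernel_mass_nonneg[OF a] by (simp add: nn_integral_cmult ennreal_mult p_def)
  also have "p * sphere_kernel_mass DIM('a) a = (sphere_trace_const DIM('a) s)\<^sup>2 * (Gamma s * 2 powr s)"
    using G unfolding sphere_trace_const_square[OF s] p_def a_def by simp
  finally show ?thesis .
qed

text \<open>The dual inequality. The Schur test is applied at each fixed l, and the integration over
  l then turns the Gaussian kernels into their constant row sum.\<close>

lemma nn_integral_weighted_fourier_sphere_le: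
  fixes g :: "'a::euclidean_space \<Rightarrow> complex"
  assumes g[measurable]: "g \<in> borel_measurable borel" and B: "\<And>x. norm (g x) \<le> B"
    and s: "1 / 2 < s" "s < real DIM('a) / 2"
  shows "(\<integral>\<^sup>+\<xi>. ennreal (norm \<xi> powr (- 2 * s) * (norm (fourier_sphere g \<xi>))\<^sup>2) \<partial>lborel) \<le>
    ennreal ((2 * pi) powr (real DIM('a)) * (sphere_trace_const DIM('a) s)\<^sup>2) * (\<integral>\<^sup>+\<omega>. ennreal ((norm (g \<omega>))\<^sup>2) \<partial>sphere_measure)"
proof -
  let ?n = "real DIM('a)" and ?S = "sphere_measure :: 'a measure"
  note [measurable] = borel_measurable_fourier_sphere[OF g B]
  define c where "c = 1 / (Gamma s * 2 powr s)"
  have G: "Gamma s > 0" using s by (intro Gamma_real_pos) auto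
  then have c: "c > 0" by (simp add: c_def)
  define F where "F l \<xi> = gauss l \<xi> * (norm (fourier_sphere g \<xi>))\<^sup>2" for l \<xi>
  have [measurable (raw)]: "(\<lambda>p. F (f p) (h p)) \<in> borel_measurable M"
    if [measurable]: "f \<in> borel_measurable M" "h \<in> borel_measurable M" for f h and M :: "'m measure"
    unfolding F_def by measurable

  let ?u = "\<lambda>z. norm z powr (- 2 * s) * (norm (fourier_sphere g z))\<^sup>2"
  let ?F = "\<lambda>l x. (ennreal (c * l powr (- s - 1)) * indicator {0<..} l) * ennreal (F l x)"
  let ?k = "\<lambda>l w. ennreal (c * (2 * pi) powr ?n) * (ennreal ((norm (g w))\<^sup>2) * (ennreal (sphere_weight DIM('a) s l) * sphere_kernel l w * indicator {0<..} l))"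
  have "(\<integral>\<^sup>+\<xi>. ennreal (?u \<xi>) \<partial>lborel) = (\<integral>\<^sup>+\<xi>. \<integral>\<^sup>+l. ?F l \<xi> \<partial>lborel \<partial>lborel)" (is "integral\<^sup>N _ ?l = integral\<^sup>N _ ?r")
  proof (rule nn_integral_cong_AE)
    \<comment> \<open>The origin is excluded because \<open>powr\<close> is 0 there, whereas the
      integral over l may diverge.\<close>
    show "AE \<xi> in lborel. ?l \<xi> = ?r \<xi>" using AE_lborel_singleton[of 0]
    proof eventually_elim
      fix \<xi> :: 'a assume \<xi>: "\<xi> \<noteq> 0"
      have "(\<integral>\<^sup>+l. ?F l \<xi> \<partial>lborel) =
        (\<integral>\<^sup>+l. ennreal (c * (norm (fourier_sphere g \<xi>))\<^sup>2) * (ennreal (l powr (- s - 1) * exp (- ((norm \<xi>)\<^sup>2 / 2 / l))) * indicator {0<..} l) \<partial>lborel)"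
        using c by (intro nn_integral_cong) (auto simp: F_def indicator_def mult_ac simp flip: ennreal_mult)
      also have "\<dots> = ennreal (c * (norm (fourier_sphere g \<xi>))\<^sup>2) * ennreal (Gamma s / ((norm \<xi>)\<^sup>2 / 2) powr s)"
        using \<xi> s by (subst nn_integral_cmult, measurable, subst nn_integral_inverse_Gamma) auto
      also have "((norm \<xi>)\<^sup>2 / 2) powr s = norm \<xi> powr (2 * s) / 2 powr s"
        using \<xi> by (simp add: powr_divide powr_powr flip: powr_numeral)
      finally show "?l \<xi> = ?r \<xi>"
        using c G by (simp add: c_def powr_minus divide_simps mult_ac flip: ennreal_mult)
    qed
  qed
  also have "\<dots> = (\<integral>\<^sup>+l. \<integral>\<^sup>+\<xi>. ?F l \<xi> \<partial>lborel \<partial>lborel)"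
    by (intro nn_integral_Fubini sigma_finite_lborel) measurable
  also have "\<dots> \<le> (\<integral>\<^sup>+l. \<integral>\<^sup>+\<omega>. ?k l \<omega> \<partial>?S \<partial>lborel)" (is "integral\<^sup>N _ ?l \<le> integral\<^sup>N _ ?r")
  proof (rule nn_integral_mono)
    fix l :: real
    show "?l l \<le> ?r l"
    proof (cases "l > 0")
      case l: True
      have m: "(\<lambda>\<omega>. ennreal ((norm (g \<omega>))\<^sup>2) * sphere_kernel l \<omega>) \<in> borel_measurable ?S"
        by (rule measurable_sphere) measurable
      have "(\<integral>\<^sup>+\<xi>. ?F l \<xi> \<partial>lborel) = ennreal (c * l powr (- s - 1)) * (\<integral>\<^sup>+\<xi>. ennreal (F l \<xi>) \<partial>lborel)"
        using l by (simp add: nn_integral_cmult)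
      also have "\<dots> \<le> ennreal (c * l powr (- s - 1)) *
         (ennreal ((2 * pi * l) powr (?n / 2)) * (\<integral>\<^sup>+\<omega>. ennreal ((norm (g \<omega>))\<^sup>2) * sphere_kernel l \<omega> \<partial>?S))"
        unfolding F_def by (intro mult_left_mono nn_integral_gaussian_fourier_sphere_le[OF g B l]) auto
      also have "\<dots> = ennreal (c * (2 * pi) powr ?n * sphere_weight DIM('a) s l) * (\<integral>\<^sup>+\<omega>. ennreal ((norm (g \<omega>))\<^sup>2) * sphere_kernel l \<omega> \<partial>?S)"
        using c sphere_weight_eq[OF l, of s "DIM('a)"] by (simp add: mult.assoc[symmetric] flip: ennreal_mult) (simp add: mult.assoc)
      also have "\<dots> = (\<integral>\<^sup>+\<omega>. ennreal (c * (2 * pi) powr ?n * sphere_weight DIM('a) s l) * (ennreal ((norm (g \<omega>))\<^sup>2) * sphere_kernel l \<omega>) \<partial>?S)"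
        by (rule nn_integral_cmult[symmetric, OF m])
      also have "\<dots> = (\<integral>\<^sup>+\<omega>. ?k l \<omega> \<partial>?S)"
        using c l by (intro nn_integral_cong) (simp add: ennreal_mult sphere_weight_nonneg mult_ac)
      finally show ?thesis .
    qed simp
  qed
  also have "\<dots> = (\<integral>\<^sup>+\<omega>. \<integral>\<^sup>+l. ?k l \<omega> \<partial>lborel \<partial>?S)"
    by (rule nn_integral_Fubini[OF sigma_finite_lborel sphere_sigma_finite], rule measurable_pair_sphere) measurable
  also have "\<dots> = (\<integral>\<^sup>+\<omega>. ennreal ((2 * pi) powr ?n * (sphere_trace_const DIM('a) s)\<^sup>2) * ennreal ((norm (g \<omega>))\<^sup>2) \<partial>?S)" (is "integral\<^sup>N _ ?l = integral\<^sup>N _ ?r")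
  proof (rule nn_integral_cong)
    fix \<omega> assume "\<omega> \<in> space ?S"
    then have "norm \<omega> = 1" by simp
    from nn_integral_sphere_weight[OF s this] have "?l \<omega> = ennreal (c * (2 * pi) powr ?n) * (ennreal ((norm (g \<omega>))\<^sup>2) *
        ennreal ((sphere_trace_const DIM('a) s)\<^sup>2 * (Gamma s * 2 powr s)))"
      by (simp add: nn_integral_cmult)
    then show "?l \<omega> = ?r \<omega>" using c G by (simp add: c_def mult_ac flip: ennreal_mult)
  qed
  also have "\<dots> = ennreal ((2 * pi) powr ?n * (sphere_trace_const DIM('a) s)\<^sup>2) * (\<integral>\<^sup>+\<omega>. ennreal ((norm (g \<omega>))\<^sup>2) \<partial>?S)"
    by (rule nn_integral_cmult, rule measurable_sphere) measurable
  finally show ?thesis .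
qed

section \<open>Gaussian averages as an approximate identity\<close>

lemma integral_gaussian_normalized:
  "(\<integral>x. exp (- ((norm x)\<^sup>2 / 2)) \<partial>(lborel :: 'a::euclidean_space measure)) = (2 * pi) powr (real DIM('a) / 2)"
proof -
  have "complex_of_real (\<integral>x. exp (- ((norm x)\<^sup>2 / 2)) \<partial>(lborel :: 'a measure)) = of_real ((2 * pi) powr (real DIM('a) / 2))"
    using fourier_gaussian[of 1 "0::'a"] unfolding integral_complex_of_real[symmetric] by simp
  then show ?thesis unfolding of_real_eq_iff .
qed

text \<open>Moving the dilation from the kernel into the argument of f leaves a weight independent
  of l, so one majorant serves both the uniform bound and the limit.\<close>

lemma integral_gaussian_dilate:
  fixes f :: "'a::euclidean_space \<Rightarrow> complex"
  assumes [measurable]: "f \<in> borel_measurable borel" and l: "l > 0"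
  shows "(\<integral>x. f x * of_real ((2 * pi * l) powr (real DIM('a) / 2) * exp (- (l * (norm (x - w))\<^sup>2 / 2))) \<partial>lborel) =
    of_real ((2 * pi) powr (real DIM('a) / 2)) * (\<integral>y. f (w + (1 / sqrt l) *\<^sub>R y) * of_real (exp (- ((norm y)\<^sup>2 / 2))) \<partial>lborel)"
proof -
  define h where "h x = f x * complex_of_real ((2 * pi * l) powr (real DIM('a) / 2) * exp (- (l * (norm (x - w))\<^sup>2 / 2)))" for x
  have [measurable]: "h \<in> borel_measurable borel" unfolding h_def[abs_def] by measurable
  have "(\<integral>x. h x \<partial>lborel) = (\<integral>y. (1 / sqrt l) ^ DIM('a) *\<^sub>R h (w + (1 / sqrt l) *\<^sub>R y) \<partial>lborel)"
    using l by (subst lborel_affine[of "1 / sqrt l" w]) (simp_all add: integral_density integral_distr)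
  also have "\<dots> = (\<integral>y. of_real ((2 * pi) powr (real DIM('a) / 2)) * (f (w + (1 / sqrt l) *\<^sub>R y) * of_real (exp (- ((norm y)\<^sup>2 / 2)))) \<partial>lborel)" (is "integral\<^sup>L _ ?l = integral\<^sup>L _ ?r")
  proof (rule Bochner_Integration.integral_cong[OF refl])
    fix y :: 'a
    have "sqrt l ^ DIM('a) = l powr (real DIM('a) / 2)"
      using l by (simp add: powr_half_sqrt[symmetric] powr_powr flip: powr_realpow)
    then have "(1 / sqrt l) ^ DIM('a) * (2 * pi * l) powr (real DIM('a) / 2) = (2 * pi) powr (real DIM('a) / 2)"
      using l by (simp add: power_divide powr_mult)
    then have e1: "of_real ((1 / sqrt l) ^ DIM('a)) * complex_of_real ((2 * pi * l) powr (real DIM('a) / 2)) = of_real ((2 * pi) powr (real DIM('a) / 2))"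
      by (simp only: of_real_mult[symmetric])
    have e2: "l * (norm (w + (1 / sqrt l) *\<^sub>R y - w))\<^sup>2 / 2 = (norm y)\<^sup>2 / 2"
      using l by (simp add: power_mult_distrib power_divide)
    show "?l y = ?r y"
      unfolding h_def scaleR_conv_of_real e2 e1[symmetric] of_real_mult by (simp only: mult_ac)
  qed
  finally show ?thesis unfolding h_def by simp
qed

text \<open>Both halves feed one dominated convergence on the sphere in
  \<open>sphere_trace_bound\<close>: the bound, uniform in l and w, is the majorant, and the limit
  returns f(w) with the factor (2 pi)^n of Fourier inversion.\<close>

lemma
  fixes f :: "'a::euclidean_space \<Rightarrow> complex"
  assumes cont: "continuous_on UNIV f" and B: "\<And>x. norm (f x) \<le> B"
  shows norm_gaussian_average_le: "l > 0 \<Longrightarrow> norm (\<integral>x. f x * of_real ((2 * pi * l) powr (real DIM('a) / 2) * exp (- (l * (norm (x - w))\<^sup>2 / 2))) \<partial>lborel)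
      \<le> B * (2 * pi) powr (real DIM('a))" (is "_ \<Longrightarrow> ?A")
    and gaussian_average_tendsto: "(\<lambda>k. \<integral>x. f x * of_real ((2 * pi * real (Suc k)) powr (real DIM('a) / 2) * exp (- (real (Suc k) * (norm (x - w))\<^sup>2 / 2))) \<partial>lborel)
      \<longlonglongrightarrow> of_real ((2 * pi) powr (real DIM('a))) * f w" (is ?B)
proof -
  let ?n = "real DIM('a)"
  let ?g = "\<lambda>(y :: 'a). exp (- ((norm y)\<^sup>2 / 2))"
  let ?h = "\<lambda>l y. f (w + (1 / sqrt l) *\<^sub>R y) * of_real (?g y)"
  have [measurable]: "f \<in> borel_measurable borel" using cont by (rule borel_measurable_continuous_onI)
  have i: "integrable lborel (\<lambda>x::'a. ?g x)"
    using integrable_gaussian[of "1/2"] by simp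
  have pp: "(2 * pi) powr (?n / 2) * (2 * pi) powr (?n / 2) = (2 * pi) powr ?n"
    by (simp flip: powr_add)
  show ?A if l: "l > 0"
  proof -
    have iB: "integrable lborel (\<lambda>x::'a. B * ?g x)" by (intro integrable_mult_right i)
    have le: "norm (?h l y) \<le> B * ?g y" for y by (auto simp: norm_mult intro!: mult_right_mono B)
    have "norm (\<integral>y. ?h l y \<partial>lborel) \<le> (\<integral>y. B * ?g y \<partial>(lborel :: 'a measure))"
    proof (rule Bochner_Integration.integral_norm_bound_integral[OF _ iB le])
      show "integrable lborel (\<lambda>y. ?h l y)"
        by (rule Bochner_Integration.integrable_bound[OF iB], measurable) (intro AE_I2 order_trans[OF le], simp)
    qed
    also have "\<dots> = B * (2 * pi) powr (?n / 2)" by (simp add: integral_gaussian_normalized)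
    finally have "(2 * pi) powr (?n / 2) * norm (\<integral>y. ?h l y \<partial>lborel)
       \<le> (2 * pi) powr (?n / 2) * (B * (2 * pi) powr (?n / 2))" by (rule mult_left_mono) simp
    also have "\<dots> = B * (2 * pi) powr ?n" unfolding pp[symmetric] by (simp only: mult_ac)
    finally show ?thesis by (subst integral_gaussian_dilate[OF _ l]) (simp_all add: norm_mult)
  qed
  have "(\<lambda>k. \<integral>y. ?h (real (Suc k)) y \<partial>lborel) \<longlonglongrightarrow> (\<integral>y. f w * of_real (?g y) \<partial>(lborel :: 'a measure))"
  proof (rule integral_dominated_convergence[where w="\<lambda>y. B * ?g y"])
    show "integrable lborel (\<lambda>y::'a. B * ?g y)" by (intro integrable_mult_right i)
    have "(\<lambda>k. 1 / sqrt (real (Suc k))) \<longlonglongrightarrow> 0" by real_asymp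
    then have "(\<lambda>k. w + (1 / sqrt (real (Suc k))) *\<^sub>R y) \<longlonglongrightarrow> w + 0 *\<^sub>R y" for y
      by (intro tendsto_intros)
    then have "(\<lambda>k. f (w + (1 / sqrt (real (Suc k))) *\<^sub>R y)) \<longlonglongrightarrow> f w" for y
      using cont by (intro continuous_on_tendsto_compose[OF cont]) auto
    then show "AE y in lborel. (\<lambda>k. ?h (real (Suc k)) y) \<longlonglongrightarrow> f w * of_real (?g y)"
      by (intro AE_I2 tendsto_intros)
  qed (auto simp: norm_mult intro!: mult_right_mono B)
  then have "(\<lambda>k. of_real ((2 * pi) powr (?n / 2)) * (\<integral>y. ?h (real (Suc k)) y \<partial>lborel))
     \<longlonglongrightarrow> of_real ((2 * pi) powr (?n / 2)) * (\<integral>y. f w * of_real (?g y) \<partial>(lborel :: 'a measure))"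
    by (intro tendsto_intros)
  also have "of_real ((2 * pi) powr (?n / 2)) * (\<integral>y. f w * of_real (?g y) \<partial>(lborel :: 'a measure)) = of_real ((2 * pi) powr ?n) * f w"
    unfolding integral_mult_right_zero integral_complex_of_real integral_gaussian_normalized pp[symmetric] by simp
  finally show ?B
    by (subst integral_gaussian_dilate) auto
qed

section \<open>The trace inequality\<close>

lemma borel_measurable_fourier:
  fixes f :: "'a::euclidean_space \<Rightarrow> complex"
  assumes [measurable]: "f \<in> borel_measurable borel"
  shows "fourier f \<in> borel_measurable borel"
  unfolding fourier_def[abs_def] by measurable

lemma norm_fourier_le: "norm (fourier f \<xi>) \<le> (\<integral>x. norm (f x) \<partial>lborel)"
proof -
  have "norm (fourier f \<xi>) \<le> (\<integral>x. norm (wave x \<xi> * f x) \<partial>lborel)"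
    unfolding fourier_def by (rule integral_norm_bound)
  then show ?thesis by (simp add: norm_mult)
qed

text \<open>Duality with f itself as the density on the sphere: the pairing tends to p N and is at
  most the square root of h p C^2 N, so one factor N cancels. H guards against a default value: a
  divergent integral would make \<open>hom_sobolev_norm s f\<close> equal to 0.\<close>

lemma sphere_trace_bound:
  fixes f :: "'a::euclidean_space \<Rightarrow> complex"
  assumes cont: "continuous_on UNIV f" and B: "\<And>x. norm (f x) \<le> B" and int: "integrable lborel f"
    and s: "1 / 2 < s" "s < real DIM('a) / 2"
    and H: "integrable lborel (\<lambda>\<xi>. norm \<xi> powr (2 * s) * (norm (fourier f \<xi>))\<^sup>2)"
  shows "sphere_L2_norm f \<le> sphere_trace_const DIM('a) s * hom_sobolev_norm s f"
proof -
  let ?n = "real DIM('a)" and ?S = "sphere_measure :: 'a measure"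
  interpret S: finite_measure ?S by (rule finite_sphere_measure)
  have f[measurable]: "f \<in> borel_measurable borel" using cont by (rule borel_measurable_continuous_onI)
  have [measurable]: "f \<in> borel_measurable ?S" by (rule measurable_sphere[OF f])
  note [measurable] = borel_measurable_fourier_sphere[OF f B] borel_measurable_fourier[OF f]
  define C where "C = sphere_trace_const DIM('a) s"
  have C: "C > 0" unfolding C_def by (rule sphere_trace_const_pos[OF s])
  define N where "N = (\<integral>\<omega>. (norm (f \<omega>))\<^sup>2 \<partial>?S)"
  define h where "h = (\<integral>\<xi>. norm \<xi> powr (2 * s) * (norm (fourier f \<xi>))\<^sup>2 \<partial>lborel)"
  have N: "N \<ge> 0" and h: "h \<ge> 0" by (simp_all add: N_def h_def)
  define p where "p = (2 * pi) powr ?n"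
  have p: "p > 0" by (simp add: p_def)
  have B0: "B \<ge> 0" using order_trans[OF norm_ge_zero B] .
  have N': "(\<integral>\<^sup>+\<omega>. ennreal ((norm (f \<omega>))\<^sup>2) \<partial>?S) = ennreal N"
    unfolding N_def
  proof (rule nn_integral_eq_integral)
    show "integrable ?S (\<lambda>\<omega>. (norm (f \<omega>))\<^sup>2)"
      by (rule S.integrable_const_bound[where B="B\<^sup>2"]) (auto intro!: power_mono B)
  qed simp
  have h': "(\<integral>\<^sup>+\<xi>. ennreal (norm \<xi> powr (2 * s) * (norm (fourier f \<xi>))\<^sup>2) \<partial>lborel) = ennreal h"
    unfolding h_def by (rule nn_integral_eq_integral[OF H]) simp
  define P where "P l \<xi> = complex_of_real (gauss l \<xi>)" for l :: real and \<xi> :: 'a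
  have [measurable]: "P l \<in> borel_measurable borel" for l unfolding P_def[abs_def] by measurable
  \<comment> \<open>Z is the Gaussian-regularised pairing of the two transforms. T l w will be (2
    pi)^n times the Gaussian mean of f about w with variance 1/l.\<close>
  define Z where "Z l = (\<integral>\<xi>. P l \<xi> * fourier f \<xi> * cnj (fourier_sphere f \<xi>) \<partial>lborel)" for l
  define T where "T l w = (\<integral>x. f x * of_real ((2 * pi * l) powr (?n / 2) * exp (- (l * (norm (x - w))\<^sup>2 / 2))) \<partial>lborel)" for l and w :: 'a
  have [measurable]: "T l \<in> borel_measurable borel" for l unfolding T_def[abs_def] by measurable

  have sq: "(x powr r)\<^sup>2 = x powr (2 * r)" for x r :: real
    by (simp add: power2_eq_square flip: powr_add)
  let ?u = "\<lambda>x. norm x powr s * norm (fourier f x)"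
  let ?v = "\<lambda>x. norm x powr (- s) * norm (fourier_sphere f x)"
  \<comment> \<open>The Gaussian factor is at most 1 and is dropped, so the bound is uniform in l
    and survives the limit. The weight |xi|^(2s) is split evenly between the two factors.\<close>
  have Z_le: "norm (Z l) \<le> sqrt (h * (p * C\<^sup>2 * N))" if l: "l > 0" for l
  proof -
    have "ennreal (norm (Z l)) \<le> (\<integral>\<^sup>+\<xi>. ennreal (norm (P l \<xi> * fourier f \<xi> * cnj (fourier_sphere f \<xi>))) \<partial>lborel)"
      unfolding Z_def by (rule norm_integral_le_nn_integral)
    also have "\<dots> \<le> (\<integral>\<^sup>+\<xi>. ennreal (?u \<xi>) * ennreal (?v \<xi>) \<partial>lborel)" (is "integral\<^sup>N _ ?l' \<le> integral\<^sup>N _ ?r'")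
    proof (rule nn_integral_mono_AE)
      show "AE \<xi> in lborel. ?l' \<xi> \<le> ?r' \<xi>" using AE_lborel_singleton[of 0]
      proof eventually_elim
        fix \<xi> :: 'a assume "\<xi> \<noteq> 0"
        then have "?u \<xi> * (?v \<xi>) = norm (fourier f \<xi>) * norm (fourier_sphere f \<xi>)"
          by (simp add: powr_minus field_simps)
        moreover have "norm (P l \<xi>) \<le> 1" using l by (simp add: P_def)
        ultimately have "norm (P l \<xi> * fourier f \<xi> * cnj (fourier_sphere f \<xi>)) \<le> ?u \<xi> * (?v \<xi>)"
          using mult_right_mono[of "norm (P l \<xi>)" 1 "norm (fourier f \<xi>) * norm (fourier_sphere f \<xi>)"]
          by (simp only: norm_mult mult.assoc complex_mod_cnj) simp
        then show "?l' \<xi> \<le> ?r' \<xi>" by (simp add: ennreal_leI flip: ennreal_mult)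
      qed
    qed
    finally have "(ennreal (norm (Z l)))\<^sup>2 \<le> (\<integral>\<^sup>+\<xi>. ennreal (?u \<xi>) * ennreal (?v \<xi>) \<partial>lborel)\<^sup>2"
      by (rule power_mono) simp
    also have "\<dots> \<le> (\<integral>\<^sup>+\<xi>. (ennreal (?u \<xi>))\<^sup>2 \<partial>lborel) * (\<integral>\<^sup>+\<xi>. (ennreal (?v \<xi>))\<^sup>2 \<partial>lborel)"
      by (rule Cauchy_Schwarz_nn_integral) measurable
    also have "(\<integral>\<^sup>+\<xi>. (ennreal (?u \<xi>))\<^sup>2 \<partial>lborel) = ennreal h" unfolding h'[symmetric]
      by (intro nn_integral_cong) (simp add: ennreal_power power_mult_distrib sq)
    also have "(\<integral>\<^sup>+\<xi>. (ennreal (?v \<xi>))\<^sup>2 \<partial>lborel) =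
       (\<integral>\<^sup>+\<xi>. ennreal (norm \<xi> powr (- 2 * s) * (norm (fourier_sphere f \<xi>))\<^sup>2) \<partial>lborel)"
      by (intro nn_integral_cong) (simp add: ennreal_power power_mult_distrib sq)
    also have "\<dots> \<le> ennreal (p * C\<^sup>2) * ennreal N"
      using nn_integral_weighted_fourier_sphere_le[OF f B s] unfolding N' p_def C_def .
    finally have "ennreal ((norm (Z l))\<^sup>2) \<le> ennreal (h * (p * C\<^sup>2 * N))"
      using h p N by (simp add: ennreal_power mult_left_mono flip: ennreal_mult)
    then have "(norm (Z l))\<^sup>2 \<le> h * (p * C\<^sup>2 * N)" using h p N by (subst (asm) ennreal_le_iff) auto
    then show ?thesis by (rule real_le_rsqrt)
  qed

  have Z_eq: "Z l = (\<integral>w. cnj (f w) * T l w \<partial>?S)" if l: "l > 0" for l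
  proof -
    have icf: "integrable ?S (\<lambda>\<omega>. cnj (f \<omega>))"
      by (rule integrable_sphere_measure[where B=B]) (auto simp: B)
    have "Z l = (\<integral>\<xi>. (P l \<xi> * fourier f \<xi>) * (\<integral>\<omega>. cnj (f \<omega>) * exp (\<i> * of_real (\<omega> \<bullet> \<xi>)) \<partial>?S) \<partial>lborel)"
      unfolding Z_def cnj_fourier_sphere[OF f B] ..
    also have "\<dots> = (\<integral>\<omega>. cnj (f \<omega>) * (\<integral>\<xi>. (P l \<xi> * fourier f \<xi>) * exp (\<i> * of_real (\<omega> \<bullet> \<xi>)) \<partial>lborel) \<partial>?S)"
    proof (rule integral_Fubini_bounded[OF sigma_finite_lborel sphere_sigma_finite _ icf, where B=1])
      show "integrable lborel (\<lambda>\<xi>. P l \<xi> * fourier f \<xi>)"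
        unfolding P_def by (rule integrable_gaussian_mult[OF _ norm_fourier_le l]) measurable
      show "(\<lambda>(\<xi>, \<omega>). exp (\<i> * of_real (\<omega> \<bullet> \<xi>))) \<in> borel_measurable (lborel \<Otimes>\<^sub>M ?S)"
        by (rule measurable_pair_sphere) measurable
    qed simp
    also have "(\<lambda>\<omega>. \<integral>\<xi>. (P l \<xi> * fourier f \<xi>) * exp (\<i> * of_real (\<omega> \<bullet> \<xi>)) \<partial>lborel) = T l"
    proof
      fix w :: 'a
      have "(\<integral>\<xi>. (P l \<xi> * fourier f \<xi>) * exp (\<i> * of_real (w \<bullet> \<xi>)) \<partial>lborel) =
        (\<integral>\<xi>. (P l \<xi> * exp (\<i> * of_real (w \<bullet> \<xi>))) * (\<integral>x. f x * wave x \<xi> \<partial>lborel) \<partial>lborel)"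
        unfolding fourier_def by (simp add: mult_ac)
      also have "\<dots> = (\<integral>x. f x * (\<integral>\<xi>. (P l \<xi> * exp (\<i> * of_real (w \<bullet> \<xi>))) * wave x \<xi> \<partial>lborel) \<partial>lborel)"
      proof (rule integral_Fubini_bounded[OF sigma_finite_lborel sigma_finite_lborel _ int, where B=1])
        show "integrable lborel (\<lambda>\<xi>. P l \<xi> * exp (\<i> * of_real (w \<bullet> \<xi>)))"
          unfolding P_def by (rule integrable_gaussian_mult[OF _ _ l, where K=1]) auto
        show "(\<lambda>(\<xi>, x). wave x \<xi>) \<in> borel_measurable (lborel \<Otimes>\<^sub>M (lborel :: 'a measure))"
          by measurable
      qed simp
      also have "\<dots> = T l w"
        unfolding T_def gaussian_fourier_kernel[OF l, symmetric] P_def by (simp only: mult_ac)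
      finally show "(\<integral>\<xi>. (P l \<xi> * fourier f \<xi>) * exp (\<i> * of_real (w \<bullet> \<xi>)) \<partial>lborel) = T l w" .
    qed
    finally show ?thesis .
  qed

  have "(\<lambda>k. \<integral>w. cnj (f w) * T (real (Suc k)) w \<partial>?S) \<longlonglongrightarrow> (\<integral>w. cnj (f w) * (of_real p * f w) \<partial>?S)"
  proof (rule integral_dominated_convergence[where w="\<lambda>_. B * (B * p)"])
    show "(\<lambda>w. cnj (f w) * (of_real p * f w)) \<in> borel_measurable ?S" by measurable
    show "(\<lambda>w. cnj (f w) * T (real (Suc k)) w) \<in> borel_measurable ?S" for k
      by (rule measurable_sphere) measurable
    show "AE w in ?S. (\<lambda>k. cnj (f w) * T (real (Suc k)) w) \<longlonglongrightarrow> cnj (f w) * (of_real p * f w)"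
      unfolding T_def p_def by (intro AE_I2 tendsto_intros gaussian_average_tendsto[OF cont B])
    show "AE w in ?S. norm (cnj (f w) * T (real (Suc k)) w) \<le> B * (B * p)" for k
      unfolding norm_mult T_def p_def
      by (intro AE_I2 mult_mono norm_gaussian_average_le[OF cont B]) (auto simp: B B0)
  qed simp
  also have "(\<integral>w. cnj (f w) * (of_real p * f w) \<partial>?S) = (\<integral>w. complex_of_real (p * (norm (f w))\<^sup>2) \<partial>?S)"
    unfolding of_real_mult complex_norm_square by (simp only: mult_ac)
  also have "\<dots> = of_real (p * N)"
    by (simp add: integral_complex_of_real N_def del: of_real_mult of_real_power)
  finally have "(\<lambda>k. Z (real (Suc k))) \<longlonglongrightarrow> of_real (p * N)"
    by (simp add: Z_eq)
  then have "norm (complex_of_real (p * N)) \<le> sqrt (h * (p * C\<^sup>2 * N))"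
    by (rule Lim_bounded[OF tendsto_norm, where M=0]) (use Z_le in auto)
  then have "p * N \<le> sqrt (h * (p * C\<^sup>2 * N))"
    using p N by (simp add: norm_mult)
  then have "(p * N)\<^sup>2 \<le> h * (p * C\<^sup>2 * N)"
    using p N h by (metis mult_nonneg_nonneg real_sqrt_ge_0_iff real_sqrt_pow2 less_imp_le zero_le_power2 power_mono)
  then have "(p * N) * (p * N) \<le> (p * N) * (C\<^sup>2 * h)"
    by (simp add: power2_eq_square mult_ac)
  \<comment> \<open>N = 0 is treated apart, since otherwise p N is cancelled from both
    sides.\<close>
  then have "p * N \<le> C\<^sup>2 * h"
    using p N h by (cases "N = 0") (auto simp: mult_le_cancel_left)
  then have "N \<le> C\<^sup>2 * (1 / p * h)"
    using p by (simp add: field_simps)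
  then have "sqrt N \<le> sqrt (C\<^sup>2 * (1 / p * h))"
    by (rule real_sqrt_le_mono)
  also have "\<dots> = C * sqrt ((2 * pi) powr (- ?n) * h)"
    using C by (simp add: real_sqrt_mult p_def powr_minus divide_inverse)
  finally show ?thesis
    unfolding sphere_L2_norm_def hom_sobolev_norm_def N_def C_def h_def .
qed

section \<open>Fourier transforms of Schwartz functions\<close>

abbreviation fderiv :: "('a::euclidean_space \<Rightarrow> complex) \<Rightarrow> 'a \<Rightarrow> 'a \<Rightarrow> complex" where
  "fderiv f x \<equiv> frechet_derivative f (at x)"

lemma partials_append: "partials (bs @ cs) f = partials bs (partials cs f)"
  by (induction bs) simp_all

lemma schwartz_partials: "schwartz f \<Longrightarrow> set cs \<subseteq> Basis \<Longrightarrow> schwartz (partials cs f)"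
  unfolding schwartz_def partials_append[symmetric] by auto

lemma schwartz_differentiable: "schwartz f \<Longrightarrow> f differentiable (at x)"
  unfolding schwartz_def by (metis empty_set empty_subsetI partials.simps(1))

lemma schwartz_continuous_on: "schwartz f \<Longrightarrow> continuous_on A f"
  by (meson continuous_at_imp_continuous_on differentiable_imp_continuous_within schwartz_differentiable)

lemma schwartz_borel_measurable: "schwartz f \<Longrightarrow> f \<in> borel_measurable borel"
  by (intro borel_measurable_continuous_onI schwartz_continuous_on)

lemma schwartz_decay:
  assumes "schwartz f"
  obtains C where "C \<ge> 0" "\<And>x. norm x ^ k * norm (f x) \<le> C"
proof -
  have "bounded (range (\<lambda>x. norm x ^ k *\<^sub>R partials [] f x))"
    using assms unfolding schwartz_def by (metis empty_set empty_subsetI)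
  then obtain C where C: "\<And>x. norm (norm x ^ k *\<^sub>R f x) \<le> C"
    by (auto simp: bounded_iff)
  then have "norm x ^ k * norm (f x) \<le> C" for x by simp
  moreover have "C \<ge> 0" using C[of 0] norm_ge_zero order_trans by blast
  ultimately show thesis using that by blast
qed

lemma sum_power_le:
  fixes a b :: real
  assumes "a \<ge> 0" "b \<ge> 0"
  shows "(a + b) ^ k \<le> 2 ^ k * (a ^ k + b ^ k)"
proof -
  have "(a + b) ^ k \<le> (2 * max a b) ^ k" using assms by (intro power_mono) auto
  also have "\<dots> = 2 ^ k * max a b ^ k" by (simp add: power_mult_distrib)
  also have "max a b ^ k \<le> a ^ k + b ^ k" using assms by (auto simp: max_def)
  finally show ?thesis by simp
qed

lemma schwartz_decay':
  assumes "schwartz f"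
  obtains C where "C \<ge> 0" "\<And>x. norm (f x) \<le> C / (1 + (norm x)\<^sup>2) ^ m"
proof -
  obtain C0 where C0: "C0 \<ge> 0" "\<And>x. norm x ^ 0 * norm (f x) \<le> C0" using schwartz_decay[OF assms, where k=0] by blast
  obtain C1 where C1: "C1 \<ge> 0" "\<And>x. norm x ^ (2 * m) * norm (f x) \<le> C1" using schwartz_decay[OF assms, where k="2 * m"] by blast
  have "norm (f x) \<le> 2 ^ m * (C0 + C1) / (1 + (norm x)\<^sup>2) ^ m" for x
  proof -
    have "(1 + (norm x)\<^sup>2) ^ m * norm (f x) \<le> 2 ^ m * (1 ^ m + ((norm x)\<^sup>2) ^ m) * norm (f x)"
      by (intro mult_right_mono sum_power_le) auto
    also have "\<dots> \<le> 2 ^ m * (C0 + C1)"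
      using C0(2)[of x] C1(2)[of x] by (simp add: power_mult[symmetric] distrib_right mult.assoc)
    finally show ?thesis
      by (subst pos_le_divide_eq) (auto simp: mult.commute intro!: zero_less_power add_pos_nonneg)
  qed
  then show thesis using that[of "2 ^ m * (C0 + C1)"] C0(1) C1(1) by auto
qed

text \<open>Each coordinate is bounded by the norm, so the n-th power is dominated by a product of
  one-dimensional functions 1 / (1 + t^2), one for each coordinate.\<close>

lemma integrable_inverse_power:
  "integrable lborel (\<lambda>x::'a::euclidean_space. 1 / (1 + (norm x)\<^sup>2) ^ DIM('a))"
proof (rule integrableI_nonneg)
  have 1: "integrable lborel (\<lambda>x::real. inverse (1 + x\<^sup>2))"
    using integrable_inverse_1_plus_square by (simp add: set_integrable_def)
  have "(\<integral>\<^sup>+x. ennreal (1 / (1 + (norm x)\<^sup>2) ^ DIM('a)) \<partial>(lborel :: 'a measure)) \<le>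
    (\<integral>\<^sup>+x. (\<Prod>b\<in>Basis. ennreal (inverse (1 + (x \<bullet> b)\<^sup>2))) \<partial>(lborel :: 'a measure))" (is "integral\<^sup>N _ ?l \<le> integral\<^sup>N _ ?r")
  proof (rule nn_integral_mono)
    fix x :: 'a
    have "(\<Prod>b\<in>(Basis :: 'a set). inverse (1 + (norm x)\<^sup>2)) \<le> (\<Prod>b\<in>Basis. inverse (1 + (x \<bullet> b)\<^sup>2))"
    proof (intro prod_mono conjI le_imp_inverse_le add_left_mono)
      fix b :: 'a assume "b \<in> Basis"
      then show "(x \<bullet> b)\<^sup>2 \<le> (norm x)\<^sup>2" using Basis_le_norm[of b x] by (simp add: abs_le_square_iff[symmetric])
    qed (auto intro: add_pos_nonneg)
    then show "?l x \<le> ?r x"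
      by (simp add: prod_ennreal ennreal_leI power_inverse[symmetric] inverse_eq_divide power_one_over)
  qed
  also have "\<dots> = (\<Prod>b\<in>(Basis :: 'a set). \<integral>\<^sup>+x. ennreal (inverse (1 + x\<^sup>2)) \<partial>lborel)"
    by (rule nn_integral_lborel_prod) auto
  also have "\<dots> < \<infinity>"
    using 1 by (simp add: nn_integral_eq_integral ennreal_power integral_nonneg_AE)
  finally show "(\<integral>\<^sup>+x. ennreal (1 / (1 + (norm x)\<^sup>2) ^ DIM('a)) \<partial>(lborel :: 'a measure)) < \<infinity>" .
qed auto

lemma integrable_decay:
  fixes f :: "'a::euclidean_space \<Rightarrow> 'b::{banach, second_countable_topology}"
  assumes "f \<in> borel_measurable borel" and C: "\<And>x. norm (f x) \<le> C / (1 + (norm x)\<^sup>2) ^ DIM('a)"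
  shows "integrable lborel f"
proof (rule Bochner_Integration.integrable_bound)
  show "integrable lborel (\<lambda>x::'a. C * (1 / (1 + (norm x)\<^sup>2) ^ DIM('a)))"
    by (intro integrable_mult_right integrable_inverse_power)
  show "AE x in lborel. norm (f x) \<le> norm (C * (1 / (1 + (norm x)\<^sup>2) ^ DIM('a)))"
    by (intro AE_I2 order_trans[OF C]) (auto intro!: divide_right_mono)
qed (use assms in simp)

lemma schwartz_integrable: "schwartz f \<Longrightarrow> integrable lborel f"
  by (meson integrable_decay schwartz_borel_measurable schwartz_decay')

text \<open>The derivative bound is required on the segment only, so D may depend on x. A global
  Lipschitz constant would not give the integrable majorant that \<open>fourier_partial\<close>
  needs.\<close>

lemma norm_add_scaled_diff_le:
  fixes f :: "'a::euclidean_space \<Rightarrow> complex"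
  assumes f: "\<And>x. f differentiable (at x)"
    and D: "\<And>t. 0 \<le> t \<Longrightarrow> t \<le> h \<Longrightarrow> norm (fderiv f ((x + t *\<^sub>R b)) b) \<le> D" and h: "0 \<le> h"
  shows "norm (f (x + h *\<^sub>R b) - f x) \<le> D * h"
proof -
  have "norm (f (x + h *\<^sub>R b) - f (x + 0 *\<^sub>R b)) \<le> D * norm (h - 0)"
  proof (rule differentiable_bound[where S="{0..h}" and f="\<lambda>t. f (x + t *\<^sub>R b)"
       and f'="\<lambda>t s. fderiv f ((x + t *\<^sub>R b)) (s *\<^sub>R b)"])
    fix t assume t: "t \<in> {0..h}"
    have "((\<lambda>t. f (x + t *\<^sub>R b)) has_derivative (\<lambda>s. fderiv f ((x + t *\<^sub>R b)) (s *\<^sub>R b))) (at t)"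
      by (rule has_derivative_compose[OF _ f[unfolded frechet_derivative_works], of "\<lambda>t. x + t *\<^sub>R b"])
        (auto intro!: derivative_eq_intros)
    then show "((\<lambda>t. f (x + t *\<^sub>R b)) has_derivative (\<lambda>s. fderiv f ((x + t *\<^sub>R b)) (s *\<^sub>R b))) (at t within {0..h})"
      by (rule has_derivative_at_withinI)
    have "linear (fderiv f ((x + t *\<^sub>R b)))" using f linear_frechet_derivative by blast
    then have "norm (fderiv f ((x + t *\<^sub>R b)) (s *\<^sub>R b)) \<le> D * norm s" for s
      using mult_left_mono[OF D[of t], of "\<bar>s\<bar>"] t by (simp add: linear_cmul mult.commute)
    then show "onorm (\<lambda>s. fderiv f ((x + t *\<^sub>R b)) (s *\<^sub>R b)) \<le> D" by (rule onorm_le)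
  qed (use h in auto)
  then show ?thesis using h by simp
qed

text \<open>Difference quotients replace integration by parts: translating f by t b multiplies its
  transform by exp(i t b \<bullet> \<xi>), and dominated convergence lets the step tend to 0 on both
  sides.\<close>

lemma fourier_partial:
  fixes f :: "'a::euclidean_space \<Rightarrow> complex"
  assumes f: "schwartz f" and b: "b \<in> Basis"
  shows "fourier (partials [b] f) \<xi> = \<i> * of_real (b \<bullet> \<xi>) * fourier f \<xi>"
proof -
  let ?n = "DIM('a)"
  define Df where "Df = partials [b] f"
  have Df: "schwartz Df" unfolding Df_def using b by (intro schwartz_partials f) auto
  have Df_eq: "Df x = fderiv f x b" for x by (simp add: Df_def)
  note [measurable] = schwartz_borel_measurable[OF f] schwartz_borel_measurable[OF Df]
  obtain C where C: "C \<ge> 0" "\<And>x. norm (Df x) \<le> C / (1 + (norm x)\<^sup>2) ^ ?n"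
    using schwartz_decay'[OF Df] by blast
  define E where "E x = wave x \<xi>" for x :: 'a
  have [measurable]: "E \<in> borel_measurable borel" unfolding E_def[abs_def] by measurable
  have E1: "norm (E x) = 1" for x by (simp add: E_def)
  define h where "h k = 1 / real (Suc k)" for k
  have h: "h k > 0" "h k \<le> 1" for k by (auto simp: h_def)
  have h0: "h \<longlonglongrightarrow> 0" unfolding h_def[abs_def] by real_asymp
  have iE: "integrable lborel (\<lambda>x. E x * f x)"
    by (rule Bochner_Integration.integrable_bound[OF schwartz_integrable[OF f]]) (auto simp: norm_mult E1)
  have shift: "integrable lborel (\<lambda>x. E x * f (x + t *\<^sub>R b)) \<and>
     (\<integral>x. E x * f (x + t *\<^sub>R b) \<partial>lborel) = exp (\<i> * of_real (t * (b \<bullet> \<xi>))) * fourier f \<xi>" for t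
  proof -
    have eq: "E x * f (x + t *\<^sub>R b) = exp (\<i> * of_real (t * (b \<bullet> \<xi>))) * (E (t *\<^sub>R b + x) * f (t *\<^sub>R b + x))" for x
    proof -
      have "E x = exp (\<i> * of_real (t * (b \<bullet> \<xi>))) * E (t *\<^sub>R b + x)"
        unfolding E_def exp_add[symmetric] by (simp add: inner_add_left algebra_simps)
      then show ?thesis by (simp add: add.commute)
    qed
    have i: "integrable (distr lborel borel ((+) (t *\<^sub>R b))) (\<lambda>x. E x * f x)"
      using iE by (simp add: lborel_distr_plus)
    have "(\<integral>x. E x * f x \<partial>lborel) = (\<integral>x. E x * f x \<partial>distr lborel borel ((+) (t *\<^sub>R b)))"
      by (simp add: lborel_distr_plus)
    then show ?thesis using i unfolding eq
      by (simp add: integrable_distr_eq integral_distr fourier_def E_def)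
  qed
  let ?e = "\<lambda>k. (exp (\<i> * of_real (b \<bullet> \<xi>) * of_real (h k)) - 1) / of_real (h k)"
  \<comment> \<open>The factor 3^n compares decay at x with decay at a point y of the segment: steps
    are at most 1, so |x| <= |y| + 1 and 1 + |x|^2 <= 3 (1 + |y|^2).\<close>
  let ?C = "\<lambda>(x :: 'a). C * 3 ^ ?n * (1 / (1 + (norm x)\<^sup>2) ^ ?n)"
  let ?r = "\<lambda>k x. norm (f (x + h k *\<^sub>R b) - f x - fderiv f x (h k *\<^sub>R b))"
  let ?q = "\<lambda>k x. (1 / h k) *\<^sub>R (E x * f (x + h k *\<^sub>R b) - E x * f x)"
  have "(\<lambda>k. \<integral>x. ?q k x \<partial>lborel) \<longlonglongrightarrow> (\<integral>x. E x * Df x \<partial>lborel)"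
  proof (rule integral_dominated_convergence[where w="\<lambda>x. ?C x"])
    show "integrable lborel (\<lambda>x::'a. ?C x)"
      by (intro integrable_mult_right integrable_inverse_power)
    show "AE x in lborel. (\<lambda>k. ?q k x) \<longlonglongrightarrow> E x * Df x"
    proof (rule AE_I2)
      fix x
      have "(f has_derivative fderiv f x) (at x)"
        using schwartz_differentiable[OF f] frechet_derivative_works by blast
      then have lin: "bounded_linear (fderiv f x)" and
        lim: "(\<lambda>v. norm (f (x + v) - f x - fderiv f x v) / norm v) \<midarrow>0\<rightarrow> 0"
        by (auto simp: has_derivative_at)
      have "(\<lambda>k. h k *\<^sub>R b) \<longlonglongrightarrow> 0 *\<^sub>R b" by (intro tendsto_intros h0)
      then have "filterlim (\<lambda>k. h k *\<^sub>R b) (at 0) sequentially"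
        using h(1) b by (auto simp: filterlim_at less_le nonzero_Basis)
      from filterlim_compose[OF lim this]
      have "(\<lambda>k. ?r k x / norm (h k *\<^sub>R b)) \<longlonglongrightarrow> 0" .
      also have "(\<lambda>k. ?r k x / norm (h k *\<^sub>R b)) = (\<lambda>k. norm ((1 / h k) *\<^sub>R (f (x + h k *\<^sub>R b) - f x) - Df x))"
      proof
        fix k
        have "fderiv f x (h k *\<^sub>R b) = h k *\<^sub>R Df x" using lin by (simp add: linear_simps Df_eq)
        then have "(1 / h k) *\<^sub>R (f (x + h k *\<^sub>R b) - f x) - Df x = (1 / h k) *\<^sub>R (f (x + h k *\<^sub>R b) - f x - fderiv f x (h k *\<^sub>R b))"
          using h(1)[of k] by (simp add: scaleR_diff_right)
        then show "?r k x / norm (h k *\<^sub>R b) = norm ((1 / h k) *\<^sub>R (f (x + h k *\<^sub>R b) - f x) - Df x)"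
          using h(1)[of k] b by simp
      qed
      finally have "(\<lambda>k. (1 / h k) *\<^sub>R (f (x + h k *\<^sub>R b) - f x)) \<longlonglongrightarrow> Df x"
        by (intro LIM_zero_cancel[where l="Df x"]) (simp only: tendsto_norm_zero_iff)
      then have "(\<lambda>k. E x * ((1 / h k) *\<^sub>R (f (x + h k *\<^sub>R b) - f x))) \<longlonglongrightarrow> E x * Df x"
        by (intro tendsto_intros)
      then show "(\<lambda>k. ?q k x) \<longlonglongrightarrow> E x * Df x" by (simp add: right_diff_distrib)
    qed
    show "AE x in lborel. norm (?q k x) \<le> ?C x" for k
    proof (rule AE_I2)
      fix x
      have "norm (fderiv f ((x + t *\<^sub>R b)) b) \<le> ?C x"
        if t: "0 \<le> t" "t \<le> h k" for t
      proof -
        define y where "y = x + t *\<^sub>R b"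
        have "norm x \<le> norm y + norm (t *\<^sub>R b)" unfolding y_def by (metis add_diff_cancel norm_triangle_ineq4)
        also have "norm (t *\<^sub>R b) \<le> 1" using t h(2)[of k] b by simp
        finally have "(norm x)\<^sup>2 \<le> (norm y + 1)\<^sup>2" by (intro power_mono) auto
        also have "\<dots> \<le> 2 * (norm y)\<^sup>2 + 2"
          using sum_squares_bound[of "norm y" 1] by (simp add: power2_sum)
        finally have le2: "(norm x)\<^sup>2 \<le> 2 * (norm y)\<^sup>2 + 2" .
        have "1 + X \<le> 3 * (1 + Y)" if "X \<le> 2 * Y + 2" "0 \<le> Y" for X Y :: real using that by simp
        from this[OF le2] have "1 + (norm x)\<^sup>2 \<le> 3 * (1 + (norm y)\<^sup>2)" by simp
        then have "(1 + (norm x)\<^sup>2) ^ ?n \<le> (3 * (1 + (norm y)\<^sup>2)) ^ ?n" by (intro power_mono) auto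
        then have le: "(1 + (norm x)\<^sup>2) ^ ?n \<le> 3 ^ ?n * (1 + (norm y)\<^sup>2) ^ ?n" by (simp only: power_mult_distrib)
        have pos: "(1 + (norm x)\<^sup>2) ^ ?n > 0" "(1 + (norm y)\<^sup>2) ^ ?n > 0" by (auto intro!: zero_less_power add_pos_nonneg)
        have "norm (Df y) \<le> C / (1 + (norm y)\<^sup>2) ^ ?n" by (rule C)
        also have "\<dots> \<le> ?C x"
          using mult_left_mono[OF le C(1)] pos by (simp add: divide_simps mult_ac)
        finally show ?thesis by (simp add: Df_eq y_def)
      qed
      from norm_add_scaled_diff_le[OF schwartz_differentiable[OF f] this less_imp_le[OF h(1)]]
      have "norm (f (x + h k *\<^sub>R b) - f x) \<le> ?C x * h k" .
      moreover have "norm (?q k x) = norm (f (x + h k *\<^sub>R b) - f x) / h k"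
        using h(1)[of k] by (simp add: E1 norm_mult flip: right_diff_distrib)
      ultimately show "norm (?q k x) \<le> ?C x" using h(1)[of k] by (simp only: pos_divide_le_eq)
    qed
  qed measurable
  also have "(\<lambda>k. \<integral>x. ?q k x \<partial>lborel) = (\<lambda>k. ?e k * fourier f \<xi>)"
  proof
    fix k
    have "(\<integral>x. ?q k x \<partial>lborel) = (1 / h k) *\<^sub>R (exp (\<i> * of_real (h k * (b \<bullet> \<xi>))) * fourier f \<xi> - fourier f \<xi>)"
      using shift[of "h k"] iE by (simp add: fourier_def E_def)
    then show "(\<integral>x. ?q k x \<partial>lborel) = ?e k * fourier f \<xi>"
      by (simp add: scaleR_conv_of_real algebra_simps diff_divide_distrib)
  qed
  finally have lim1: "(\<lambda>k. ?e k * fourier f \<xi>) \<longlonglongrightarrow> (\<integral>x. E x * Df x \<partial>lborel)" .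
  have "((\<lambda>z. exp (\<i> * of_real (b \<bullet> \<xi>) * z)) has_field_derivative \<i> * of_real (b \<bullet> \<xi>)) (at 0)"
    by (auto intro!: derivative_eq_intros)
  then have "(\<lambda>z. (exp (\<i> * of_real (b \<bullet> \<xi>) * z) - 1) / z) \<midarrow>0\<rightarrow> \<i> * of_real (b \<bullet> \<xi>)"
    by (simp add: has_field_derivative_iff)
  moreover have "filterlim (\<lambda>k. complex_of_real (h k)) (at 0) sequentially"
    using tendsto_of_real[OF h0, where 'a=complex] h(1) by (auto simp: filterlim_at less_le)
  ultimately have "(\<lambda>k. ?e k) \<longlonglongrightarrow> \<i> * of_real (b \<bullet> \<xi>)"
    by (rule filterlim_compose)
  then have "(\<lambda>k. ?e k * fourier f \<xi>) \<longlonglongrightarrow> \<i> * of_real (b \<bullet> \<xi>) * fourier f \<xi>"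
    by (intro tendsto_intros)
  with lim1 have "(\<integral>x. E x * Df x \<partial>lborel) = \<i> * of_real (b \<bullet> \<xi>) * fourier f \<xi>"
    by (rule LIMSEQ_unique)
  then show ?thesis by (simp add: fourier_def E_def Df_def)
qed

lemma fourier_partials_replicate:
  assumes "schwartz f" "b \<in> Basis"
  shows "fourier (partials (replicate k b) f) \<xi> = (\<i> * of_real (b \<bullet> \<xi>)) ^ k * fourier f \<xi>"
proof (induction k)
  case (Suc k)
  have "fourier (partials [b] (partials (replicate k b) f)) \<xi> = \<i> * of_real (b \<bullet> \<xi>) * fourier (partials (replicate k b) f) \<xi>"
    using assms by (intro fourier_partial schwartz_partials) auto
  then show ?case using Suc by (simp add: mult_ac)
qed simp

lemma sum_power_le_card:
  fixes t :: "'b \<Rightarrow> real"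
  assumes A: "finite A" "A \<noteq> {}" and t: "\<And>b. b \<in> A \<Longrightarrow> t b \<ge> 0"
  shows "(\<Sum>b\<in>A. t b) ^ m \<le> real (card A) ^ m * (\<Sum>b\<in>A. t b ^ m)"
proof -
  have "Max (t ` A) \<in> t ` A" using A by (intro Max_in) auto
  then obtain c where cA: "c \<in> A" and tc: "Max (t ` A) = t c" by (rule imageE)
  have c: "t b \<le> t c" if "b \<in> A" for b unfolding tc[symmetric] using that A by (intro Max_ge) auto
  have "(\<Sum>b\<in>A. t b) \<le> real (card A) * t c" using c by (rule sum_bounded_above)
  then have "(\<Sum>b\<in>A. t b) ^ m \<le> (real (card A) * t c) ^ m" using t by (intro power_mono sum_nonneg) auto
  also have "\<dots> = real (card A) ^ m * t c ^ m" by (simp add: power_mult_distrib)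
  also have "t c ^ m \<le> (\<Sum>b\<in>A. t b ^ m)" using A cA t by (intro member_le_sum) auto
  finally show ?thesis by (simp add: mult_left_mono)
qed

text \<open>Repeated derivatives in a single direction suffice: the m-th power of |xi|^2 is bounded
  by a multiple of the sum of the (2m)-th powers of the coordinates, and each of these is produced
  by 2m derivatives along one basis vector.\<close>

lemma schwartz_fourier_decay:
  fixes f :: "'a::euclidean_space \<Rightarrow> complex"
  assumes f: "schwartz f"
  obtains C where "C \<ge> 0" "\<And>\<xi>. norm (fourier f \<xi>) \<le> C / (1 + (norm \<xi>)\<^sup>2) ^ m"
proof -
  define D where "D b = (\<integral>x. norm (partials (replicate (2 * m) b) f x) \<partial>lborel)" for b
  define D0 where "D0 = (\<integral>x. norm (f x) \<partial>lborel)"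
  define C where "C = 2 ^ m * (D0 + real DIM('a) ^ m * (\<Sum>b\<in>(Basis :: 'a set). D b))"
  have D: "D b \<ge> 0" for b by (simp add: D_def)
  have D0: "D0 \<ge> 0" by (simp add: D0_def)
  have "norm (fourier f \<xi>) \<le> C / (1 + (norm \<xi>)\<^sup>2) ^ m" for \<xi>
  proof -
    have b: "((\<xi> \<bullet> b)\<^sup>2) ^ m * norm (fourier f \<xi>) \<le> D b" if "b \<in> Basis" for b
    proof -
      have "norm (fourier (partials (replicate (2 * m) b) f) \<xi>) \<le> D b" unfolding D_def by (rule norm_fourier_le)
      then show ?thesis unfolding fourier_partials_replicate[OF f that]
        by (simp add: norm_mult norm_power inner_commute power_mult)
    qed
    have "(1 + (norm \<xi>)\<^sup>2) ^ m * norm (fourier f \<xi>) \<le> 2 ^ m * (1 ^ m + ((norm \<xi>)\<^sup>2) ^ m) * norm (fourier f \<xi>)"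
      by (intro mult_right_mono sum_power_le) auto
    also have "\<dots> = 2 ^ m * (norm (fourier f \<xi>) + ((norm \<xi>)\<^sup>2) ^ m * norm (fourier f \<xi>))"
      by (simp add: algebra_simps)
    also have "\<dots> \<le> C" unfolding C_def
    proof (intro mult_left_mono add_mono)
      show "norm (fourier f \<xi>) \<le> D0" unfolding D0_def by (rule norm_fourier_le)
      have "((norm \<xi>)\<^sup>2) ^ m * norm (fourier f \<xi>) \<le> real DIM('a) ^ m * (\<Sum>b\<in>Basis. ((\<xi> \<bullet> b)\<^sup>2) ^ m) * norm (fourier f \<xi>)"
        unfolding power2_norm_sum_Basis by (intro mult_right_mono sum_power_le_card) auto
      also have "\<dots> = real DIM('a) ^ m * (\<Sum>b\<in>Basis. ((\<xi> \<bullet> b)\<^sup>2) ^ m * norm (fourier f \<xi>))"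
        by (simp add: sum_distrib_right)
      also have "\<dots> \<le> real DIM('a) ^ m * (\<Sum>b\<in>(Basis :: 'a set). D b)"
        by (intro mult_left_mono sum_mono b) auto
      finally show "((norm \<xi>)\<^sup>2) ^ m * norm (fourier f \<xi>) \<le> real DIM('a) ^ m * (\<Sum>b\<in>(Basis :: 'a set). D b)" .
    qed simp
    finally show ?thesis
      by (subst pos_le_divide_eq) (auto simp: mult.commute intro!: zero_less_power add_pos_nonneg)
  qed
  moreover have "C \<ge> 0" unfolding C_def using D D0 by (intro mult_nonneg_nonneg add_nonneg_nonneg sum_nonneg) auto
  ultimately show thesis using that by blast
qed

text \<open>With q = 1 + |xi|^2 the weight is at most q^n because s < n, while the squared transform
  is at most C^2 / q^(2n). What remains is C^2 / q^n, which is integrable.\<close>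

lemma schwartz_sobolev_integrable:
  fixes f :: "'a::euclidean_space \<Rightarrow> complex"
  assumes f: "schwartz f" and s: "0 < s" "s < real DIM('a)"
  shows "integrable lborel (\<lambda>\<xi>. norm \<xi> powr (2 * s) * (norm (fourier f \<xi>))\<^sup>2)"
proof -
  obtain C where C: "C \<ge> 0" "\<And>\<xi>. norm (fourier f \<xi>) \<le> C / (1 + (norm \<xi>)\<^sup>2) ^ DIM('a)"
    using schwartz_fourier_decay[OF f, where m="DIM('a)"] by blast
  note [measurable] = borel_measurable_fourier[OF schwartz_borel_measurable[OF f]]
  show ?thesis
  proof (rule integrable_decay[where C="C\<^sup>2"])
    fix \<xi> :: 'a
    define q where "q = 1 + (norm \<xi>)\<^sup>2"
    have q: "q \<ge> 1" by (simp add: q_def)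
    have "norm \<xi> powr (2 * s) = ((norm \<xi>)\<^sup>2) powr s" using powr_powr[of "norm \<xi>" 2 s] by simp
    also have "\<dots> \<le> q powr s" using s by (intro powr_mono2) (auto simp: q_def)
    also have "\<dots> \<le> q powr real DIM('a)" using s q by (intro powr_mono) auto
    also have "\<dots> = q ^ DIM('a)" using q by (simp add: powr_realpow)
    finally have 1: "norm \<xi> powr (2 * s) \<le> q ^ DIM('a)" .
    have "(norm (fourier f \<xi>))\<^sup>2 \<le> (C / q ^ DIM('a))\<^sup>2" unfolding q_def by (intro power_mono C) auto
    with 1 have "norm \<xi> powr (2 * s) * (norm (fourier f \<xi>))\<^sup>2 \<le> q ^ DIM('a) * (C / q ^ DIM('a))\<^sup>2"
      by (intro mult_mono) (use q in auto)
    also have "\<dots> = C\<^sup>2 / q ^ DIM('a)" using q by (simp add: power2_eq_square)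
    finally show "norm (norm \<xi> powr (2 * s) * (norm (fourier f \<xi>))\<^sup>2) \<le> C\<^sup>2 / (1 + (norm \<xi>)\<^sup>2) ^ DIM('a)"
      by (simp add: q_def)
  qed measurable
qed

section \<open>Superpositions of Gaussians\<close>

lemma real_polynomial_function_has_derivative:
  "real_polynomial_function p \<Longrightarrow> (p has_derivative frechet_derivative p (at x)) (at x)"
  using differentiable_at_real_polynomial_function frechet_derivative_works by blast

lemma real_polynomial_function_frechet_derivative:
  fixes p :: "'a::euclidean_space \<Rightarrow> real"
  assumes "real_polynomial_function p"
  shows "real_polynomial_function (\<lambda>x. frechet_derivative p (at x) b)"
  using assms
proof (induction p rule: real_polynomial_function.induct)
  case (linear f)
  have "frechet_derivative f (at x) = f" for x
    by (rule frechet_derivative_at[symmetric]) (rule bounded_linear_imp_has_derivative[OF linear])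
  then show ?case by (simp add: real_polynomial_function.intros(2))
next
  case (const c)
  then show ?case by (simp add: real_polynomial_function.intros(2))
next
  case (add f g)
  note d = add.hyps[THEN real_polynomial_function_has_derivative]
  show ?case unfolding frechet_derivative_at[OF has_derivative_add[OF d], symmetric]
    by (intro real_polynomial_function.intros(3) add.IH)
next
  case (mult f g)
  note d = mult.hyps[THEN real_polynomial_function_has_derivative]
  show ?case unfolding frechet_derivative_at[OF has_derivative_mult[OF d], symmetric]
    by (intro real_polynomial_function.intros(3,4) mult.IH mult.hyps)
qed

lemma real_polynomial_function_growth:
  fixes p :: "'a::euclidean_space \<Rightarrow> real"
  assumes "real_polynomial_function p"
  obtains C m where "C \<ge> 0" "\<And>x. \<bar>p x\<bar> \<le> C * (1 + norm x) ^ m"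
proof -
  have "\<exists>C m. C \<ge> 0 \<and> (\<forall>x. \<bar>p x\<bar> \<le> C * (1 + norm x) ^ m)"
    using assms
  proof (induction p rule: real_polynomial_function.induct)
    case (linear f)
    obtain K where K: "K > 0" "\<And>x. norm (f x) \<le> norm x * K" using linear bounded_linear.pos_bounded by blast
    have "\<bar>f x\<bar> \<le> K * (1 + norm x) ^ 1" for x
    proof -
      have "norm x * K \<le> K * (1 + norm x)" using K(1) by (simp add: algebra_simps)
      then show ?thesis using K(2)[of x] by simp
    qed
    then show ?case using K(1) by (intro exI[of _ K] exI[of _ 1]) auto
  next
    case (const c)
    show ?case by (intro exI[of _ "\<bar>c\<bar>"] exI[of _ 0]) auto
  next
    case (add f g)
    then obtain C m D k where 1: "C \<ge> 0" "\<And>x. \<bar>f x\<bar> \<le> C * (1 + norm x) ^ m"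
      and 2: "D \<ge> 0" "\<And>x. \<bar>g x\<bar> \<le> D * (1 + norm x) ^ k" by blast
    have "\<bar>f x + g x\<bar> \<le> (C + D) * (1 + norm x) ^ (m + k)" for x
    proof -
      have "\<bar>f x + g x\<bar> \<le> C * (1 + norm x) ^ m + D * (1 + norm x) ^ k"
        using 1(2)[of x] 2(2)[of x] by linarith
      also have "\<dots> \<le> C * (1 + norm x) ^ (m + k) + D * (1 + norm x) ^ (m + k)"
        by (intro add_mono mult_left_mono power_increasing 1 2) auto
      finally show ?thesis by (simp add: algebra_simps)
    qed
    then show ?case using 1(1) 2(1) by (intro exI[of _ "C + D"] exI[of _ "m + k"]) auto
  next
    case (mult f g)
    then obtain C m D k where 1: "C \<ge> 0" "\<And>x. \<bar>f x\<bar> \<le> C * (1 + norm x) ^ m"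
      and 2: "D \<ge> 0" "\<And>x. \<bar>g x\<bar> \<le> D * (1 + norm x) ^ k" by blast
    have "\<bar>f x * g x\<bar> \<le> (C * D) * (1 + norm x) ^ (m + k)" for x
      using mult_mono[OF 1(2)[of x] 2(2)[of x]] 1(1) by (simp add: abs_mult power_add mult_ac)
    then show ?case using 1(1) 2(1) by (intro exI[of _ "C * D"] exI[of _ "m + k"]) auto
  qed
  then show thesis using that by blast
qed

text \<open>A single term of the exponential series gives (1 + r)^k <= k! exp(1 + r), and 1 + r -
  r^2/2 = 3/2 - (r - 1)^2/2.\<close>

lemma power_times_gaussian_le:
  fixes r :: real
  assumes "r \<ge> 0"
  shows "(1 + r) ^ k * exp (- (r\<^sup>2 / 2)) \<le> fact k * exp (3 / 2)"
proof -
  have "(1 + r) ^ k / fact k \<le> exp (1 + r)"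
  proof -
    have "(1 + r) ^ k / fact k = (\<Sum>i\<in>{k}. (1 + r) ^ i /\<^sub>R fact i)" by (simp add: divide_inverse_commute)
    also have "\<dots> \<le> exp (1 + r)"
      unfolding exp_def using assms by (intro sum_le_suminf summable_exp_generic) auto
    finally show ?thesis .
  qed
  then have "(1 + r) ^ k \<le> fact k * exp (1 + r)" by (simp add: field_simps)
  then have "(1 + r) ^ k * exp (- (r\<^sup>2 / 2)) \<le> fact k * exp (1 + r) * exp (- (r\<^sup>2 / 2))"
    by (intro mult_right_mono) auto
  also have "\<dots> = fact k * exp (1 + r - r\<^sup>2 / 2)" by (simp add: mult.assoc flip: exp_add)
  also have "\<dots> \<le> fact k * exp (3 / 2)"
  proof -
    have "0 \<le> (r - 1)\<^sup>2" by simp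
    then have "1 + r - r\<^sup>2 / 2 \<le> 3 / 2" unfolding power2_diff by simp
    then show ?thesis by simp
  qed
  finally show ?thesis .
qed

text \<open>By induction every iterated derivative is a polynomial times the Gaussian:
  differentiating along b replaces p by its derivative along b minus p times x \<bullet> b.
  Polynomial growth is then beaten by \<open>power_times_gaussian_le\<close>.\<close>

lemma schwartz_gaussian: "schwartz (\<lambda>x::'a::euclidean_space. complex_of_real (exp (- ((norm x)\<^sup>2 / 2))))"
proof -
  let ?G = "\<lambda>x::'a. complex_of_real (exp (- ((norm x)\<^sup>2 / 2)))"
  let ?g = "\<lambda>(x :: 'a). exp (- ((norm x)\<^sup>2 / 2))"
  have der: "((\<lambda>x. complex_of_real (p x * ?g x)) has_derivative (\<lambda>v. of_real ((D v - p x * (x \<bullet> v)) * ?g x))) (at x)"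
    if "(p has_derivative D) (at x)" for p D and x :: 'a unfolding power2_norm_eq_inner using that
    by (auto intro!: derivative_eq_intros simp: inner_commute algebra_simps)
  have ex: "\<exists>p. real_polynomial_function p \<and> partials bs ?G = (\<lambda>x. complex_of_real (p x * ?g x))"
    if "set bs \<subseteq> Basis" for bs :: "'a list" using that
  proof (induction bs)
    case Nil
    show ?case by (intro exI[of _ "\<lambda>_. 1"]) (auto intro: real_polynomial_function.intros(2))
  next
    case (Cons b bs)
    then obtain p where p: "real_polynomial_function p" "partials bs ?G = (\<lambda>x. complex_of_real (p x * ?g x))"
      by auto
    let ?q = "\<lambda>x. frechet_derivative p (at x) b - p x * (x \<bullet> b)"
    have "partials (b # bs) ?G = (\<lambda>x. complex_of_real (?q x * ?g x))"
      unfolding partials.simps p(2) frechet_derivative_at[OF der[OF real_polynomial_function_has_derivative[OF p(1)]], symmetric] ..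
    moreover have "real_polynomial_function ?q"
      using p(1) by (intro real_polynomial_function_diff real_polynomial_function.intros(4)
          real_polynomial_function_frechet_derivative real_polynomial_function.intros(1)[OF bounded_linear_inner_left])
    ultimately show ?case by blast
  qed
  show ?thesis unfolding schwartz_def
  proof (intro allI impI conjI)
    fix bs :: "'a list" and x :: 'a assume "set bs \<subseteq> Basis"
    from ex[OF this] obtain p where p: "real_polynomial_function p" "partials bs ?G = (\<lambda>x. complex_of_real (p x * ?g x))"
      by blast
    from der[OF real_polynomial_function_has_derivative[OF p(1)]] show "partials bs ?G differentiable (at x)"
      unfolding p(2) differentiable_def by blast
  next
    fix bs :: "'a list" and k :: nat assume "set bs \<subseteq> Basis"
    from ex[OF this] obtain p where p: "real_polynomial_function p" "partials bs ?G = (\<lambda>x. complex_of_real (p x * ?g x))"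
      by blast
    obtain C m where C: "C \<ge> 0" "\<And>x. \<bar>p x\<bar> \<le> C * (1 + norm x) ^ m" using real_polynomial_function_growth[OF p(1)] by metis
    have "norm (norm x ^ k *\<^sub>R partials bs ?G x) \<le> C * (fact (k + m) * exp (3 / 2))" for x
    proof -
      have "norm (norm x ^ k *\<^sub>R partials bs ?G x) = norm x ^ k * \<bar>p x\<bar> * ?g x"
        unfolding p(2) by (simp add: norm_mult)
      also have "\<dots> \<le> (1 + norm x) ^ k * (C * (1 + norm x) ^ m) * ?g x"
        by (intro mult_right_mono mult_mono power_mono C) (use C(1) in auto)
      also have "\<dots> = C * ((1 + norm x) ^ (k + m) * ?g x)" by (simp add: power_add)
      also have "\<dots> \<le> C * (fact (k + m) * exp (3 / 2))"
        by (intro mult_left_mono power_times_gaussian_le C(1)) auto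
      finally show ?thesis .
    qed
    then show "bounded (range (\<lambda>x. norm x ^ k *\<^sub>R partials bs ?G x))" unfolding bounded_iff by blast
  qed
qed

section \<open>Differentiation under the integral sign\<close>

lemma frechet_derivative_Basis_sum:
  fixes f :: "'a::euclidean_space \<Rightarrow> complex"
  assumes "schwartz f"
  shows "fderiv f x v = (\<Sum>b\<in>Basis. (v \<bullet> b) *\<^sub>R partials [b] f x)"
proof -
  have lin: "linear (fderiv f x)"
    using schwartz_differentiable[OF assms] by (rule linear_frechet_derivative)
  have "fderiv f x v = fderiv f x (\<Sum>b\<in>Basis. (v \<bullet> b) *\<^sub>R b)"
    by (simp add: euclidean_representation)
  also have "\<dots> = (\<Sum>b\<in>Basis. (v \<bullet> b) *\<^sub>R partials [b] f x)"
    using lin by (simp add: linear_sum linear_cmul)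
  finally show ?thesis .
qed

lemma schwartz_frechet_derivative_bound:
  fixes f :: "'a::euclidean_space \<Rightarrow> complex"
  assumes f: "schwartz f"
  obtains L where "L \<ge> 0" "\<And>x v. norm (fderiv f x v) \<le> L * norm v"
    "\<And>x y. norm (f x - f y) \<le> L * norm (x - y)"
proof -
  have "\<forall>b\<in>Basis. \<exists>C. C \<ge> 0 \<and> (\<forall>x. norm (fderiv f x b) \<le> C)"
  proof
    fix b :: 'a assume "b \<in> Basis"
    then have "schwartz (partials [b] f)" by (intro schwartz_partials f) auto
    then obtain C where "C \<ge> 0" "\<And>x. norm x ^ 0 * norm (partials [b] f x) \<le> C"
      using schwartz_decay[where k=0] by blast
    then show "\<exists>C. C \<ge> 0 \<and> (\<forall>x. norm (fderiv f x b) \<le> C)" by auto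
  qed
  then obtain C where C: "\<And>b. b \<in> Basis \<Longrightarrow> C b \<ge> 0" "\<And>b x. b \<in> Basis \<Longrightarrow> norm (fderiv f x b) \<le> C b"
    by metis
  define L where "L = (\<Sum>b\<in>Basis. C b)"
  have 1: "norm (fderiv f x v) \<le> L * norm v" for x v
  proof -
    have "norm (fderiv f x v) = norm (\<Sum>b\<in>Basis. (v \<bullet> b) *\<^sub>R fderiv f x b)"
      unfolding frechet_derivative_Basis_sum[OF f, of x v] by simp
    also have "\<dots> \<le> (\<Sum>b\<in>Basis. C b * norm v)"
    proof (rule sum_norm_le)
      fix b :: 'a assume b: "b \<in> Basis"
      show "norm ((v \<bullet> b) *\<^sub>R fderiv f x b) \<le> C b * norm v"
        using mult_mono[OF Basis_le_norm[OF b, of v] C(2)[OF b, of x]] by (simp add: mult.commute)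
    qed
    finally show ?thesis by (simp add: L_def sum_distrib_right)
  qed
  moreover have "L \<ge> 0" unfolding L_def by (intro sum_nonneg C)
  moreover have "norm (f x - f y) \<le> L * norm (x - y)" for x y
  proof (rule differentiable_bound[of UNIV f "\<lambda>x. fderiv f x"])
    show "(f has_derivative fderiv f x) (at x within UNIV)" for x
      using schwartz_differentiable[OF f] by (simp add: frechet_derivative_works)
    show "onorm (fderiv f x) \<le> L" for x using 1 by (rule onorm_le)
  qed auto
  ultimately show thesis using that by blast
qed

context
  fixes M :: "'t measure" and a :: "'t \<Rightarrow> real" and y :: "'t \<Rightarrow> 'a::euclidean_space" and A \<delta> Y :: real
  assumes M: "finite_measure M"
    and a [measurable]: "a \<in> borel_measurable M" and y [measurable]: "y \<in> borel_measurable M"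
    and \<delta>: "\<delta> > 0" and a_ge: "\<And>t. \<delta> \<le> a t" and a_le: "\<And>t. a t \<le> A" and Y: "\<And>t. norm (y t) \<le> Y"
begin

text \<open>The Frechet remainders of the integrands, divided by the norm of the increment, tend to
  0 for each t. The Lipschitz bound of h dominates them uniformly in t, and M is finite.\<close>

lemma has_derivative_superposition:
  fixes h :: "'a \<Rightarrow> complex"
  assumes h: "schwartz h" and w [measurable]: "w \<in> borel_measurable M" and W: "\<And>t. \<bar>w t\<bar> \<le> W"
  shows "((\<lambda>x. \<integral>t. w t *\<^sub>R h (a t *\<^sub>R x - y t) \<partial>M) has_derivative
    (\<lambda>v. \<integral>t. (w t * a t) *\<^sub>R fderiv h ((a t *\<^sub>R x - y t)) v \<partial>M)) (at x)"
proof -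
  interpret finite_measure M by (rule M)
  obtain L where L: "L \<ge> 0" "\<And>x v. norm (fderiv h x v) \<le> L * norm v"
    "\<And>x y. norm (h x - h y) \<le> L * norm (x - y)" using schwartz_frechet_derivative_bound[OF h] by blast
  obtain B where B: "B \<ge> 0" "\<And>x. norm (h x) \<le> B" using schwartz_decay[OF h, where k=0] by auto
  have A0: "0 < a t" "\<bar>a t\<bar> \<le> A" for t using \<delta> a_ge[of t] a_le[of t] by auto
  have A: "A \<ge> 0" using A0[of undefined] by linarith
  have W0: "W \<ge> 0" using W[of undefined] by linarith
  note [measurable] = schwartz_borel_measurable[OF h]
  let ?d = "\<lambda>t. fderiv h ((a t *\<^sub>R x - y t))"
  have lin: "linear (fderiv h z)" for z
    using schwartz_differentiable[OF h] by (rule linear_frechet_derivative)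
  have [measurable]: "(\<lambda>z. fderiv h z v) \<in> borel_measurable borel" for v
  proof -
    have [measurable]: "partials [b] h \<in> borel_measurable borel" if "b \<in> Basis" for b
      using that by (intro schwartz_borel_measurable schwartz_partials h) auto
    show ?thesis unfolding frechet_derivative_Basis_sum[OF h] by measurable
  qed
  have wa: "\<bar>w t * a t\<bar> \<le> W * A" for t
    unfolding abs_mult by (intro mult_mono W A0 W0) auto
  have i1: "integrable M (\<lambda>t. w t *\<^sub>R h (a t *\<^sub>R x - y t))" for x
    by (rule integrable_const_bound[where B="W * B"]) (auto intro!: mult_mono W B W0)
  have i2: "integrable M (\<lambda>t. (w t * a t) *\<^sub>R ?d t v)" for v
    by (rule integrable_const_bound[where B="W * A * (L * norm v)"])
      (auto intro!: mult_mono L wa[unfolded abs_mult] mult_nonneg_nonneg W0 A simp: abs_mult)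
  let ?F = "\<lambda>x. \<integral>t. w t *\<^sub>R h (a t *\<^sub>R x - y t) \<partial>M"
  let ?D = "\<lambda>v. \<integral>t. (w t * a t) *\<^sub>R ?d t v \<partial>M"
  have bl: "bounded_linear ?D"
  proof (rule bounded_linear_intro)
    show "?D (u + v) = ?D u + ?D v" for u v using i2 lin by (simp add: linear_add scaleR_add_right)
    show "?D (r *\<^sub>R v) = r *\<^sub>R ?D v" for r v
    proof -
      have "?D (r *\<^sub>R v) = (\<integral>t. r *\<^sub>R ((w t * a t) *\<^sub>R ?d t v) \<partial>M)"
        using lin by (simp add: linear_cmul mult_ac)
      also have "\<dots> = r *\<^sub>R ?D v" by (rule Bochner_Integration.integral_scaleR_right)
      finally show ?thesis .
    qed
    show "norm (?D v) \<le> norm v * (W * A * L * measure M (space M))" for v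
    proof -
      have "norm (?D v) \<le> (\<integral>t. norm ((w t * a t) *\<^sub>R ?d t v) \<partial>M)" by (rule integral_norm_bound)
      also have "\<dots> \<le> (\<integral>t. W * A * (L * norm v) \<partial>M)"
        by (rule integral_mono[OF integrable_norm[OF i2]])
          (auto intro!: mult_mono L wa[unfolded abs_mult] mult_nonneg_nonneg W0 A simp: abs_mult)
      finally show ?thesis by (simp add: mult_ac)
    qed
  qed
  \<comment> \<open>The limit is tested along sequences of increments, the setting of dominated
    convergence.\<close>
  have "(\<lambda>v. norm (?F (x + v) - ?F x - ?D v) / norm v) \<midarrow>0\<rightarrow> 0"
    unfolding tendsto_at_iff_sequentially
  proof (intro allI impI)
    fix V :: "nat \<Rightarrow> 'a" assume V: "\<forall>i. V i \<in> UNIV - {0}" and V0: "V \<longlonglongrightarrow> 0"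
    define R where "R t v = h (a t *\<^sub>R (x + v) - y t) - h (a t *\<^sub>R x - y t) - a t *\<^sub>R ?d t v" for t v
    let ?R = "\<lambda>t k. norm (w t *\<^sub>R R t (V k)) / norm (V k)"
    have "(\<lambda>k. \<integral>t. ?R t k \<partial>M) \<longlonglongrightarrow> (\<integral>t. 0 \<partial>M)"
    proof (rule integral_dominated_convergence[where w="\<lambda>_. W * (2 * (L * A))"])
      show "AE t in M. (\<lambda>k. ?R t k) \<longlonglongrightarrow> 0"
      proof (rule AE_I2)
        fix t
        let ?z = "a t *\<^sub>R x - y t"
        let ?e = "\<lambda>k. norm (h (?z + a t *\<^sub>R V k) - h ?z - fderiv h ?z (a t *\<^sub>R V k)) / norm (a t *\<^sub>R V k)"
        have "(h has_derivative fderiv h ?z) (at ?z)"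
          using schwartz_differentiable[OF h] frechet_derivative_works by blast
        then have lim: "(\<lambda>v. norm (h (?z + v) - h ?z - fderiv h ?z v) / norm v) \<midarrow>0\<rightarrow> 0"
          by (simp add: has_derivative_at)
        have "(\<lambda>k. a t *\<^sub>R V k) \<longlonglongrightarrow> a t *\<^sub>R 0" by (intro tendsto_intros V0)
        then have "filterlim (\<lambda>k. a t *\<^sub>R V k) (at 0) sequentially"
          using V A0(1)[of t] by (auto simp: filterlim_at)
        from filterlim_compose[OF lim this]
        have "(\<lambda>k. \<bar>w t\<bar> * a t * (?e k)) \<longlonglongrightarrow> \<bar>w t\<bar> * a t * 0" by (intro tendsto_intros)
        also have "(\<lambda>k. \<bar>w t\<bar> * a t * (?e k)) = (\<lambda>k. ?R t k)"
        proof
          fix k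
          have z: "a t *\<^sub>R (x + V k) - y t = ?z + a t *\<^sub>R V k" by (simp add: scaleR_add_right)
          show "\<bar>w t\<bar> * a t * (?e k) = ?R t k"
            using A0(1)[of t] V lin[of ?z] unfolding R_def z by (simp add: linear_cmul)
        qed
        finally show "(\<lambda>k. ?R t k) \<longlonglongrightarrow> 0" by simp
      qed
      show "AE t in M. norm (?R t k) \<le> W * (2 * (L * A))" for k
      proof (rule AE_I2)
        fix t
        have V0: "norm (V k) > 0" using V by auto
        have "norm (R t (V k)) \<le> norm (h (a t *\<^sub>R (x + V k) - y t) - h (a t *\<^sub>R x - y t)) + norm (a t *\<^sub>R ?d t (V k))"
          unfolding R_def by (rule norm_triangle_ineq4)
        also have "\<dots> \<le> L * (A * norm (V k)) + A * (L * norm (V k))"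
        proof (rule add_mono)
          have "norm (h (a t *\<^sub>R (x + V k) - y t) - h (a t *\<^sub>R x - y t)) \<le> L * norm ((a t *\<^sub>R (x + V k) - y t) - (a t *\<^sub>R x - y t))"
            by (rule L)
          also have "norm ((a t *\<^sub>R (x + V k) - y t) - (a t *\<^sub>R x - y t)) = \<bar>a t\<bar> * norm (V k)"
            by (simp add: scaleR_add_right)
          also have "L * (\<bar>a t\<bar> * norm (V k)) \<le> L * (A * norm (V k))"
            by (intro mult_left_mono mult_right_mono A0 L) auto
          finally show "norm (h (a t *\<^sub>R (x + V k) - y t) - h (a t *\<^sub>R x - y t)) \<le> L * (A * norm (V k))" .
          show "norm (a t *\<^sub>R ?d t (V k)) \<le> A * (L * norm (V k))"
            unfolding norm_scaleR by (intro mult_mono A0 L A) auto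
        qed
        finally have "norm (R t (V k)) / norm (V k) \<le> 2 * (L * A)"
          using V0 by (simp add: pos_divide_le_eq mult_ac)
        then have "\<bar>w t\<bar> * (norm (R t (V k)) / norm (V k)) \<le> W * (2 * (L * A))"
          by (intro mult_mono W W0) auto
        then show "norm (?R t k) \<le> W * (2 * (L * A))" by simp
      qed
    qed (auto simp: R_def)
    then have "(\<lambda>k. \<integral>t. ?R t k \<partial>M) \<longlonglongrightarrow> 0" by simp
    then have "(\<lambda>k. norm (?F (x + V k) - ?F x - ?D (V k)) / norm (V k)) \<longlonglongrightarrow> 0"
    proof (rule Lim_null_comparison[rotated], intro always_eventually allI)
      fix k
      have "?F (x + V k) - ?F x - ?D (V k) = (\<integral>t. w t *\<^sub>R R t (V k) \<partial>M)"
        using i1 i2 unfolding R_def by (simp add: scaleR_diff_right)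
      then have "norm (?F (x + V k) - ?F x - ?D (V k)) \<le> (\<integral>t. norm (w t *\<^sub>R R t (V k)) \<partial>M)"
        by (simp only: integral_norm_bound)
      then show "norm (norm (?F (x + V k) - ?F x - ?D (V k)) / norm (V k)) \<le> (\<integral>t. ?R t k \<partial>M)"
        by (simp add: divide_right_mono)
    qed
    then show "((\<lambda>v. norm (?F (x + v) - ?F x - ?D v) / norm v) \<circ> V) \<longlonglongrightarrow> 0" by (simp add: o_def)
  qed
  with bl show ?thesis by (simp add: has_derivative_at)
qed

text \<open>Every derivative adds a factor a t to the weight, so the induction runs through the
  bounded weights w t * a t ^ j. For the decay, \<delta> |x| is at most the norm of the argument of
  h plus Y, which converts powers of |x| into powers of that argument.\<close>

lemma schwartz_superposition:
  fixes h :: "'a \<Rightarrow> complex"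
  assumes h: "schwartz h" and w [measurable]: "w \<in> borel_measurable M" and W: "\<And>t. \<bar>w t\<bar> \<le> W"
  shows "schwartz (\<lambda>x. \<integral>t. w t *\<^sub>R h (a t *\<^sub>R x - y t) \<partial>M)"
proof -
  interpret finite_measure M by (rule M)
  have A0: "0 < a t" "\<bar>a t\<bar> \<le> A" for t using \<delta> a_ge[of t] a_le[of t] by auto
  have A: "A \<ge> 0" using A0[of undefined] by linarith
  have W0: "W \<ge> 0" using W[of undefined] by linarith
  have Y0: "Y \<ge> 0" using order_trans[OF norm_ge_zero Y[of undefined]] .
  have wj: "\<bar>w t * a t ^ j\<bar> \<le> W * A ^ j" for t j
    unfolding abs_mult power_abs by (intro mult_mono W power_mono A0 W0) auto
  let ?F = "\<lambda>x. \<integral>t. w t *\<^sub>R h (a t *\<^sub>R x - y t) \<partial>M"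
  have eq: "partials bs ?F = (\<lambda>x. \<integral>t. (w t * a t ^ length bs) *\<^sub>R partials bs h (a t *\<^sub>R x - y t) \<partial>M)"
    if "set bs \<subseteq> Basis" for bs using that
  proof (induction bs)
    case (Cons b bs)
    have "((\<lambda>x. \<integral>t. (w t * a t ^ length bs) *\<^sub>R partials bs h (a t *\<^sub>R x - y t) \<partial>M) has_derivative
      (\<lambda>v. \<integral>t. (w t * a t ^ length bs * a t) *\<^sub>R fderiv (partials bs h) ((a t *\<^sub>R x - y t)) v \<partial>M)) (at x)" for x
      using Cons.prems by (intro has_derivative_superposition[OF _ _ wj] schwartz_partials h) auto
    from frechet_derivative_at[OF this, symmetric] Cons show ?case by (simp add: mult_ac)
  qed simp
  show ?thesis unfolding schwartz_def
  proof (intro allI impI conjI)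
    fix bs and x assume bs: "set bs \<subseteq> (Basis :: 'a set)"
    have "((\<lambda>x. \<integral>t. (w t * a t ^ length bs) *\<^sub>R partials bs h (a t *\<^sub>R x - y t) \<partial>M) has_derivative
      (\<lambda>v. \<integral>t. (w t * a t ^ length bs * a t) *\<^sub>R fderiv (partials bs h) ((a t *\<^sub>R x - y t)) v \<partial>M)) (at x)" for x
      using bs by (intro has_derivative_superposition[OF _ _ wj] schwartz_partials h) auto
    then show "partials bs ?F differentiable (at x)" unfolding eq[OF bs] differentiable_def by blast
  next
    fix bs and k :: nat assume bs: "set bs \<subseteq> (Basis :: 'a set)"
    define g where "g = partials bs h"
    have g: "schwartz g" unfolding g_def using bs by (intro schwartz_partials h)
    note [measurable] = schwartz_borel_measurable[OF g]
    let ?G = "\<lambda>x t. (w t * a t ^ length bs) *\<^sub>R g (a t *\<^sub>R x - y t)"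
    obtain B where B: "B \<ge> 0" "\<And>x. norm x ^ 0 * norm (g x) \<le> B" using schwartz_decay[OF g, where k=0] by blast
    obtain C where C: "C \<ge> 0" "\<And>x. norm x ^ k * norm (g x) \<le> C" using schwartz_decay[OF g, where k=k] by blast
    define K where "K = W * A ^ length bs * ((1 / \<delta>) ^ k * (2 ^ k * (C + Y ^ k * B)))"
    have *: "norm (norm x ^ k *\<^sub>R (?G x t)) \<le> K" for x t
    proof -
      let ?z = "a t *\<^sub>R x - y t"
      have "\<delta> * norm x \<le> norm (a t *\<^sub>R x)" using a_ge[of t] A0(1)[of t] by (simp add: mult_right_mono)
      also have "a t *\<^sub>R x = ?z + y t" by simp
      also have "norm \<dots> \<le> norm ?z + Y" using norm_triangle_ineq[of ?z "y t"] Y[of t] by linarith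
      finally have "norm x \<le> 1 / \<delta> * (norm ?z + Y)" using \<delta> by (simp add: field_simps)
      then have "norm x ^ k \<le> (1 / \<delta> * (norm ?z + Y)) ^ k" by (intro power_mono) auto
      also have "\<dots> = (1 / \<delta>) ^ k * (norm ?z + Y) ^ k" by (simp only: power_mult_distrib)
      also have "\<dots> \<le> (1 / \<delta>) ^ k * (2 ^ k * (norm ?z ^ k + Y ^ k))"
        using \<delta> Y0 by (intro mult_left_mono sum_power_le) auto
      finally have "norm x ^ k * norm (g ?z) \<le> (1 / \<delta>) ^ k * (2 ^ k * (norm ?z ^ k + Y ^ k)) * norm (g ?z)"
        by (intro mult_right_mono) auto
      also have "\<dots> = (1 / \<delta>) ^ k * (2 ^ k * (norm ?z ^ k * norm (g ?z) + Y ^ k * norm (g ?z)))"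
        by (simp add: algebra_simps)
      also have "\<dots> \<le> (1 / \<delta>) ^ k * (2 ^ k * (C + Y ^ k * B))"
        using C(2)[of ?z] B(2)[of ?z] \<delta> Y0 by (intro mult_left_mono add_mono) auto
      finally have "norm x ^ k * norm (g ?z) \<le> (1 / \<delta>) ^ k * (2 ^ k * (C + Y ^ k * B))" .
      then have "\<bar>w t * a t ^ length bs\<bar> * (norm x ^ k * norm (g ?z)) \<le> K"
        unfolding K_def by (rule mult_mono[OF wj]) (use W0 A in auto)
      then show ?thesis by (simp add: mult_ac abs_mult)
    qed
    have "norm (norm x ^ k *\<^sub>R partials bs ?F x) \<le> K * measure M (space M)" for x
    proof -
      have i: "integrable M (\<lambda>t. norm x ^ k *\<^sub>R (?G x t))"
        by (rule integrable_const_bound[where B=K]) (use * in auto)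
      have "norm x ^ k *\<^sub>R partials bs ?F x = (\<integral>t. norm x ^ k *\<^sub>R (?G x t) \<partial>M)"
        unfolding eq[OF bs] g_def[symmetric]
        by (rule Bochner_Integration.integral_scaleR_right[symmetric])
      also have "norm \<dots> \<le> (\<integral>t. norm (norm x ^ k *\<^sub>R (?G x t)) \<partial>M)" by (rule integral_norm_bound)
      also have "\<dots> \<le> (\<integral>t. K \<partial>M)" by (rule integral_mono[OF integrable_norm[OF i]]) (use * in auto)
      finally show ?thesis by (simp add: mult_ac)
    qed
    then show "bounded (range (\<lambda>x. norm x ^ k *\<^sub>R partials bs ?F x))" unfolding bounded_iff by blast
  qed
qed

end

section \<open>Sharpness\<close>

lemma fourier_gaussian_translate:
  fixes \<omega> \<xi> :: "'a::euclidean_space"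
  assumes l: "l > 0"
  shows "(\<integral>x. wave x \<xi> * of_real (exp (- (l * (norm (x - \<omega>))\<^sup>2 / 2))) \<partial>lborel) =
    wave \<omega> \<xi> * of_real ((2 * pi / l) powr (real DIM('a) / 2) * gauss l \<xi>)"
proof -
  define f where "f x = wave x \<xi> * of_real (exp (- (l * (norm (x - \<omega>))\<^sup>2 / 2)))" for x :: 'a
  let ?g = "\<lambda>x. exp (\<i> * of_real (x \<bullet> (- \<xi>))) * of_real (gauss (1 / l) x)"
  have [measurable]: "f \<in> borel_measurable borel" unfolding f_def[abs_def] by measurable
  have "(\<integral>x. f x \<partial>lborel) = (\<integral>x. f x \<partial>distr lborel borel ((+) \<omega>))"
    by (simp add: lborel_distr_plus)
  also have "\<dots> = (\<integral>x. f (\<omega> + x) \<partial>lborel)"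
    by (rule integral_distr) auto
  also have "(\<lambda>x. f (\<omega> + x)) = (\<lambda>x. wave \<omega> \<xi> * (?g x))"
  proof
    fix x
    have "wave (\<omega> + x) \<xi> = wave \<omega> \<xi> * exp (\<i> * of_real (x \<bullet> (- \<xi>)))"
      unfolding exp_add[symmetric] by (simp add: inner_add_left algebra_simps)
    then show "f (\<omega> + x) = wave \<omega> \<xi> * (?g x)" using l by (simp add: f_def mult_ac)
  qed
  also have "(\<integral>x. wave \<omega> \<xi> * (?g x) \<partial>lborel) =
     wave \<omega> \<xi> * of_real ((2 * pi * (1 / l)) powr (real DIM('a) / 2) * exp (- (1 / l * (norm (- \<xi>))\<^sup>2 / 2)))"
    using l by (subst integral_mult_right_zero, subst fourier_gaussian) auto
  finally show ?thesis by (simp add: f_def mult.commute)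
qed

lemma ident_pair_sphere_measure:
  assumes "sets L = sets borel"
  shows "(\<lambda>p. p) \<in> measurable (L \<Otimes>\<^sub>M (sphere_measure :: 'a::euclidean_space measure)) (borel \<Otimes>\<^sub>M borel)"
  by (rule measurable_pair_sphere, rule measurable_ident_sets, rule sets_pair_measure_cong) (simp_all add: assms)

text \<open>Superposition over \<open>l \<in> [1/K, K]\<close> of Gaussians centred on the sphere; as \<open>K \<rightarrow> \<infinity>\<close> its Fourier transform
  tends to a multiple of \<open>|\<xi>|\<^sup>-\<^sup>2\<^sup>s\<close> times that of the surface measure, the extremiser.\<close>

lemma sphere_trace_test_function:
  fixes s K :: real
  assumes s: "0 < s" and K: "K \<ge> 1"
  obtains F :: "'a::euclidean_space \<Rightarrow> complex" and b :: real where "schwartz F" "b \<ge> 0"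
    "ennreal b = (\<integral>\<^sup>+l\<in>{1/K..K}. ennreal (sphere_weight DIM('a) s l) *
       (\<integral>\<^sup>+\<omega>. sphere_kernel l \<omega> \<partial>(sphere_measure :: 'a measure)) \<partial>lborel)"
    "b\<^sup>2 \<le> measure (sphere_measure :: 'a measure) (sphere 0 1) * (sphere_L2_norm F)\<^sup>2"
    "(hom_sobolev_norm s F)\<^sup>2 \<le> Gamma s * 2 powr s * b"
proof -
  let ?n = "real DIM('a)" and ?S = "sphere_measure :: 'a measure"
  interpret S: finite_measure ?S by (rule finite_sphere_measure)
  define I where "I = {1/K..K}"
  have I: "l > 0" "1/K \<le> l" "l \<le> K" if "l \<in> I" for l
    using that K order_less_le_trans[of 0 "1/K" l] by (auto simp: I_def)
  define L where "L = density lborel (indicator I :: real \<Rightarrow> ennreal)"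
  have sets_L [measurable_cong]: "sets L = sets borel" by (simp add: L_def)
  have [measurable]: "I \<in> sets borel" by (simp add: I_def)
  interpret L: finite_measure L
    by (rule finite_measureI) (simp add: L_def emeasure_density I_def emeasure_lborel_Icc_eq)
  interpret LS: pair_sigma_finite L ?S ..
  let ?P = "L \<Otimes>\<^sub>M ?S"
  interpret P: finite_measure ?P by (rule finite_measure_pair_measure) (unfold_locales)
  note ident = ident_pair_sphere_measure[OF sets_L, where 'a='a]
  note ident_L = measurable_ident_sets[OF sets_L]

  text \<open>The superposition lemma wants bounds on the whole parameter type, hence the truncations.\<close>
  define cl where "cl l = max (1/K) (min K l)" for l
  define cw where "cw \<omega> = (if norm \<omega> \<le> 1 then \<omega> else 0)" for \<omega> :: 'a
  have K1: "1/K \<le> 1" "0 < 1/K" using K by auto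
  have cl: "1/K \<le> cl l" "cl l \<le> K" "0 < cl l" for l
    using K K1 unfolding cl_def by linarith+
  have cl_eq: "cl l = l" if "l \<in> I" for l using I[OF that] by (simp add: cl_def)
  have cw: "norm (cw \<omega>) \<le> 1" for \<omega> by (simp add: cw_def)
  have cw_eq: "cw \<omega> = \<omega>" if "\<omega> \<in> space ?S" for \<omega> using that by (simp add: cw_def)
  have [measurable]: "cl \<in> borel_measurable borel" "cw \<in> borel_measurable borel"
    unfolding cl_def[abs_def] cw_def[abs_def] by measurable
  define w where "w l = sphere_weight DIM('a) s (cl l)" for l
  \<comment> \<open>The two factors of \<open>sphere_weight\<close> are monotone in opposite
    directions: the first is largest at 1/K, the second at K.\<close>
  define W where "W = (1/K) powr (- s - 1) * (K / (2 * pi)) powr (?n / 2)"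
  have w: "0 \<le> w l" "\<bar>w l\<bar> \<le> W" for l
  proof -
    show "0 \<le> w l" by (simp add: w_def sphere_weight_nonneg)
    have "w l \<le> W" unfolding w_def W_def sphere_weight_def
      using cl[of l] s K by (intro mult_mono powr_mono2 powr_mono2' divide_right_mono) auto
    with \<open>0 \<le> w l\<close> show "\<bar>w l\<bar> \<le> W" by simp
  qed
  have [measurable]: "w \<in> borel_measurable borel" unfolding w_def[abs_def] by measurable
  define E where "E p x = exp (- (cl (fst p) * (norm (x - cw (snd p)))\<^sup>2 / 2))" for p :: "real \<times> 'a" and x :: 'a
  have E: "0 \<le> E p x" "E p x \<le> 1" for p x
    using cl(3)[of "fst p"] by (auto simp: E_def)
  have E_P [measurable]: "(\<lambda>p. w (fst p) * E p x) \<in> borel_measurable ?P" for x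
    by (rule measurable_compose[OF ident]) (unfold E_def, measurable)
  define f where "f x = (\<integral>p. w (fst p) * E p x \<partial>?P)" for x
  define F where "F x = complex_of_real (f x)" for x
  have wE: "norm (w (fst p) * E p x) \<le> W" for p x
    using mult_mono[OF w(2)[of "fst p"] E(2)[of p x]] E(1)[of p x] order_trans[OF abs_ge_zero w(2)[of 0]]
    by (simp add: abs_mult)
  have int_E: "integrable ?P (\<lambda>p. w (fst p) * E p x)" for x
    by (rule P.integrable_const_bound[OF AE_I2[OF wE] E_P])
  have f0: "f x \<ge> 0" for x unfolding f_def by (intro integral_nonneg_AE AE_I2 mult_nonneg_nonneg w E)

  have F: "schwartz F"
  proof -
    \<comment> \<open>The factor l in the exponent is absorbed into the argument as sqrt(l), so that
      all members of the family are dilates and translates of one fixed Gaussian.\<close>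
    let ?h = "\<lambda>p x. complex_of_real (exp (- ((norm (sqrt (cl (fst p)) *\<^sub>R x - sqrt (cl (fst p)) *\<^sub>R cw (snd p)))\<^sup>2 / 2)))"
    have "schwartz (\<lambda>x. \<integral>p. w (fst p) *\<^sub>R ?h p x \<partial>?P)"
    proof (rule schwartz_superposition[OF P.finite_measure_axioms, where \<delta>="sqrt (1/K)" and A="sqrt K" and Y="sqrt K" and W=W])
      show "(\<lambda>p. sqrt (cl (fst p))) \<in> borel_measurable ?P"
        by (rule measurable_compose[OF ident]) measurable
      show "(\<lambda>p. sqrt (cl (fst p)) *\<^sub>R cw (snd p)) \<in> borel_measurable ?P"
        by (rule measurable_compose[OF ident]) measurable
      show "(\<lambda>p. w (fst p)) \<in> borel_measurable ?P" by (rule measurable_compose[OF ident]) measurable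
      show "norm (sqrt (cl (fst p)) *\<^sub>R cw (snd p)) \<le> sqrt K" for p :: "real \<times> 'a"
        using mult_mono[OF real_sqrt_le_mono[OF cl(2)[of "fst p"]] cw[of "snd p"]] cl(3)[of "fst p"] K by simp
    qed (use K cl w schwartz_gaussian in auto)
    also have "(\<lambda>x. \<integral>p. w (fst p) *\<^sub>R ?h p x \<partial>?P) = F"
    proof
      fix x
      have "w (fst p) *\<^sub>R ?h p x = of_real (w (fst p) * E p x)" for p using cl(3)[of "fst p"]
        by (simp add: E_def scaleR_conv_of_real power_mult_distrib flip: scaleR_diff_right)
      then show "(\<integral>p. w (fst p) *\<^sub>R ?h p x \<partial>?P) = F x"
        unfolding F_def f_def by (simp only: integral_complex_of_real)
    qed
    finally show ?thesis .
  qed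

  define e where "e l = (\<integral>\<^sup>+\<omega>. sphere_kernel l \<omega> \<partial>?S)" for l
  have [measurable]: "e \<in> borel_measurable borel"
    unfolding e_def[abs_def] by (rule S.borel_measurable_nn_integral, rule measurable_pair_sphere) measurable

  \<comment> \<open>The integral of F over the sphere is the quantity that links the two norms:
    Cauchy-Schwarz against 1 bounds the trace from below by it, and the quadratic form bounds the
    Sobolev norm from above by it.\<close>
  define B where "B = (\<integral>\<^sup>+\<omega>. ennreal (f \<omega>) \<partial>?S)"
  have B_eq: "B = (\<integral>\<^sup>+l\<in>I. ennreal (sphere_weight DIM('a) s l) * e l \<partial>lborel)"
  proof -
    let ?R = "\<lambda>l z. \<integral>\<^sup>+\<omega>'. ennreal (w l * E (l, \<omega>') z) \<partial>?S"
    have "B = (\<integral>\<^sup>+\<omega>. \<integral>\<^sup>+l. ennreal (w l) * sphere_kernel l \<omega> \<partial>L \<partial>?S)" unfolding B_def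
    proof (rule nn_integral_cong)
      fix \<omega> assume \<omega>: "\<omega> \<in> space ?S"
      have "ennreal (f \<omega>) = (\<integral>\<^sup>+p. ennreal (w (fst p) * E p \<omega>) \<partial>?P)"
        unfolding f_def by (rule nn_integral_eq_integral[OF int_E, symmetric]) (intro AE_I2 mult_nonneg_nonneg w E)
      also have "\<dots> = (\<integral>\<^sup>+l. ?R l \<omega> \<partial>L)"
        using S.nn_integral_fst[OF measurable_compose[OF E_P[of \<omega>] measurable_ennreal]] by simp
      also have "\<dots> = (\<integral>\<^sup>+l. ennreal (w l) * sphere_kernel l \<omega> \<partial>L)" unfolding L_def
      proof (subst (1 2) nn_integral_density)
        show "(\<lambda>l. ?R l \<omega>) \<in> borel_measurable lborel"
          by (rule S.borel_measurable_nn_integral, rule measurable_pair_sphere) (unfold E_def, measurable)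
        show "(\<integral>\<^sup>+l. indicator I l * (?R l \<omega>) \<partial>lborel) = (\<integral>\<^sup>+l. indicator I l * (ennreal (w l) * sphere_kernel l \<omega>) \<partial>lborel)" (is "integral\<^sup>N _ ?l'' = integral\<^sup>N _ ?r''")
        proof (rule nn_integral_cong)
          fix l :: real
          have "(?R l \<omega>) = ennreal (w l) * sphere_kernel l \<omega>" if l: "l \<in> I"
          proof -
            have "(?R l \<omega>) = (\<integral>\<^sup>+\<omega>'. ennreal (w l) * ennreal (exp (- (l * (1 - \<omega>' \<bullet> \<omega>)))) \<partial>?S)" (is "integral\<^sup>N _ ?l''' = integral\<^sup>N _ ?r'''")
            proof (rule nn_integral_cong)
              fix \<omega>' assume \<omega>': "\<omega>' \<in> space ?S"
              have "E (l, \<omega>') \<omega> = exp (- (l * ((norm (\<omega> - \<omega>'))\<^sup>2 / 2)))"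
                by (simp add: E_def cl_eq[OF l] cw_eq[OF \<omega>'])
              also have "(norm (\<omega> - \<omega>'))\<^sup>2 / 2 = 1 - \<omega>' \<bullet> \<omega>"
                using \<omega> \<omega>' by (intro sphere_dist_sqr) auto
              finally show "?l''' \<omega>' = ?r''' \<omega>'" using w(1) by (simp add: ennreal_mult)
            qed
            also have "\<dots> = ennreal (w l) * sphere_kernel l \<omega>"
              unfolding sphere_kernel_def by (rule nn_integral_cmult, rule measurable_sphere) measurable
            finally show ?thesis .
          qed
          then show "?l'' l = ?r'' l" by (auto simp: indicator_def)
        qed
      qed measurable
      finally show "ennreal (f \<omega>) = (\<integral>\<^sup>+l. ennreal (w l) * sphere_kernel l \<omega> \<partial>L)" .
    qed
    also have "\<dots> = (\<integral>\<^sup>+l. \<integral>\<^sup>+\<omega>. ennreal (w l) * sphere_kernel l \<omega> \<partial>?S \<partial>L)"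
      by (rule nn_integral_Fubini[OF sphere_sigma_finite L.sigma_finite_measure_axioms], rule measurable_sphere_pair) measurable
    also have "\<dots> = (\<integral>\<^sup>+l. ennreal (w l) * e l \<partial>L)"
      unfolding e_def by (intro nn_integral_cong nn_integral_cmult, rule measurable_sphere) measurable
    also have "\<dots> = (\<integral>\<^sup>+l. indicator I l * (ennreal (w l) * e l) \<partial>lborel)"
      unfolding L_def by (rule nn_integral_density) measurable
    also have "\<dots> = (\<integral>\<^sup>+l\<in>I. ennreal (sphere_weight DIM('a) s l) * e l \<partial>lborel)"
      by (intro nn_integral_cong) (auto simp: indicator_def w_def cl_eq)
    finally show ?thesis .
  qed

  obtain D where D: "\<And>x. norm (F x) \<le> D" using schwartz_decay[OF F, where k=0] by auto
  have f_le: "f x \<le> D" for x using D[of x] f0[of x] by (simp add: F_def)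
  have [measurable]: "f \<in> borel_measurable borel"
  proof -
    have "(\<lambda>x. Re (F x)) \<in> borel_measurable borel" using schwartz_borel_measurable[OF F] by measurable
    then show ?thesis by (simp add: F_def)
  qed
  have f_S [measurable]: "f \<in> borel_measurable ?S" by (rule measurable_sphere) measurable
  define b where "b = (\<integral>\<omega>. f \<omega> \<partial>?S)"
  have b0: "b \<ge> 0" unfolding b_def using f0 by (intro integral_nonneg_AE) auto
  have B_b: "B = ennreal b"
    unfolding B_def b_def using f0 f_le by (intro nn_integral_eq_integral S.integrable_const_bound[where B=D]) auto

  have N_eq: "(\<integral>\<^sup>+\<omega>. ennreal ((f \<omega>)\<^sup>2) \<partial>?S) = ennreal ((sphere_L2_norm F)\<^sup>2)"
  proof -
    have "(sphere_L2_norm F)\<^sup>2 = (\<integral>\<omega>. (f \<omega>)\<^sup>2 \<partial>?S)"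
      unfolding sphere_L2_norm_def F_def by (subst real_sqrt_pow2) (auto intro!: integral_nonneg_AE)
    moreover have "(\<integral>\<^sup>+\<omega>. ennreal ((f \<omega>)\<^sup>2) \<partial>?S) = ennreal (\<integral>\<omega>. (f \<omega>)\<^sup>2 \<partial>?S)"
      using f0 f_le by (intro nn_integral_eq_integral S.integrable_const_bound[where B="D\<^sup>2"]) (auto intro!: power_mono)
    ultimately show ?thesis by simp
  qed
  have trace: "b\<^sup>2 \<le> measure ?S (sphere 0 1) * (sphere_L2_norm F)\<^sup>2"
  proof -
    have "B\<^sup>2 = (\<integral>\<^sup>+\<omega>. ennreal (f \<omega>) * 1 \<partial>?S)\<^sup>2" by (simp add: B_def)
    also have "\<dots> \<le> (\<integral>\<^sup>+\<omega>. (ennreal (f \<omega>))\<^sup>2 \<partial>?S) * (\<integral>\<^sup>+\<omega>. 1\<^sup>2 \<partial>?S)"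
      by (rule Cauchy_Schwarz_nn_integral) measurable
    also have "(\<integral>\<^sup>+\<omega>. (ennreal (f \<omega>))\<^sup>2 \<partial>?S) = ennreal ((sphere_L2_norm F)\<^sup>2)"
      unfolding N_eq[symmetric] using f0 by (simp add: ennreal_power)
    also have "(\<integral>\<^sup>+\<omega>. 1\<^sup>2 \<partial>?S) = ennreal (measure ?S (sphere 0 1))"
      by (simp add: S.emeasure_eq_measure)
    finally have "ennreal (b\<^sup>2) \<le> ennreal (measure ?S (sphere 0 1) * (sphere_L2_norm F)\<^sup>2)"
      using b0 unfolding B_b by (simp add: ennreal_power ennreal_mult mult.commute)
    then show ?thesis by (subst (asm) ennreal_le_iff) auto
  qed

  let ?k = "\<lambda>l (x :: 'a). cl l powr (- s - 1) * gauss (cl l) x"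
  \<comment> \<open>m is the truncation to l in I of the integral that represents
    \<open>Gamma s * 2 powr s\<close> times |xi|^(-2s).\<close>
  define m where "m \<xi> = (\<integral>l. ?k l \<xi> \<partial>L)" for \<xi> :: 'a
  have m_bd: "\<bar>?k l \<xi>\<bar> \<le> (1/K) powr (- s - 1) * 1" for l and \<xi> :: 'a
    unfolding abs_mult using cl[of l] s K by (intro mult_mono) (auto intro!: powr_mono2')
  have int_m: "integrable L (\<lambda>l. ?k l \<xi>)" for \<xi> :: 'a
  proof (rule L.integrable_const_bound[where B="(1/K) powr (- s - 1) * 1"])
    show "(\<lambda>l. ?k l \<xi>) \<in> borel_measurable L" by (rule measurable_compose[OF ident_L]) measurable
    show "AE l in L. norm (?k l \<xi>) \<le> (1/K) powr (- s - 1) * 1" using m_bd by auto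
  qed
  have F_hat: "fourier F \<xi> = of_real (m \<xi>) * fourier_sphere (\<lambda>_. 1) \<xi>" for \<xi>
  proof -
    define G where "G p x = wave x \<xi> * of_real (w (fst p) * E p x)" for p x
    let ?E = "\<lambda>p x. exp (- (cl (fst p) * (norm (x - cw (snd p)))\<^sup>2 / 2))"
    interpret PL: pair_sigma_finite ?P "lborel :: 'a measure" ..
    have [measurable]: "(\<lambda>q. G (fst q) (snd q)) \<in> borel_measurable (?P \<Otimes>\<^sub>M lborel)"
    proof -
      have i: "(\<lambda>q. (fst q, snd q)) \<in> measurable (?P \<Otimes>\<^sub>M (lborel :: 'a measure)) ((borel \<Otimes>\<^sub>M borel) \<Otimes>\<^sub>M borel)"
        by (rule measurable_Pair[OF measurable_compose[OF measurable_fst ident]]) measurable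
      have "(\<lambda>q. G (fst q) (snd q)) \<in> borel_measurable ((borel \<Otimes>\<^sub>M borel) \<Otimes>\<^sub>M borel)"
        unfolding G_def E_def by measurable
      from measurable_compose[OF i this] show ?thesis by simp
    qed
    have gauss: "integrable lborel (\<lambda>x::'a. ?E p x) \<and>
        (\<integral>x. ?E p x \<partial>(lborel :: 'a measure)) = (2 * pi / cl (fst p)) powr (?n / 2)" for p :: "real \<times> 'a"
    proof
      let ?g = "\<lambda>x::'a. ?E p x"
      have "integrable lborel (\<lambda>x::'a. exp (- (cl (fst p) / 2 * (norm x)\<^sup>2)))"
        using cl(3)[of "fst p"] by (intro integrable_gaussian) auto
      then have "integrable (distr lborel borel ((+) (- cw (snd p)))) (\<lambda>x::'a. exp (- (cl (fst p) / 2 * (norm x)\<^sup>2)))"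
        by (simp add: lborel_distr_plus)
      then show "integrable lborel ?g" by (subst (asm) integrable_distr_eq) (simp_all add: mult_ac)
      have "complex_of_real (\<integral>x. ?g x \<partial>lborel) = of_real ((2 * pi / cl (fst p)) powr (?n / 2))"
        using fourier_gaussian_translate[OF cl(3)[of "fst p"], of 0 "cw (snd p)"]
        by (simp add: integral_complex_of_real[symmetric] del: integral_complex_of_real)
      then show "(\<integral>x. ?g x \<partial>lborel) = (2 * pi / cl (fst p)) powr (?n / 2)" unfolding of_real_eq_iff .
    qed
    \<comment> \<open>This cancellation is why F is weighted by \<open>sphere_weight\<close>: after
      the Fourier transform, the weight left in l is exactly l^(-s-1), the one that represents
      |xi|^(-2s).\<close>
    have wg: "w l * (2 * pi / cl l) powr (?n / 2) = cl l powr (- s - 1)" for l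
    proof -
      have "(cl l / (2 * pi)) powr (?n / 2) * (2 * pi / cl l) powr (?n / 2) = 1"
        using cl(3)[of l] by (simp flip: powr_mult)
      then show ?thesis unfolding w_def sphere_weight_def by simp
    qed
    have G_norm: "norm (G p x) = w (fst p) * ?E p x" for p x
      using w(1)[of "fst p"] by (simp add: G_def norm_mult E_def)
    have int_G: "integrable (?P \<Otimes>\<^sub>M lborel) (\<lambda>(p, x). G p x)"
    proof (rule PL.Fubini_integrable)
      show "integrable ?P (\<lambda>p. \<integral>x. norm (case (p, x) of (p, x) \<Rightarrow> G p x) \<partial>lborel)"
      proof -
        have "(\<lambda>p. \<integral>x. norm (case (p, x) of (p, x) \<Rightarrow> G p x) \<partial>lborel) = (\<lambda>p. cl (fst p) powr (- s - 1))"
          using gauss by (simp add: G_norm wg fun_eq_iff)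
        moreover have "integrable ?P (\<lambda>p. cl (fst p) powr (- s - 1))"
        proof (rule P.integrable_const_bound[where B="(1/K) powr (- s - 1)"])
          show "(\<lambda>p. cl (fst p) powr (- s - 1)) \<in> borel_measurable ?P"
            by (rule measurable_compose[OF ident]) measurable
        qed (use cl s K in \<open>auto intro!: AE_I2 powr_mono2'\<close>)
        ultimately show ?thesis by simp
      qed
      show "AE p in ?P. integrable lborel (\<lambda>x. case (p, x) of (p, x) \<Rightarrow> G p x)"
      proof (rule AE_I2)
        fix p
        have "integrable lborel (\<lambda>x. w (fst p) * ?E p x)"
          using gauss[of p] by (intro integrable_mult_right) auto
        then have "integrable lborel (\<lambda>x. G p x)"
        proof (rule Bochner_Integration.integrable_bound)
          show "(\<lambda>x. G p x) \<in> borel_measurable lborel" unfolding G_def E_def by measurable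
        qed (simp only: G_norm real_norm_def abs_ge_self AE_I2)
        then show "integrable lborel (\<lambda>x. case (p, x) of (p, x) \<Rightarrow> G p x)" by simp
      qed
    qed (simp add: case_prod_beta)
    have "fourier F \<xi> = (\<integral>x. (\<integral>p. G p x \<partial>?P) \<partial>lborel)" unfolding fourier_def F_def f_def G_def
      by (simp only: integral_complex_of_real[symmetric] integral_mult_right_zero)
    also have "\<dots> = (\<integral>p. (\<integral>x. G p x \<partial>lborel) \<partial>?P)" using PL.Fubini_integral[OF int_G] by simp
    also have "\<dots> = (\<integral>p. (\<lambda>(l, \<omega>). of_real (?k l \<xi>) * wave \<omega> \<xi>) p \<partial>?P)" (is "integral\<^sup>L _ ?l' = integral\<^sup>L _ ?r'")
    proof (rule Bochner_Integration.integral_cong[OF refl])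
      fix p assume "p \<in> space ?P"
      then have "snd p \<in> space ?S" by (auto simp: space_pair_measure)
      note cw_p = cw_eq[OF this]
      have "(\<integral>x. G p x \<partial>lborel) = of_real (w (fst p)) * (\<integral>x. wave x \<xi> * of_real (exp (- (cl (fst p) * (norm (x - snd p))\<^sup>2 / 2))) \<partial>lborel)"
        unfolding G_def E_def cw_p by (subst integral_mult_right_zero[symmetric]) (simp add: mult_ac)
      also have "\<dots> = of_real (w (fst p) * (2 * pi / cl (fst p)) powr (?n / 2) * gauss (cl (fst p)) \<xi>) * exp (- \<i> * of_real (snd p \<bullet> \<xi>))"
        unfolding fourier_gaussian_translate[OF cl(3)] of_real_mult by (simp only: mult_ac)
      finally show "?l' p = ?r' p" unfolding wg by (simp add: case_prod_beta)
    qed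
    also have "\<dots> = (\<integral>l. (\<integral>\<omega>. of_real (?k l \<xi>) * wave \<omega> \<xi> \<partial>?S) \<partial>L)"
    proof (rule LS.integral_fst[symmetric], rule P.integrable_const_bound[where B="(1/K) powr (- s - 1) * 1"])
      show "(\<lambda>(l, \<omega>). of_real (?k l \<xi>) * wave \<omega> \<xi>) \<in> borel_measurable ?P"
        by (rule measurable_compose[OF ident]) measurable
      have "norm (complex_of_real (?k l \<xi>) * wave \<omega> \<xi>) \<le> (1/K) powr (- s - 1) * 1" for l \<omega>
        using m_bd[of l \<xi>] by (simp add: norm_mult)
      then show "AE p in ?P. norm (case p of (l, \<omega>) \<Rightarrow> of_real (?k l \<xi>) * wave \<omega> \<xi>) \<le> (1/K) powr (- s - 1) * 1"
        by (auto intro!: AE_I2)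
    qed
    also have "\<dots> = (\<integral>l. of_real (?k l \<xi>) * fourier_sphere (\<lambda>_. 1) \<xi> \<partial>L)"
      unfolding fourier_sphere_def integral_mult_right_zero by simp
    also have "\<dots> = of_real (m \<xi>) * fourier_sphere (\<lambda>_. 1) \<xi>"
      unfolding m_def integral_mult_left_zero integral_complex_of_real ..
    finally show ?thesis .
  qed

  let ?j = "\<lambda>l (z :: 'a). ennreal (l powr (- s - 1) * exp (- ((norm z)\<^sup>2 / 2 / l)))"
  have m_nn: "ennreal (m \<xi>) = (\<integral>\<^sup>+l\<in>I. ?j l \<xi> \<partial>lborel)" for \<xi>
  proof -
    have "ennreal (m \<xi>) = (\<integral>\<^sup>+l. ennreal (?k l \<xi>) \<partial>L)"
      unfolding m_def by (rule nn_integral_eq_integral[OF int_m, symmetric]) auto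
    also have "\<dots> = (\<integral>\<^sup>+l. indicator I l * ennreal (?k l \<xi>) \<partial>lborel)"
      unfolding L_def by (rule nn_integral_density) measurable
    also have "\<dots> = (\<integral>\<^sup>+l\<in>I. ?j l \<xi> \<partial>lborel)"
      by (intro nn_integral_cong) (auto simp: indicator_def cl_eq)
    finally show ?thesis .
  qed
  have m0: "m \<xi> \<ge> 0" for \<xi> unfolding m_def by (intro integral_nonneg_AE AE_I2) auto
  define c where "c = Gamma s * 2 powr s"
  have G: "Gamma s > 0" using s by (rule Gamma_real_pos)
  then have c: "c > 0" by (simp add: c_def)
  have m_le: "norm \<xi> powr (2 * s) * m \<xi> \<le> c" for \<xi>
  proof (cases "\<xi> = 0")
    case False
    have "ennreal (m \<xi>) \<le> (\<integral>\<^sup>+l\<in>{0<..}. ?j l \<xi> \<partial>lborel)"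
      unfolding m_nn using I by (intro nn_integral_mono) (auto simp: indicator_def)
    also have "\<dots> = ennreal (Gamma s / ((norm \<xi>)\<^sup>2 / 2) powr s)"
      using False s by (intro nn_integral_inverse_Gamma) auto
    also have "((norm \<xi>)\<^sup>2 / 2) powr s = norm \<xi> powr (2 * s) / 2 powr s"
      using powr_powr[of "norm \<xi>" 2 s] by (simp add: powr_divide)
    finally have "m \<xi> \<le> c / norm \<xi> powr (2 * s)"
      using G by (subst (asm) ennreal_le_iff) (auto simp: c_def)
    then show ?thesis using False by (simp add: field_simps)
  qed (use c in simp)

  have sobolev: "(hom_sobolev_norm s F)\<^sup>2 \<le> c * b"
  proof -
    let ?g = "\<lambda>_::'a. 1 :: complex"
    have g: "?g \<in> borel_measurable borel" "\<And>x. norm (?g x) \<le> 1" by auto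
    note [measurable] = borel_measurable_fourier_sphere[OF g] borel_measurable_fourier[OF schwartz_borel_measurable[OF F]]
    define \<sigma> where "\<sigma> \<xi> = (norm (fourier_sphere ?g \<xi>))\<^sup>2" for \<xi>
    have [measurable]: "\<sigma> \<in> borel_measurable borel" unfolding \<sigma>_def[abs_def] by measurable
    define J where "J l = (\<integral>\<^sup>+\<xi>. ennreal (gauss l \<xi> * \<sigma> \<xi>) \<partial>lborel)" for l
    have \<sigma>0: "\<sigma> \<xi> \<ge> 0" for \<xi> by (simp add: \<sigma>_def)
    let ?f = "\<lambda>x. norm x powr (2 * s) * (norm (fourier F x))\<^sup>2"
    let ?K = "\<lambda>l x. ennreal c * (ennreal (l powr (- s - 1)) * indicator I l) * ennreal (gauss l x * \<sigma> x)"
    define h where "h = (\<integral>\<xi>. ?f \<xi> \<partial>lborel)"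
    have h0: "h \<ge> 0" by (simp add: h_def)
    have "ennreal h \<le> (\<integral>\<^sup>+\<xi>. ennreal (?f \<xi>) \<partial>lborel)"
      using norm_integral_le_nn_integral[of lborel "\<lambda>\<xi>. ?f \<xi>"] h0 by (simp add: h_def)
    also have "\<dots> \<le> (\<integral>\<^sup>+\<xi>. \<integral>\<^sup>+l. ?K l \<xi> \<partial>lborel \<partial>lborel)" (is "integral\<^sup>N _ ?l' \<le> integral\<^sup>N _ ?r'")
    proof (rule nn_integral_mono)
      fix \<xi> :: 'a
      \<comment> \<open>One factor m is spent on cancelling |xi|^(2s), by \<open>m_le\<close>. The
        other is kept as an integral over I, which leads back to the quadratic form and hence to
        b.\<close>
      have "?f \<xi> = (norm \<xi> powr (2 * s) * m \<xi>) * (m \<xi> * \<sigma> \<xi>)"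
        unfolding F_hat \<sigma>_def using m0[of \<xi>] by (simp add: norm_mult power_mult_distrib power2_eq_square)
      also have "\<dots> \<le> c * (m \<xi> * \<sigma> \<xi>)" using m0 \<sigma>0 by (intro mult_right_mono m_le mult_nonneg_nonneg)
      finally have "ennreal (?f \<xi>) \<le> ennreal (c * \<sigma> \<xi>) * ennreal (m \<xi>)"
        using c m0[of \<xi>] \<sigma>0[of \<xi>] by (simp add: ennreal_leI mult_ac flip: ennreal_mult)
      also have "\<dots> = (\<integral>\<^sup>+l. ennreal (c * \<sigma> \<xi>) * (?j l \<xi> * indicator I l) \<partial>lborel)"
        unfolding m_nn by (rule nn_integral_cmult[symmetric]) measurable
      also have "\<dots> = (\<integral>\<^sup>+l. ?K l \<xi> \<partial>lborel)"
        using c \<sigma>0[of \<xi>] by (intro nn_integral_cong) (auto simp: indicator_def mult_ac simp flip: ennreal_mult)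
      finally show "?l' \<xi> \<le> ?r' \<xi>" .
    qed
    also have "\<dots> = (\<integral>\<^sup>+l. \<integral>\<^sup>+\<xi>. ?K l \<xi> \<partial>lborel \<partial>lborel)"
      by (intro nn_integral_Fubini sigma_finite_lborel) measurable
    also have "\<dots> = (\<integral>\<^sup>+l. ennreal c * (ennreal (l powr (- s - 1)) * indicator I l) * J l \<partial>lborel)"
      unfolding J_def by (intro nn_integral_cong nn_integral_cmult) measurable
    also have "\<dots> \<le> (\<integral>\<^sup>+l. ennreal (c * (2 * pi) powr ?n) * (ennreal (sphere_weight DIM('a) s l) * e l * indicator I l) \<partial>lborel)" (is "integral\<^sup>N _ ?l' \<le> integral\<^sup>N _ ?r'")
    proof (rule nn_integral_mono)
      fix l :: real
      show "?l' l \<le> ?r' l"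
      proof (cases "l \<in> I")
        case True
        note l = I(1)[OF True]
        \<comment> \<open>For the density 1 the inequality between 2 |g(\<omega>) g(\<omega>')| and
          the sum of squares is an equality, so the Schur test loses nothing here.\<close>
        have "J l \<le> ennreal ((2 * pi * l) powr (?n / 2)) * e l"
          using nn_integral_gaussian_fourier_sphere_le[OF g l] unfolding J_def \<sigma>_def e_def by simp
        then have "ennreal c * ennreal (l powr (- s - 1)) * J l \<le>
           ennreal c * ennreal (l powr (- s - 1)) * (ennreal ((2 * pi * l) powr (?n / 2)) * e l)"
          by (rule mult_left_mono) simp
        also have "\<dots> = ennreal (c * l powr (- s - 1) * (2 * pi * l) powr (?n / 2)) * e l"
          using c by (simp add: ennreal_mult mult.assoc)
        also have "c * l powr (- s - 1) * (2 * pi * l) powr (?n / 2) = c * (2 * pi) powr ?n * sphere_weight DIM('a) s l"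
          using sphere_weight_eq[OF l, of s "DIM('a)"] by (simp only: mult.assoc)
        finally show ?thesis using True c by (simp add: ennreal_mult sphere_weight_nonneg mult.assoc)
      qed simp
    qed
    also have "\<dots> = ennreal (c * (2 * pi) powr ?n) * B"
      unfolding B_eq by (rule nn_integral_cmult) measurable
    finally have "ennreal h \<le> ennreal (c * (2 * pi) powr ?n * b)"
      unfolding B_b using c b0 by (simp flip: ennreal_mult)
    then have "h \<le> c * (2 * pi) powr ?n * b" using c b0 by (subst (asm) ennreal_le_iff) auto
    moreover have "(hom_sobolev_norm s F)\<^sup>2 = (2 * pi) powr (- ?n) * h"
      unfolding hom_sobolev_norm_def h_def[symmetric] using h0 by simp
    ultimately show ?thesis by (simp add: powr_minus divide_inverse[symmetric] pos_divide_le_eq mult_ac)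
  qed

  show thesis
    using that[OF F b0 _ trace] sobolev B_eq unfolding B_b I_def e_def c_def by blast
qed

text \<open>The value that b would have for the full range of l. Tonelli reduces it to the constant
  row sum times the area of the sphere.\<close>

lemma nn_integral_sphere_weight_sphere:
  fixes s :: real
  assumes s: "1 / 2 < s" "s < real DIM('a::euclidean_space) / 2"
  shows "(\<integral>\<^sup>+l\<in>{0<..}. ennreal (sphere_weight DIM('a) s l) * (\<integral>\<^sup>+\<omega>. sphere_kernel l \<omega> \<partial>(sphere_measure :: 'a measure)) \<partial>lborel) =
    ennreal ((sphere_trace_const DIM('a) s)\<^sup>2 * (Gamma s * 2 powr s) * measure (sphere_measure :: 'a measure) (sphere 0 1))"
proof -
  let ?S = "sphere_measure :: 'a measure"
  let ?k = "\<lambda>l \<omega>. ennreal (sphere_weight DIM('a) s l) * sphere_kernel l \<omega> * indicator {0<..} l"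
  interpret S: finite_measure ?S by (rule finite_sphere_measure)
  have G: "Gamma s > 0" using s by (intro Gamma_real_pos) auto
  have m: "sphere_kernel l \<in> borel_measurable ?S" for l by (rule measurable_sphere) measurable
  have "(\<integral>\<^sup>+l\<in>{0<..}. ennreal (sphere_weight DIM('a) s l) * (\<integral>\<^sup>+\<omega>. sphere_kernel l \<omega> \<partial>?S) \<partial>lborel) =
    (\<integral>\<^sup>+l. \<integral>\<^sup>+\<omega>. ?k l \<omega> \<partial>?S \<partial>lborel)" using m by (simp add: nn_integral_cmult nn_integral_multc)
  also have "\<dots> = (\<integral>\<^sup>+\<omega>. \<integral>\<^sup>+l. ?k l \<omega> \<partial>lborel \<partial>?S)"
    by (rule nn_integral_Fubini[OF sigma_finite_lborel sphere_sigma_finite], rule measurable_pair_sphere) measurable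
  also have "\<dots> = (\<integral>\<^sup>+\<omega>. ennreal ((sphere_trace_const DIM('a) s)\<^sup>2 * (Gamma s * 2 powr s)) \<partial>?S)"
    by (intro nn_integral_cong nn_integral_sphere_weight s) simp
  finally show ?thesis using G by (simp add: S.emeasure_eq_measure flip: ennreal_mult)
qed

text \<open>With D the area and c = \<open>Gamma s * 2 powr s\<close>, testing gives b^2 <= D C'^2 c
  b, so b <= D C'^2 c for every truncation. By monotone convergence the same bound holds for c D
  times the square of \<open>sphere_trace_const\<close>, and c D cancels.\<close>

lemma sphere_trace_const_sharp:
  fixes s C :: real
  assumes s: "1 / 2 < s" "s < real DIM('a::euclidean_space) / 2"
    and C: "\<And>f :: 'a \<Rightarrow> complex. schwartz f \<Longrightarrow> sphere_L2_norm f \<le> C * hom_sobolev_norm s f"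
  shows "sphere_trace_const DIM('a) s \<le> C"
proof -
  let ?n = "real DIM('a)" and ?S = "sphere_measure :: 'a measure"
  interpret S: finite_measure ?S by (rule finite_sphere_measure)
  define D where "D = measure ?S (sphere 0 1)"
  have D: "D > 0"
  proof -
    have "2 * pi powr (?n / 2) / Gamma (?n / 2) > 0" by (intro divide_pos_pos Gamma_real_pos) auto
    then show ?thesis
      using emeasure_sphere_measure_space[where 'a='a] unfolding D_def measure_def by simp
  qed
  \<comment> \<open>C may be negative, and the estimate is about to be squared.\<close>
  define C' where "C' = max C 0"
  have C': "C' \<ge> 0" "C \<le> C'" by (auto simp: C'_def)
  define c where "c = Gamma s * 2 powr s"
  have c: "c > 0" using s by (simp add: c_def Gamma_real_pos)
  define e where "e l = (\<integral>\<^sup>+\<omega>. sphere_kernel l \<omega> \<partial>?S)" for l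
  have [measurable]: "e \<in> borel_measurable borel"
    unfolding e_def[abs_def] by (rule S.borel_measurable_nn_integral, rule measurable_pair_sphere) measurable
  let ?I = "\<lambda>k. {1 / real (Suc k)..real (Suc k)}"
  let ?T = "sphere_trace_const DIM('a) s"
  define g where "g l = ennreal (sphere_weight DIM('a) s l) * e l" for l
  have [measurable]: "g \<in> borel_measurable borel" unfolding g_def[abs_def] by measurable
  define u where "u k = (\<integral>\<^sup>+l\<in>(?I k). g l \<partial>lborel)" for k
  have u: "u k \<le> ennreal (D * C'\<^sup>2 * c)" for k
  proof -
    obtain F :: "'a \<Rightarrow> complex" and b where F: "schwartz F" and b: "b \<ge> 0" "ennreal b = u k"
      "b\<^sup>2 \<le> D * (sphere_L2_norm F)\<^sup>2" "(hom_sobolev_norm s F)\<^sup>2 \<le> c * b"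
      using sphere_trace_test_function[of s "real (Suc k)", where 'a='a] s
      unfolding u_def g_def e_def D_def c_def by auto
    have H: "hom_sobolev_norm s F \<ge> 0" by (simp add: hom_sobolev_norm_def)
    have N: "sphere_L2_norm F \<ge> 0" by (simp add: sphere_L2_norm_def)
    have "sphere_L2_norm F \<le> C' * hom_sobolev_norm s F"
      using C[OF F] mult_right_mono[OF C'(2) H] by linarith
    then have "(sphere_L2_norm F)\<^sup>2 \<le> (C' * hom_sobolev_norm s F)\<^sup>2" using N by (rule power_mono)
    also have "\<dots> \<le> C'\<^sup>2 * (c * b)" unfolding power_mult_distrib by (intro mult_left_mono b) auto
    finally have "b\<^sup>2 \<le> D * (C'\<^sup>2 * (c * b))" using b(3) D by (meson mult_left_mono order_trans less_imp_le)
    then have "b * b \<le> b * (D * C'\<^sup>2 * c)" by (simp add: power2_eq_square mult_ac)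
    then have "b \<le> D * C'\<^sup>2 * c" using b(1) D c by (cases "b = 0") (auto simp: mult_le_cancel_left)
    then show ?thesis unfolding b(2)[symmetric] by (rule ennreal_leI)
  qed
  have "(\<lambda>k. \<integral>\<^sup>+l. g l * indicator (?I k) l \<partial>lborel) \<longlonglongrightarrow> (\<integral>\<^sup>+l. g l * indicator {0<..} l \<partial>lborel)"
  proof (rule nn_integral_LIMSEQ)
    show "incseq (\<lambda>k l. g l * indicator (?I k) l)"
    proof (intro incseq_SucI le_funI mult_left_mono)
      fix k and l :: real
      have "(?I k) \<subseteq> (?I (Suc k))" unfolding atLeastatMost_subset_iff by (simp add: divide_simps)
      then show "indicator (?I k) l \<le> (indicator (?I (Suc k)) l :: ennreal)"
        by (auto simp: indicator_def)
    qed simp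
    fix l :: real
    show "(\<lambda>k. g l * indicator (?I k) l) \<longlonglongrightarrow> g l * indicator {0<..} l"
    proof (cases "l > 0")
      case True
      have "eventually (\<lambda>k. 1 / real (Suc k) < l) sequentially"
        by (rule order_tendstoD(2)[OF _ True]) real_asymp
      moreover have "eventually (\<lambda>k. l \<le> real (Suc k)) sequentially"
        by (rule filterlim_at_top[THEN iffD1, rule_format]) real_asymp
      ultimately have "eventually (\<lambda>k. g l * indicator {0<..} l = g l * indicator (?I k) l) sequentially"
        by eventually_elim (use True in \<open>auto simp: indicator_def\<close>)
      then show ?thesis by (rule Lim_transform_eventually[OF tendsto_const])
    next
      case False
      have "l < 1 / real (Suc k)" for k using False by (intro order_le_less_trans[of l 0]) auto
      then have "indicator (?I k) l = (0 :: ennreal)" for k by (simp add: indicator_def not_le)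
      with False show ?thesis by simp
    qed
  qed measurable
  then have "(\<integral>\<^sup>+l. g l * indicator {0<..} l \<partial>lborel) \<le> ennreal (D * C'\<^sup>2 * c)"
    by (rule LIMSEQ_le_const2) (use u[unfolded u_def] in blast)
  then have "ennreal ((?T)\<^sup>2 * c * D) \<le> ennreal (D * C'\<^sup>2 * c)"
    unfolding g_def e_def nn_integral_sphere_weight_sphere[OF s] c_def D_def .
  then have "(?T)\<^sup>2 * c * D \<le> D * C'\<^sup>2 * c"
    using D c by (subst (asm) ennreal_le_iff) auto
  then have "(c * D) * (?T)\<^sup>2 \<le> (c * D) * C'\<^sup>2" by (simp add: mult_ac)
  then have "(?T)\<^sup>2 \<le> C'\<^sup>2"
    using D c by (subst (asm) mult_le_cancel_left_pos) auto
  then have "?T \<le> C'" using C'(1) by (rule power2_le_imp_le)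
  \<comment> \<open>Positivity of the constant rules out C' = 0, so C' is C.\<close>
  then show ?thesis using sphere_trace_const_pos[OF s] by (auto simp: C'_def max_def split: if_splits)
qed

theorem theorem1p4:
  fixes s :: real
  assumes "CARD('n::finite) \<ge> 2"
    and "1 / 2 < s" and "s < real CARD('n) / 2"
  shows "(\<forall>f :: real ^ 'n \<Rightarrow> complex. schwartz f \<longrightarrow> sphere_L2_norm f \<le> sphere_trace_const CARD('n) s * hom_sobolev_norm s f) \<and>
         (\<forall>C < sphere_trace_const CARD('n) s. \<not> (\<forall>f :: real ^ 'n \<Rightarrow> complex. schwartz f \<longrightarrow>
                 sphere_L2_norm f \<le> C * hom_sobolev_norm s f))"
proof (intro conjI allI impI notI)
  have d: "DIM(real ^ 'n) = CARD('n)" by simp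
  have s: "s < real DIM(real ^ 'n) / 2" using assms(3) by simp
  fix f :: "real ^ 'n \<Rightarrow> complex" assume f: "schwartz f"
  obtain B where "\<And>x. norm x ^ 0 * norm (f x) \<le> B" using schwartz_decay[OF f, where k=0] by blast
  then have B: "norm (f x) \<le> B" for x by simp
  show "sphere_L2_norm f \<le> sphere_trace_const CARD('n) s * hom_sobolev_norm s f"
    using sphere_trace_bound[OF schwartz_continuous_on[OF f] B schwartz_integrable[OF f] assms(2) s
        schwartz_sobolev_integrable[OF f]] assms(2) s unfolding d by simp
next
  fix C assume C: "C < sphere_trace_const CARD('n) s"
    and "\<forall>f :: real ^ 'n \<Rightarrow> complex. schwartz f \<longrightarrow> sphere_L2_norm f \<le> C * hom_sobolev_norm s f"
  then have "sphere_trace_const DIM(real ^ 'n) s \<le> C"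
    using assms by (intro sphere_trace_const_sharp) auto
  with C show False by simp
qed

end
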